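(* Let $\mathcal A$ be a unital $C^*$-algebra, $k\in\mathbb N$, and $\alpha=(\alpha_{r,m}:C([-r,r]^m)\to[0,\infty])_{r>0,\,m\in\mathbb N}$ a family of possibly infinite norms. Suppose that $\alpha_{r,1}(\varphi)=\sup_{[-r,r]}|\varphi|$ for all $r>0$ and $\varphi\in C([-r,r])$, that $\alpha$ is finite on polynomials, and that for every $m\ge2$, $P\in\mathcal P_m$, and $b\in\mathcal A^{m-1}$, $$\sup_{\mathbf a\in\mathcal A_{\mathrm{sa},r}^m}\|P_\otimes(\mathbf a)\# b\|\le\alpha_{r,m}(P)\prod_{i=1}^{m-1}\|b_i\|\qquad(r>0).$$ If $f\in C_\alpha^k(\mathbb R)$, then the map $f_{\mathcal A}:\mathcal A_{\mathrm{sa}}\to\mathcal A$, $a\mapsto f(a)$, defined by continuous functional calculus, is ($k$ times continuously Fréchet differentiable, i.e.) in $C^k(\mathcal A_{\mathrm{sa}};\mathcal A)$, and $$\partial_{b_k}\cdots\partial_{b_1}f_{\mathcal A}(a)=\sum_{\pi\in S_k}f^{[k]}_{\mathcal A,\alpha}(\underbrace{a,\ldots,a}_{k+1\text{ times}})\#[b_{\pi(1)},\ldots,b_{\pi(k)}]$$ for all $a,b_1,\ldots,b_k\in\mathcal A_{\mathrm{sa}}$.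
   Context: $\mathcal A_{\mathrm{sa}}:=\{a\in\mathcal A:a^*=a\}$, $\mathcal A_{\mathrm{sa},r}:=\{a\in\mathcal A_{\mathrm{sa}}:\|a\|\le r\}$; $S_k$ is the symmetric group; $\partial_b$ is the directional derivative. A possibly infinite norm on a complex vector space $V$ is a function $\eta:V\to[0,\infty]$ with $\eta(cv)=|c|\eta(v)$ ($0\cdot\infty=0$), $\eta(v+w)\le\eta(v)+\eta(w)$, and $\eta(v)=0$ iff $v=0$. $C(X)$ denotes complex-valued continuous functions; if the domain of $\varphi$ contains $[-r,r]^m$, write $\alpha_{r,m}(\varphi):=\alpha_{r,m}(\varphi|_{[-r,r]^m})$. $\mathcal P_m:=\mathbb C[\lambda_1,\ldots,\lambda_m]$ viewed as functions on $\mathbb R^m$. $\mathcal C_\alpha(\mathbb R^m):=\{\varphi\in C(\mathbb R^m):\alpha_{r,m}(\varphi)<\infty\ \forall r>0\}$ with the topology generated by the seminorms $\alpha_{r,m}$, $r>0$. $\alpha$ is finite on polynomials if $\mathcal P_m\subseteq\mathcal C_\alpha(\mathbb R^m)$ for all $m$; then $C_\alpha(\mathbb R^m)$ is the closure of $\mathcal P_m$ in $\mathcal C_\alpha(\mathbb R^m)$. For $P=\sum_{|\delta|\le d}c_\delta\boldsymbol\lambda^\delta\in\mathcal P_m$ ($m\ge2$), $\mathbf a\in\mathcal A^m$, $b\in\mathcal A^{m-1}$: $P_\otimes(\mathbf a)\# b=\sum_{|\delta|\le d}c_\delta a_1^{\delta_1}b_1\cdots a_{m-1}^{\delta_{m-1}}b_{m-1}a_m^{\delta_m}$.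 Under the stated hypotheses on $\alpha$, for each $\mathbf a\in\mathcal A_{\mathrm{sa}}^m$ and $b\in\mathcal A^{m-1}$, the map $P\mapsto P_\otimes(\mathbf a)\# b$ extends uniquely to a continuous linear map $C_\alpha(\mathbb R^m)\to\mathcal A$; the image of $\varphi$ is denoted $\varphi_{\mathcal A,\alpha}(\mathbf a)\# b$ (the $m$-variate $\alpha$-lexicographic functional calculus). Divided differences: $f^{[0]}:=f$ and, for distinct reals, $f^{[i]}(s_1,\ldots,s_{i+1}):=\frac{f^{[i-1]}(s_1,\ldots,s_i)-f^{[i-1]}(s_1,\ldots,s_{i-1},s_{i+1})}{s_i-s_{i+1}}$, extended continuously to $\mathbb R^{i+1}$ when $f\in C^i(\mathbb R)$. $\mathcal C_\alpha^k(\mathbb R):=\{f\in C^k(\mathbb R):\alpha_{r,i+1}(f^{[i]})<\infty\ \forall r>0,\ 0\le i\le k\}$ with the topology generated by the seminorms $f\mapsto\alpha_{r,i+1}(f^{[i]})$; $C_\alpha^k(\mathbb R)$ is the closure of $\mathbb C[\lambda]$ in $\mathcal C_\alpha^k(\mathbb R)$. If $f\in C_\alpha^k(\mathbb R)$, then $f^{[i]}\in C_\alpha(\mathbb R^{i+1})$ for $0\le i\le k$. *)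

theory Defs
  imports "HOL-Analysis.Analysis" "HOL-Library.Poly_Mapping"
    "HOL-Computational_Algebra.Polynomial" "HOL-Combinatorics.Permutations"
begin

section \<open>Unital C*-algebras\<close>

text \<open>The unit is only required to be a unit; \<open>1 \<noteq> 0\<close> is not assumed, so the zero algebra
  is allowed.\<close>

class cstar_algebra = real_normed_algebra + banach + monoid_mult +
  fixes scaleC :: "complex \<Rightarrow> 'a \<Rightarrow> 'a"  (infixr \<open>*\<^sub>C\<close> 75)
    and star :: "'a \<Rightarrow> 'a"
  assumes scaleC_add_right: "c *\<^sub>C (x + y) = c *\<^sub>C x + c *\<^sub>C y"
    and scaleC_add_left: "(c + d) *\<^sub>C x = c *\<^sub>C x + d *\<^sub>C x"
    and scaleC_scaleC: "c *\<^sub>C d *\<^sub>C x = (c * d) *\<^sub>C x"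
    and scaleC_of_real: "complex_of_real t *\<^sub>C x = t *\<^sub>R x"
    and mult_scaleC_left: "(c *\<^sub>C x) * y = c *\<^sub>C (x * y)"
    and mult_scaleC_right: "x * (c *\<^sub>C y) = c *\<^sub>C (x * y)"
    and norm_scaleC: "norm (c *\<^sub>C x) = cmod c * norm x"
    and star_star: "star (star x) = x"
    and star_add: "star (x + y) = star x + star y"
    and star_scaleC: "star (c *\<^sub>C x) = cnj c *\<^sub>C star x"
    and star_mult: "star (x * y) = star y * star x"
    and cstar_identity: "norm (star x * x) = (norm x)\<^sup>2"

lemma star_scaleR: "star (t *\<^sub>R x) = t *\<^sub>R star (x :: 'a :: cstar_algebra)"
  by (metis complex_cnj_complex_of_real scaleC_of_real star_scaleC)

lemma star_zero [simp]: "star (0 :: 'a :: cstar_algebra) = 0"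
  using star_scaleR[of 0] by simp

lemma star_minus: "star (- x) = - star (x :: 'a :: cstar_algebra)"
  using star_scaleR[of "-1"] by simp

lemma star_diff: "star (x - y) = star x - star (y :: 'a :: cstar_algebra)"
  using star_add[of x "- y"] by (simp add: star_minus)

text \<open>The real normed space of self-adjoint elements.\<close>

typedef (overloaded) 'a sa = "{a :: 'a :: cstar_algebra. star a = a}"
  morphisms sa_elem Abs_sa
  by (rule exI[of _ 0]) simp

setup_lifting type_definition_sa

instantiation sa :: (cstar_algebra) real_normed_vector
begin

lift_definition zero_sa :: "'a sa" is 0 by simp
lift_definition plus_sa :: "'a sa \<Rightarrow> 'a sa \<Rightarrow> 'a sa" is "(+)" by (simp add: star_add)
lift_definition minus_sa :: "'a sa \<Rightarrow> 'a sa \<Rightarrow> 'a sa" is "(-)" by (simp add: star_diff)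
lift_definition uminus_sa :: "'a sa \<Rightarrow> 'a sa" is uminus by (simp add: star_minus)
lift_definition scaleR_sa :: "real \<Rightarrow> 'a sa \<Rightarrow> 'a sa" is "(*\<^sub>R)" by (simp add: star_scaleR)
lift_definition norm_sa :: "'a sa \<Rightarrow> real" is norm .

definition dist_sa :: "'a sa \<Rightarrow> 'a sa \<Rightarrow> real"
  where "dist_sa a b = norm (a - b)"
definition sgn_sa :: "'a sa \<Rightarrow> 'a sa"
  where "sgn_sa a = inverse (norm a) *\<^sub>R a"
definition uniformity_sa :: "('a sa \<times> 'a sa) filter"
  where "uniformity_sa = (INF e\<in>{0 <..}. principal {(x, y). dist x y < e})"
definition open_sa :: "'a sa set \<Rightarrow> bool"
  where "open_sa U \<longleftrightarrow> (\<forall>x\<in>U. eventually (\<lambda>(x', y). x' = x \<longrightarrow> y \<in> U) uniformity)"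

instance
  by standard
    ((transfer, simp add: algebra_simps norm_triangle_ineq; fail)
      | simp add: dist_sa_def sgn_sa_def uniformity_sa_def open_sa_def)+

end

section \<open>Continuous functional calculus\<close>

text \<open>A function on a set \<open>X\<close> is represented by a function that is \<open>undefined\<close> outside \<open>X\<close>, so
  that restrictions are given by \<open>restrict\<close>.\<close>

definition Cfun :: "'x :: topological_space set \<Rightarrow> ('x \<Rightarrow> complex) set"
  where "Cfun X = {\<phi> \<in> extensional X. continuous_on X \<phi>}"

definition spectrum :: "'a :: cstar_algebra \<Rightarrow> complex set"
  where "spectrum a = {z. \<not> (\<exists>y. (a - z *\<^sub>C 1) * y = 1 \<and> y * (a - z *\<^sub>C 1) = 1)}"

definition unital_star_hom :: "'x :: topological_space set \<Rightarrow> (('x \<Rightarrow> complex) \<Rightarrow> 'a :: cstar_algebra) \<Rightarrow> bool"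
  where "unital_star_hom X \<Phi> \<longleftrightarrow>
    \<Phi> (\<lambda>x\<in>X. 1) = 1 \<and>
    (\<forall>\<phi>\<in>Cfun X. \<forall>\<psi>\<in>Cfun X. \<Phi> (\<lambda>x\<in>X. \<phi> x + \<psi> x) = \<Phi> \<phi> + \<Phi> \<psi>) \<and>
    (\<forall>\<phi>\<in>Cfun X. \<forall>\<psi>\<in>Cfun X. \<Phi> (\<lambda>x\<in>X. \<phi> x * \<psi> x) = \<Phi> \<phi> * \<Phi> \<psi>) \<and>
    (\<forall>\<phi>\<in>Cfun X. \<forall>c. \<Phi> (\<lambda>x\<in>X. c * \<phi> x) = c *\<^sub>C \<Phi> \<phi>) \<and>
    (\<forall>\<phi>\<in>Cfun X. \<Phi> (\<lambda>x\<in>X. cnj (\<phi> x)) = star (\<Phi> \<phi>))"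

definition cfc :: "'a :: cstar_algebra \<Rightarrow> (complex \<Rightarrow> complex) \<Rightarrow> 'a"
  where "cfc a = (THE \<Phi>. \<Phi> \<in> extensional (Cfun (spectrum a)) \<and>
    unital_star_hom (spectrum a) \<Phi> \<and> \<Phi> (\<lambda>z\<in>spectrum a. z) = a)"

text \<open>The spectrum of a self-adjoint element is a set of real numbers, represented in the
  complex plane; \<open>\<lambda>z. f (Re z)\<close> is \<open>f\<close> on it.\<close>

definition op_fun :: "(real \<Rightarrow> complex) \<Rightarrow> 'a :: cstar_algebra sa \<Rightarrow> 'a"
  where "op_fun f a = cfc (sa_elem a) (\<lambda>z\<in>spectrum (sa_elem a). f (Re z))"

section \<open>Differentiability\<close>

text \<open>The space of bounded \<open>i\<close>-linear maps: an argument \<open>b\<close> encodes the tuple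
  \<open>(b 0, \<dots>, b (i - 1))\<close>.\<close>

definition bounded_multilinear :: "nat \<Rightarrow> ((nat \<Rightarrow> 'v :: real_normed_vector) \<Rightarrow> 'w :: real_normed_vector) \<Rightarrow> bool"
  where "bounded_multilinear i M \<longleftrightarrow>
    (\<forall>b b'. (\<forall>j<i. b j = b' j) \<longrightarrow> M b = M b') \<and>
    (\<forall>b. \<forall>j<i. linear (\<lambda>v. M (b(j := v)))) \<and>
    (\<exists>K. \<forall>b. norm (M b) \<le> K * (\<Prod>j<i. norm (b j)))"

definition multilinear_norm :: "nat \<Rightarrow> ((nat \<Rightarrow> 'v :: real_normed_vector) \<Rightarrow> 'w :: real_normed_vector) \<Rightarrow> real"
  where "multilinear_norm i M = (SUP b\<in>{b. \<forall>j<i. norm (b j) \<le> 1}. norm (M b))"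

text \<open>\<open>D i\<close> is the \<open>i\<close>-th Frechet derivative of \<open>F\<close>. It takes values in the bounded \<open>i\<close>-linear
  maps, and \<open>D (i + 1) a\<close> is the Frechet derivative of \<open>D i\<close> at \<open>a\<close> with respect to the operator
  norm, under the identification of \<open>(i + 1)\<close>-linear maps with linear maps into \<open>i\<close>-linear maps,
  where the new argument comes first.\<close>

definition frechet_derivatives ::
    "nat \<Rightarrow> ('v :: real_normed_vector \<Rightarrow> 'w :: real_normed_vector) \<Rightarrow> (nat \<Rightarrow> 'v \<Rightarrow> (nat \<Rightarrow> 'v) \<Rightarrow> 'w) \<Rightarrow> bool"
  where "frechet_derivatives k F D \<longleftrightarrow>
    (\<forall>a b. D 0 a b = F a) \<and>
    (\<forall>i\<le>k. \<forall>a. bounded_multilinear i (D i a)) \<and>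
    (\<forall>i<k. \<forall>a. ((\<lambda>h. multilinear_norm i
        (\<lambda>b. D i (a + h) b - D i a b - D (Suc i) a (case_nat h b)) / norm h) \<longlongrightarrow> 0) (at 0))"

definition Ck_frechet :: "nat \<Rightarrow> ('v :: real_normed_vector \<Rightarrow> 'w :: real_normed_vector) \<Rightarrow> bool"
  where "Ck_frechet k F \<longleftrightarrow> (\<exists>D. frechet_derivatives k F D \<and>
    (\<forall>i\<le>k. \<forall>a. ((\<lambda>x. multilinear_norm i (\<lambda>b. D i x b - D i a b)) \<longlongrightarrow> 0) (at a)))"

definition dir_deriv :: "'v \<Rightarrow> ('v :: real_normed_vector \<Rightarrow> 'w :: real_normed_vector) \<Rightarrow> 'v \<Rightarrow> 'w"
  where "dir_deriv b F a = vector_derivative (\<lambda>t. F (a + t *\<^sub>R b)) (at 0)"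

text \<open>\<open>iter_dir_deriv k b F\<close> applies \<open>dir_deriv (b 0)\<close> first and \<open>dir_deriv (b (k - 1))\<close> last.\<close>

definition iter_dir_deriv :: "nat \<Rightarrow> (nat \<Rightarrow> 'v) \<Rightarrow> ('v :: real_normed_vector \<Rightarrow> 'w :: real_normed_vector) \<Rightarrow> 'v \<Rightarrow> 'w"
  where "iter_dir_deriv k b F = fold (\<lambda>i. dir_deriv (b i)) [0..<k] F"

primrec Ck_real :: "nat \<Rightarrow> (real \<Rightarrow> complex) \<Rightarrow> bool"
  where
    "Ck_real 0 f \<longleftrightarrow> continuous_on UNIV f"
  | "Ck_real (Suc k) f \<longleftrightarrow>
      (\<forall>x. f differentiable (at x)) \<and> Ck_real k (\<lambda>x. vector_derivative f (at x))"

section \<open>Families of norms\<close>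

text \<open>Points of the \<open>m\<close>-dimensional real space are extensional functions on \<open>{..<m}\<close>; the topology
  is inherited from the product topology on \<open>nat \<Rightarrow> real\<close>.\<close>

definition rspace :: "nat \<Rightarrow> (nat \<Rightarrow> real) set"
  where "rspace m = {..<m} \<rightarrow>\<^sub>E UNIV"

definition cube :: "real \<Rightarrow> nat \<Rightarrow> (nat \<Rightarrow> real) set"
  where "cube r m = {..<m} \<rightarrow>\<^sub>E {-r..r}"

text \<open>In \<^typ>\<open>ennreal\<close>, \<open>0 * \<infinity> = 0\<close>.\<close>

definition inf_norm_on :: "'x :: topological_space set \<Rightarrow> (('x \<Rightarrow> complex) \<Rightarrow> ennreal) \<Rightarrow> bool"
  where "inf_norm_on X \<eta> \<longleftrightarrow>
    (\<forall>\<phi>\<in>Cfun X. \<forall>c. \<eta> (\<lambda>x\<in>X. c * \<phi> x) = ennreal (cmod c) * \<eta> \<phi>) \<and>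
    (\<forall>\<phi>\<in>Cfun X. \<forall>\<psi>\<in>Cfun X. \<eta> (\<lambda>x\<in>X. \<phi> x + \<psi> x) \<le> \<eta> \<phi> + \<eta> \<psi>) \<and>
    (\<forall>\<phi>\<in>Cfun X. \<eta> \<phi> = 0 \<longleftrightarrow> \<phi> = (\<lambda>x\<in>X. 0))"

type_synonym norm_family = "real \<Rightarrow> nat \<Rightarrow> ((nat \<Rightarrow> real) \<Rightarrow> complex) \<Rightarrow> ennreal"

definition seminorm :: "norm_family \<Rightarrow> real \<Rightarrow> nat \<Rightarrow> ((nat \<Rightarrow> real) \<Rightarrow> complex) \<Rightarrow> ennreal"
  where "seminorm \<alpha> r m \<phi> = \<alpha> r m (restrict \<phi> (cube r m))"

text \<open>The topology on a vector space \<open>V\<close> of functions on \<open>X\<close> generated by the seminorms \<open>p i\<close>,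
  \<open>i \<in> I\<close>.\<close>

definition seminorm_topology ::
    "'x set \<Rightarrow> ('x \<Rightarrow> complex) set \<Rightarrow> 'i set \<Rightarrow> ('i \<Rightarrow> ('x \<Rightarrow> complex) \<Rightarrow> ennreal) \<Rightarrow> ('x \<Rightarrow> complex) topology"
  where "seminorm_topology X V I p = topology_generated_by
    {{\<psi>\<in>V. p i (\<lambda>x\<in>X. \<psi> x - \<phi> x) < ennreal \<epsilon>} | i \<phi> \<epsilon>. i \<in> I \<and> \<phi> \<in> V \<and> 0 < \<epsilon>}"

section \<open>Lexicographic functional calculus\<close>

text \<open>Polynomials in the variables \<open>\<lambda>\<^sub>i\<close>, \<open>i < m\<close>: finitely supported maps from exponents to
  coefficients.\<close>

definition mpolys :: "nat \<Rightarrow> ((nat \<Rightarrow>\<^sub>0 nat) \<Rightarrow>\<^sub>0 complex) set"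
  where "mpolys m = {P. \<forall>\<delta>\<in>Poly_Mapping.keys P. Poly_Mapping.keys \<delta> \<subseteq> {..<m}}"

definition mpoly_fun :: "nat \<Rightarrow> ((nat \<Rightarrow>\<^sub>0 nat) \<Rightarrow>\<^sub>0 complex) \<Rightarrow> (nat \<Rightarrow> real) \<Rightarrow> complex"
  where "mpoly_fun m P = (\<lambda>s\<in>rspace m.
    \<Sum>\<delta>\<in>Poly_Mapping.keys P. Poly_Mapping.lookup P \<delta> *
      (\<Prod>i<m. complex_of_real (s i) ^ Poly_Mapping.lookup \<delta> i))"

definition mpoly_tensor ::
    "nat \<Rightarrow> ((nat \<Rightarrow>\<^sub>0 nat) \<Rightarrow>\<^sub>0 complex) \<Rightarrow> (nat \<Rightarrow> 'a) \<Rightarrow> (nat \<Rightarrow> 'a) \<Rightarrow> 'a :: cstar_algebra"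
  where "mpoly_tensor m P a b = (\<Sum>\<delta>\<in>Poly_Mapping.keys P. Poly_Mapping.lookup P \<delta> *\<^sub>C
    (prod_list (map (\<lambda>i. a i ^ Poly_Mapping.lookup \<delta> i * b i) [0..<m - 1]) *
      a (m - 1) ^ Poly_Mapping.lookup \<delta> (m - 1)))"

definition finite_seminorm_funs :: "norm_family \<Rightarrow> nat \<Rightarrow> ((nat \<Rightarrow> real) \<Rightarrow> complex) set"
  where "finite_seminorm_funs \<alpha> m = {\<phi> \<in> Cfun (rspace m). \<forall>r>0. seminorm \<alpha> r m \<phi> < \<infinity>}"

definition finite_seminorm_top :: "norm_family \<Rightarrow> nat \<Rightarrow> ((nat \<Rightarrow> real) \<Rightarrow> complex) topology"
  where "finite_seminorm_top \<alpha> m =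
    seminorm_topology (rspace m) (finite_seminorm_funs \<alpha> m) {0<..} (\<lambda>r. seminorm \<alpha> r m)"

definition finite_on_polynomials :: "norm_family \<Rightarrow> bool"
  where "finite_on_polynomials \<alpha> \<longleftrightarrow>
    (\<forall>m\<ge>1. mpoly_fun m ` mpolys m \<subseteq> finite_seminorm_funs \<alpha> m)"

definition C_alpha :: "norm_family \<Rightarrow> nat \<Rightarrow> ((nat \<Rightarrow> real) \<Rightarrow> complex) set"
  where "C_alpha \<alpha> m = finite_seminorm_top \<alpha> m closure_of (mpoly_fun m ` mpolys m)"

definition lex_extension :: "norm_family \<Rightarrow> nat \<Rightarrow> (nat \<Rightarrow> 'a) \<Rightarrow> (nat \<Rightarrow> 'a) \<Rightarrow>
    (((nat \<Rightarrow> real) \<Rightarrow> complex) \<Rightarrow> 'a :: cstar_algebra) \<Rightarrow> bool"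
  where "lex_extension \<alpha> m a b T \<longleftrightarrow>
    (\<forall>\<phi>\<in>C_alpha \<alpha> m. \<forall>\<psi>\<in>C_alpha \<alpha> m. T (\<lambda>s\<in>rspace m. \<phi> s + \<psi> s) = T \<phi> + T \<psi>) \<and>
    (\<forall>\<phi>\<in>C_alpha \<alpha> m. \<forall>c. T (\<lambda>s\<in>rspace m. c * \<phi> s) = c *\<^sub>C T \<phi>) \<and>
    continuous_map (subtopology (finite_seminorm_top \<alpha> m) (C_alpha \<alpha> m)) euclidean T \<and>
    (\<forall>P\<in>mpolys m. T (mpoly_fun m P) = mpoly_tensor m P a b)"

definition lex_calculus :: "norm_family \<Rightarrow> nat \<Rightarrow> ((nat \<Rightarrow> real) \<Rightarrow> complex) \<Rightarrow>
    (nat \<Rightarrow> 'a) \<Rightarrow> (nat \<Rightarrow> 'a) \<Rightarrow> 'a :: cstar_algebra"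
  where "lex_calculus \<alpha> m \<phi> a b =
    (THE T. T \<in> extensional (C_alpha \<alpha> m) \<and> lex_extension \<alpha> m a b T) \<phi>"

section \<open>Divided differences\<close>

text \<open>\<open>dd f i s\<close> depends on \<open>s 0, \<dots>, s i\<close> only and is meaningful only when these are distinct.\<close>

primrec dd :: "(real \<Rightarrow> complex) \<Rightarrow> nat \<Rightarrow> (nat \<Rightarrow> real) \<Rightarrow> complex"
  where
    "dd f 0 s = f (s 0)"
  | "dd f (Suc i) s =
      (dd f i s - dd f i (s(i := s (Suc i)))) / complex_of_real (s i - s (Suc i))"

definition divided_difference :: "(real \<Rightarrow> complex) \<Rightarrow> nat \<Rightarrow> (nat \<Rightarrow> real) \<Rightarrow> complex"
  where "divided_difference f i = (THE g. g \<in> Cfun (rspace (Suc i)) \<and>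
    (\<forall>s\<in>rspace (Suc i). inj_on s {..i} \<longrightarrow> g s = dd f i s))"

definition finite_seminorm_Ck :: "norm_family \<Rightarrow> nat \<Rightarrow> (real \<Rightarrow> complex) set"
  where "finite_seminorm_Ck \<alpha> k = {f. Ck_real k f \<and>
    (\<forall>r>0. \<forall>i\<le>k. seminorm \<alpha> r (Suc i) (divided_difference f i) < \<infinity>)}"

definition finite_seminorm_Ck_top :: "norm_family \<Rightarrow> nat \<Rightarrow> (real \<Rightarrow> complex) topology"
  where "finite_seminorm_Ck_top \<alpha> k =
    seminorm_topology UNIV (finite_seminorm_Ck \<alpha> k) ({0<..} \<times> {..k})
      (\<lambda>(r, i) f. seminorm \<alpha> r (Suc i) (divided_difference f i))"

definition Ck_alpha :: "norm_family \<Rightarrow> nat \<Rightarrow> (real \<Rightarrow> complex) set"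
  where "Ck_alpha \<alpha> k = finite_seminorm_Ck_top \<alpha> k closure_of
    {\<lambda>x. poly p (complex_of_real x) | p. True}"

end

theory Submission
  imports Defs "HOL-Computational_Algebra.Fundamental_Theorem_Algebra"
    "HOL-Combinatorics.Multiset_Permutations"
begin

text \<open>
  For a polynomial \<open>p\<close> everything is algebra. The \<open>i\<close>-th derivative of \<open>a \<mapsto> a ^ n\<close> in the directions
  \<open>b 1, \<dots>, b i\<close> is the sum, over all orders of the directions, of all words with \<open>n\<close> letters that
  contain the \<open>b j\<close> in this order and \<open>a\<close> otherwise. The exponents of \<open>a\<close> in these words are those of
  the complete homogeneous symmetric polynomial of degree \<open>n - i\<close> in \<open>i + 1\<close> variables, which is the
  divided difference of order \<open>i\<close> of \<open>x ^ n\<close>. So the derivative is a sum over permutations of tensor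
  evaluations of \<open>p\<^bsup>[i]\<^esup>\<close> (\<open>smooth_jet_poly\<close>, \<open>mpoly_tensor_divided_difference_mpoly\<close>).

  In general, \<open>f\<close> is a limit of polynomials \<open>p\<close> such that \<open>p\<^bsup>[i]\<^esup>\<close> tends to \<open>f\<^bsup>[i]\<^esup>\<close> in the
  norms \<open>\<alpha>\<close> for all \<open>i \<le> k\<close>. The hypothesis on tensor evaluations turns this into convergence of the
  \<open>i\<close>-th derivatives of \<open>p(a)\<close>, uniformly for \<open>a\<close> in a ball and for directions in the unit ball,
  towards the asserted formula (\<open>lex_jet_approx\<close>). For \<open>i = 0\<close> the supremum norm and the
  contractivity of the continuous functional calculus play this role. A uniform limit of \<open>C\<^sup>k\<close> maps
  whose derivatives up to order \<open>k\<close> converge uniformly is \<open>C\<^sup>k\<close>, and its derivatives are the limits;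
  the mean value inequality gives this with operator norms on the multilinear maps
  (\<open>Ck_frechet_limit\<close>, \<open>iter_dir_deriv_limit\<close>).

  Three objects are defined by descriptions, and existence and uniqueness have to be shown before
  anything can be said about them.

  \<^item> The continuous functional calculus of a self-adjoint element (\<open>is_cfc_value_cfc\<close>). Its core is
    that the norm of a self-adjoint element is at most its spectral radius
    (\<open>norm_le_of_spectrum_le\<close>). The proof is elementary: it averages resolvents over roots of
    unity.

  \<^item> The continuous extension of the divided differences of a \<open>C\<^sup>k\<close> function, by an iterated
    Hermite--Genocchi integral (\<open>hermite_genocchi_eq_dd\<close>).

  \<^item> The lexicographic functional calculus, by extension from the dense subspace of polynomials
    (\<open>lex_calculus_eq_extension\<close>).
\<close>

section \<open>Completion of a dense family of values\<close>

text \<open>Both functional calculi extend a map \<open>v\<close> that is known on polynomials only. Here \<open>e p\<close> is the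
  distance of the polynomial \<open>p\<close> from the function to be reached, and the value there is the limit
  of \<open>v p\<close> as \<open>e p\<close> tends to 0. The bound that characterises this limit also yields linearity and
  continuity of the extension.\<close>

lemma unique_limit_of_values:
  fixes v :: "'p \<Rightarrow> 'a :: banach" and e :: "'p \<Rightarrow> real"
  assumes dist: "\<And>p q. p \<in> S \<Longrightarrow> q \<in> S \<Longrightarrow> norm (v p - v q) \<le> K * (e p + e q)"
    and dense: "\<And>\<epsilon>. 0 < \<epsilon> \<Longrightarrow> \<exists>p\<in>S. e p < \<epsilon>"
    and nonneg: "\<And>p. p \<in> S \<Longrightarrow> 0 \<le> e p" and K: "0 \<le> K"
  shows "\<exists>!x. \<forall>p\<in>S. norm (x - v p) \<le> K * e p"
proof (rule ex_ex1I)
  have "\<forall>n. \<exists>p\<in>S. e p < inverse (real (Suc n))"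
    using dense by simp
  then obtain q where q: "\<And>n. q n \<in> S" "\<And>n. e (q n) < inverse (real (Suc n))"
    by metis
  have e0: "(\<lambda>n. e (q n)) \<longlonglongrightarrow> 0"
  proof (rule tendsto_sandwich[OF _ _ tendsto_const LIMSEQ_inverse_real_of_nat])
    show "\<forall>\<^sub>F n in sequentially. 0 \<le> e (q n)" using nonneg q(1) by simp
    show "\<forall>\<^sub>F n in sequentially. e (q n) \<le> inverse (real (Suc n))"
      using q(2) by (simp add: less_imp_le)
  qed
  have "Cauchy (\<lambda>n. v (q n))"
  proof (rule CauchyI)
    fix \<epsilon> :: real assume "0 < \<epsilon>"
    then have "0 < \<epsilon> / (2 * (K + 1))" using K by simp
    then obtain M where M: "\<And>n. M \<le> n \<Longrightarrow> e (q n) < \<epsilon> / (2 * (K + 1))"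
      using order_tendstoD(2)[OF e0] unfolding eventually_sequentially by meson
    have "norm (v (q m) - v (q n)) < \<epsilon>" if "M \<le> m" "M \<le> n" for m n
    proof -
      have "norm (v (q m) - v (q n)) \<le> K * (e (q m) + e (q n))"
        by (rule dist) (use q in auto)
      also have "\<dots> \<le> (K + 1) * (e (q m) + e (q n))"
        using nonneg q(1) by (intro mult_right_mono) auto
      also have "\<dots> < (K + 1) * (\<epsilon> / (2 * (K + 1)) + \<epsilon> / (2 * (K + 1)))"
        using M that K by (intro mult_strict_left_mono add_strict_mono) auto
      also have "\<dots> = \<epsilon>" using K by (simp add: divide_simps)
      finally show ?thesis .
    qed
    then show "\<exists>M. \<forall>m\<ge>M. \<forall>n\<ge>M. norm (v (q m) - v (q n)) < \<epsilon>" by blast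
  qed
  then obtain x where x: "(\<lambda>n. v (q n)) \<longlonglongrightarrow> x"
    using convergent_eq_Cauchy by blast
  have "norm (x - v p) \<le> K * e p" if p: "p \<in> S" for p
  proof -
    have "(\<lambda>n. norm (v (q n) - v p)) \<longlonglongrightarrow> norm (x - v p)"
      by (intro tendsto_intros x)
    moreover have "(\<lambda>n. K * (e (q n) + e p)) \<longlonglongrightarrow> K * (0 + e p)"
      by (intro tendsto_intros e0)
    ultimately show ?thesis
      using dist[OF q(1) p] by (intro LIMSEQ_le[of _ "norm (x - v p)" _ "K * e p"]) auto
  qed
  then show "\<exists>x. \<forall>p\<in>S. norm (x - v p) \<le> K * e p" by blast
next
  fix x y assume xy: "\<forall>p\<in>S. norm (x - v p) \<le> K * e p" "\<forall>p\<in>S. norm (y - v p) \<le> K * e p"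
  have "norm (x - y) \<le> 0 + \<epsilon>" if "0 < \<epsilon>" for \<epsilon>
  proof -
    obtain p where p: "p \<in> S" "e p < \<epsilon> / (2 * (K + 1))"
      using dense[of "\<epsilon> / (2 * (K + 1))"] \<open>0 < \<epsilon>\<close> K by auto
    have "norm (x - y) \<le> norm (x - v p) + norm (y - v p)"
      by (metis dist_norm dist_triangle2)
    also have "\<dots> \<le> 2 * (K * e p)" using xy p by fastforce
    also have "\<dots> \<le> 2 * ((K + 1) * e p)" using nonneg[OF p(1)] by (intro mult_left_mono mult_right_mono) auto
    also have "\<dots> \<le> \<epsilon>" using p(2) K by (simp add: field_simps)
    finally show ?thesis by simp
  qed
  then have "norm (x - y) \<le> 0" by (rule field_le_epsilon)
  then show "x = y" by simp
qed

section \<open>Invertibility and the spectrum\<close>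

lemma scaleC_zero_left [simp]: "0 *\<^sub>C (x :: 'a :: cstar_algebra) = 0"
  using scaleC_of_real[of 0 x] by simp

lemma scaleC_one [simp]: "1 *\<^sub>C (x :: 'a :: cstar_algebra) = x"
  using scaleC_of_real[of 1 x] by simp

lemma scaleC_zero_right [simp]: "c *\<^sub>C (0 :: 'a :: cstar_algebra) = 0"
  using scaleC_add_right[of c 0 0] by simp

lemma scaleC_minus_left: "(- c) *\<^sub>C (x :: 'a :: cstar_algebra) = - (c *\<^sub>C x)"
  using scaleC_add_left[of c "- c" x] by (simp add: eq_neg_iff_add_eq_0 add.commute)

lemma scaleC_minus_right: "c *\<^sub>C (- (x :: 'a :: cstar_algebra)) = - (c *\<^sub>C x)"
  using scaleC_add_right[of c x "- x"] by (simp add: eq_neg_iff_add_eq_0 add.commute)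

lemma scaleC_diff_left: "(c - d) *\<^sub>C (x :: 'a :: cstar_algebra) = c *\<^sub>C x - d *\<^sub>C x"
  using scaleC_add_left[of c "- d" x] by (simp add: scaleC_minus_left)

lemma scaleC_diff_right: "c *\<^sub>C ((x :: 'a :: cstar_algebra) - y) = c *\<^sub>C x - c *\<^sub>C y"
  using scaleC_add_right[of c x "- y"] by (simp add: scaleC_minus_right)

lemma scaleC_sum_right: "c *\<^sub>C (\<Sum>i\<in>I. x i :: 'a :: cstar_algebra) = (\<Sum>i\<in>I. c *\<^sub>C x i)"
  by (induction I rule: infinite_finite_induct) (auto simp: scaleC_add_right)

lemma scaleR_eq_scaleC: "t *\<^sub>R x = complex_of_real t *\<^sub>C (x :: 'a :: cstar_algebra)"
  by (simp add: scaleC_of_real)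

lemma scaleC_scaleR: "c *\<^sub>C (t *\<^sub>R x) = t *\<^sub>R (c *\<^sub>C (x :: 'a :: cstar_algebra))"
  by (simp add: scaleR_eq_scaleC scaleC_scaleC mult.commute)

lemma bounded_linear_scaleC: "bounded_linear (\<lambda>x :: 'a :: cstar_algebra. c *\<^sub>C x)"
  by (rule bounded_linear_intro[where K = "cmod c"])
    (simp_all add: scaleC_add_right scaleC_scaleR norm_scaleC)

lemma star_one [simp]: "star (1 :: 'a :: cstar_algebra) = 1"
  by (metis mult.left_neutral mult.right_neutral star_mult star_star)

lemma star_power: "star ((a :: 'a :: cstar_algebra) ^ n) = star a ^ n"
  by (induction n) (simp_all add: star_mult power_commutes)

lemma norm_star [simp]: "norm (star (x :: 'a :: cstar_algebra)) = norm x"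
proof -
  have le: "norm y \<le> norm (star y)" for y :: 'a
  proof (cases "y = 0")
    case False
    have "norm y * norm y \<le> norm (star y) * norm y"
      using cstar_identity[of y] norm_mult_ineq[of "star y" y] by (simp add: power2_eq_square)
    then show ?thesis using False by simp
  qed simp
  from le[of x] le[of "star x"] show ?thesis by (simp add: star_star)
qed

lemma norm_power_le:
  fixes x :: "'a :: cstar_algebra"
  shows "norm (x ^ n) \<le> norm (1 :: 'a) * norm x ^ n"
proof (induction n)
  case (Suc n)
  have "norm (x ^ Suc n) \<le> norm x * norm (x ^ n)" by (simp add: norm_mult_ineq)
  also have "\<dots> \<le> norm x * (norm (1 :: 'a) * norm x ^ n)" by (intro mult_left_mono Suc) simp
  finally show ?case by (simp add: mult_ac)
qed simp

definition invertible_elem :: "'a :: cstar_algebra \<Rightarrow> bool"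
  where "invertible_elem x \<longleftrightarrow> (\<exists>y. x * y = 1 \<and> y * x = 1)"

lemma spectrum_iff: "z \<in> spectrum a \<longleftrightarrow> \<not> invertible_elem (a - z *\<^sub>C 1)"
  by (simp add: spectrum_def invertible_elem_def)

lemma invertible_elem_mult:
  "invertible_elem x \<Longrightarrow> invertible_elem y \<Longrightarrow> invertible_elem (x * y)"
  unfolding invertible_elem_def by (metis mult.assoc mult.left_neutral)

lemma invertible_elem_scaleC:
  assumes "c \<noteq> 0" "invertible_elem (x :: 'a :: cstar_algebra)"
  shows "invertible_elem (c *\<^sub>C x)"
proof -
  obtain y where "x * y = 1" "y * x = 1" using assms(2) by (auto simp: invertible_elem_def)
  then show ?thesis unfolding invertible_elem_def using assms(1)
    by (intro exI[of _ "inverse c *\<^sub>C y"]) (simp add: mult_scaleC_left mult_scaleC_right scaleC_scaleC)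
qed

lemma invertible_elem_one_minus:
  fixes x :: "'a :: cstar_algebra"
  assumes "norm x < 1"
  shows "invertible_elem (1 - x)"
proof -
  have "summable (\<lambda>n. norm (1 :: 'a) * norm x ^ n)"
    using assms by (intro summable_mult summable_geometric) simp
  then have s: "summable (\<lambda>n. x ^ n)"
    by (rule summable_comparison_test'[where N = 0]) (rule norm_power_le)
  define y where "y = suminf (\<lambda>n. x ^ n)"
  have y: "y = 1 + x * y" "y = 1 + y * x"
  proof -
    have "y = x ^ 0 + suminf (\<lambda>n. x ^ Suc n)" using suminf_split_head[OF s] by (simp add: y_def)
    also have "suminf (\<lambda>n. x ^ Suc n) = x * y" by (simp add: y_def suminf_mult[OF s])
    finally show "y = 1 + x * y" by simp
    have "y = x ^ 0 + suminf (\<lambda>n. x ^ Suc n)" using suminf_split_head[OF s] by (simp add: y_def)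
    also have "suminf (\<lambda>n. x ^ Suc n) = y * x" by (simp add: y_def suminf_mult2[OF s] power_commutes)
    finally show "y = 1 + y * x" by simp
  qed
  have "(1 - x) * y = 1" "y * (1 - x) = 1"
    using y by (simp_all add: algebra_simps)
  then show ?thesis unfolding invertible_elem_def by blast
qed

lemma norm_le_of_mem_spectrum:
  assumes "z \<in> spectrum (a :: 'a :: cstar_algebra)"
  shows "cmod z \<le> norm a"
proof (rule ccontr)
  assume "\<not> cmod z \<le> norm a"
  then have z: "norm a < cmod z" "z \<noteq> 0" using norm_ge_zero[of a] by (linarith, auto)
  have "invertible_elem (1 - inverse z *\<^sub>C a)"
  proof (rule invertible_elem_one_minus)
    show "norm (inverse z *\<^sub>C a) < 1"
      using z by (simp only: norm_scaleC norm_inverse) (simp add: field_simps)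
  qed
  then have "invertible_elem ((- z) *\<^sub>C (1 - inverse z *\<^sub>C a))"
    using z(2) by (intro invertible_elem_scaleC) auto
  also have "(- z) *\<^sub>C (1 - inverse z *\<^sub>C a) = a - z *\<^sub>C 1"
    using z(2) by (simp add: scaleC_diff_right scaleC_scaleC scaleC_minus_left)
  finally show False using assms by (simp add: spectrum_iff)
qed

lemma closed_spectrum: "closed (spectrum (a :: 'a :: cstar_algebra))"
  unfolding closed_def open_dist
proof (intro ballI)
  fix z assume "z \<in> - spectrum a"
  then obtain y where y: "(a - z *\<^sub>C 1) * y = 1" "y * (a - z *\<^sub>C 1) = 1"
    by (auto simp: spectrum_iff invertible_elem_def)
  have "w \<in> - spectrum a" if w: "dist w z < 1 / (norm y + 1)" for w
  proof -
    have "cmod (w - z) * norm y \<le> cmod (w - z) * (norm y + 1)" by (intro mult_left_mono) auto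
    also have "\<dots> < 1" using w by (simp add: dist_norm field_simps add_pos_nonneg)
    finally have "norm ((w - z) *\<^sub>C y) < 1" by (simp add: norm_scaleC)
    then have "invertible_elem (1 - (w - z) *\<^sub>C y)" by (rule invertible_elem_one_minus)
    moreover have "invertible_elem (a - z *\<^sub>C 1)" using y by (auto simp: invertible_elem_def)
    ultimately have "invertible_elem ((a - z *\<^sub>C 1) * (1 - (w - z) *\<^sub>C y))"
      by (intro invertible_elem_mult)
    also have "(a - z *\<^sub>C 1) * (1 - (w - z) *\<^sub>C y) = a - w *\<^sub>C 1"
      by (simp only: right_diff_distrib mult_scaleC_right y) (simp add: scaleC_diff_left)
    finally show ?thesis by (simp add: spectrum_iff)
  qed
  then show "\<exists>e>0. \<forall>w. dist w z < e \<longrightarrow> w \<in> - spectrum a"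
    by (intro exI[of _ "1 / (norm y + 1)"]) (simp add: add_nonneg_pos)
qed

lemma compact_spectrum: "compact (spectrum (a :: 'a :: cstar_algebra))"
  using closed_spectrum norm_le_of_mem_spectrum
  by (auto simp: compact_eq_bounded_closed bounded_iff)

text \<open>Equality fails in the zero algebra.\<close>

lemma norm_one_le: "norm (1 :: 'a :: cstar_algebra) \<le> 1"
proof -
  have "norm (1 :: 'a) * norm (1 :: 'a) = norm (1 :: 'a)"
    using cstar_identity[of "1 :: 'a"] by (simp add: power2_eq_square)
  then show ?thesis by fastforce
qed

text \<open>If \<open>x + iy\<close> is in the spectrum of \<open>a\<close>, then \<open>x + i(y + t)\<close> is in that of \<open>a + it\<close>, so that
  \<open>(y + t)\<^sup>2 \<le> \<parallel>a + it\<parallel>\<^sup>2 = \<parallel>a\<^sup>2 + t\<^sup>2\<parallel> \<le> \<parallel>a\<parallel>\<^sup>2 + t\<^sup>2\<close> for all real \<open>t\<close>. Unless \<open>y = 0\<close>, this is absurd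
  for large \<open>ty\<close>.\<close>

lemma Im_spectrum_selfadjoint:
  assumes sa: "star a = (a :: 'a :: cstar_algebra)" and z: "z \<in> spectrum a"
  shows "Im z = 0"
proof (rule ccontr)
  assume nz: "Im z \<noteq> 0"
  define t where "t = (norm a ^ 2 + 1) / Im z"
  define w where "w = z + \<i> * of_real t"
  define b where "b = a + (\<i> * of_real t) *\<^sub>C 1"
  have "w \<in> spectrum b" using z
    by (simp add: spectrum_iff w_def b_def scaleC_add_left)
  then have "cmod w \<le> norm b" by (rule norm_le_of_mem_spectrum)
  then have "(cmod w)\<^sup>2 \<le> (norm b)\<^sup>2" by (simp add: power_mono)
  also have "(norm b)\<^sup>2 = norm (star b * b)" by (simp add: cstar_identity)
  also have "star b * b = a * a + (t\<^sup>2) *\<^sub>R 1"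
    by (simp add: b_def star_add star_scaleC sa algebra_simps mult_scaleC_left mult_scaleC_right
        scaleC_scaleC scaleC_minus_left scaleC_diff_right power2_eq_square scaleR_eq_scaleC)
  also have "norm (a * a + (t\<^sup>2) *\<^sub>R 1) \<le> norm a * norm a + t\<^sup>2 * 1"
    by (intro order.trans[OF norm_triangle_ineq] add_mono norm_mult_ineq)
      (simp add: mult_left_le norm_one_le)
  finally have "(cmod w)\<^sup>2 \<le> (norm a)\<^sup>2 + t\<^sup>2" by (simp add: power2_eq_square)
  moreover have "(Im z + t)\<^sup>2 \<le> (cmod w)\<^sup>2"
    using power_mono[OF abs_Im_le_cmod[of w], of 2] by (simp add: w_def)
  ultimately have "(Im z + t)\<^sup>2 \<le> (norm a)\<^sup>2 + t\<^sup>2" by linarith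
  then have "(Im z)\<^sup>2 + 2 * (Im z * t) \<le> (norm a)\<^sup>2" by (simp add: power2_eq_square algebra_simps)
  moreover have "Im z * t = norm a ^ 2 + 1" using nz by (simp add: t_def)
  ultimately show False using zero_le_power2[of "Im z"] zero_le_power2[of "norm a"] by linarith
qed

lemma norm_power_two_power_selfadjoint:
  assumes "star a = (a :: 'a :: cstar_algebra)"
  shows "norm (a ^ (2 ^ n)) = norm a ^ (2 ^ n)"
proof (induction n)
  case (Suc n)
  have "norm (a ^ (2 ^ Suc n)) = norm (star (a ^ (2 ^ n)) * a ^ (2 ^ n))"
    by (simp add: star_power assms mult_2 power_add)
  also have "\<dots> = (norm a ^ (2 ^ n))\<^sup>2" by (simp add: cstar_identity Suc)
  finally show ?case by (simp add: power2_eq_square mult_2 power_add)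
qed simp

section \<open>The norm of a self-adjoint element\<close>

text \<open>By the resolvent identity \<open>R z - R w = (z - w) R z b R w\<close>, first \<open>\<parallel>R z\<parallel> \<le> 2 \<parallel>R w\<parallel>\<close> for \<open>z\<close> near
  \<open>w\<close>, and then \<open>R\<close> is Lipschitz there.\<close>

lemma continuous_on_resolvent:
  fixes b :: "'a :: cstar_algebra"
  assumes R: "\<And>z. z \<in> D \<Longrightarrow> (1 - z *\<^sub>C b) * R z = 1 \<and> R z * (1 - z *\<^sub>C b) = 1"
  shows "continuous_on D R"
  unfolding continuous_on_iff
proof (intro ballI allI impI)
  fix w and e :: real assume w: "w \<in> D" and e: "0 < e"
  have id: "R z - R w = (z - w) *\<^sub>C (R z * b * R w)" if "z \<in> D" for z
  proof -
    have "R z - R w = R z * (1 - w *\<^sub>C b) * R w - R z * (1 - z *\<^sub>C b) * R w"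
      using R[OF that] R[OF w] by (simp add: mult.assoc)
    also have "\<dots> = R z * ((z - w) *\<^sub>C b) * R w"
      by (simp add: algebra_simps scaleC_diff_left)
    finally show ?thesis by (simp add: mult_scaleC_left mult_scaleC_right mult.assoc)
  qed
  define N where "N = norm b * norm (R w)"
  have N: "0 \<le> N" by (simp add: N_def)
  define d where "d = min (1 / (2 * (N + 1))) (e / (2 * norm (R w) * N + 1))"
  have d: "0 < d" using e N by (simp add: d_def add_nonneg_pos)
  have "dist (R z) (R w) < e" if z: "z \<in> D" "dist z w < d" for z
  proof -
    have le: "norm (R z - R w) \<le> cmod (z - w) * (norm (R z) * N)"
      unfolding id[OF z(1)] norm_scaleC N_def
      by (intro mult_left_mono order.trans[OF norm_mult_ineq] order.refl)
        (simp_all add: mult.assoc[symmetric] mult_right_mono norm_mult_ineq)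
    have zw: "cmod (z - w) * (2 * (N + 1)) < 1" "cmod (z - w) * (2 * norm (R w) * N + 1) < e"
      using z(2) N by (simp_all add: d_def dist_norm pos_less_divide_eq add_nonneg_pos)
    have "cmod (z - w) * N \<le> 1 / 2"
      using zw(1) norm_ge_zero[of "z - w"] unfolding distrib_left mult.left_commute[of _ 2] by linarith
    then have "norm (R z) * (cmod (z - w) * N) \<le> norm (R z) * (1 / 2)"
      by (intro mult_left_mono) auto
    then have "norm (R z) \<le> 2 * norm (R w)"
      using le norm_triangle_sub[of "R z" "R w"] by (simp add: mult_ac)
    then have "cmod (z - w) * (norm (R z) * N) \<le> cmod (z - w) * (2 * norm (R w) * N)"
      using N by (intro mult_left_mono mult_right_mono) auto
    also have "\<dots> \<le> cmod (z - w) * (2 * norm (R w) * N + 1)" by (intro mult_left_mono) auto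
    finally show ?thesis using le zw(2) by (simp add: dist_norm)
  qed
  then show "\<exists>d>0. \<forall>z\<in>D. dist z w < d \<longrightarrow> dist (R z) (R w) < e" using d by blast
qed

lemma power_scaleC: "(c *\<^sub>C (x :: 'a :: cstar_algebra)) ^ n = (c ^ n) *\<^sub>C x ^ n"
  by (induction n) (simp_all add: mult_scaleC_left mult_scaleC_right scaleC_scaleC mult.commute)

text \<open>From \<open>(1 - x\<^sup>2)\<inverse> = ((1 - x)\<inverse> + (1 + x)\<inverse>) / 2\<close> one gets the resolvents of all the
  powers \<open>b\<close> to the \<open>2 ^ k\<close> as averages of the resolvent of \<open>b\<close> over roots of unity. Averaging
  does not spoil a modulus of continuity, which is therefore common to all \<open>k\<close>.\<close>

lemma resolvent_of_power_equicontinuous: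
  fixes b :: "'a :: cstar_algebra"
  assumes R: "\<And>z. cmod z \<le> \<rho> \<Longrightarrow> (1 - z *\<^sub>C b) * R z = 1 \<and> R z * (1 - z *\<^sub>C b) = 1"
    and uc: "\<And>z w. cmod z \<le> \<rho> \<Longrightarrow> cmod w \<le> \<rho> \<Longrightarrow> dist z w < \<delta> \<Longrightarrow> dist (R z) (R w) < \<epsilon>"
  shows "\<exists>G. (\<forall>z. cmod z \<le> \<rho> \<longrightarrow> (1 - (z *\<^sub>C b) ^ (2 ^ k)) * G z = 1 \<and> G z * (1 - (z *\<^sub>C b) ^ (2 ^ k)) = 1) \<and>
    (\<forall>z w. cmod z \<le> \<rho> \<longrightarrow> cmod w \<le> \<rho> \<longrightarrow> dist z w < \<delta> \<longrightarrow> dist (G z) (G w) < \<epsilon>)"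
proof (induction k)
  case 0
  show ?case using R uc by (intro exI[of _ R]) auto
next
  case (Suc k)
  then obtain G where G: "\<And>z. cmod z \<le> \<rho> \<Longrightarrow> (1 - (z *\<^sub>C b) ^ (2 ^ k)) * G z = 1"
      "\<And>z. cmod z \<le> \<rho> \<Longrightarrow> G z * (1 - (z *\<^sub>C b) ^ (2 ^ k)) = 1"
      "\<And>z w. cmod z \<le> \<rho> \<Longrightarrow> cmod w \<le> \<rho> \<Longrightarrow> dist z w < \<delta> \<Longrightarrow> dist (G z) (G w) < \<epsilon>"
    by blast
  define \<omega> where "\<omega> = cis (pi / 2 ^ k)"
  \<comment> \<open>Passing from \<open>z\<close> to \<open>\<omega> z\<close> turns \<open>x = (z b) ^ 2 ^ k\<close> into \<open>- x\<close>.\<close>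
  have "\<omega> ^ (2 ^ k) = -1" unfolding \<omega>_def Complex.DeMoivre by simp
  define H where "H z = (1 / 2 :: real) *\<^sub>R (G z + G (\<omega> * z))" for z
  have n\<omega>: "cmod (\<omega> * z) = cmod z" for z by (simp add: \<omega>_def norm_mult)
  have "(1 - (z *\<^sub>C b) ^ (2 ^ Suc k)) * H z = 1 \<and> H z * (1 - (z *\<^sub>C b) ^ (2 ^ Suc k)) = 1"
    if z: "cmod z \<le> \<rho>" for z
  proof -
    define x where "x = (z *\<^sub>C b) ^ (2 ^ k)"
    have x2: "(z *\<^sub>C b) ^ (2 ^ Suc k) = x * x" by (simp add: x_def mult_2 power_add)
    have "((\<omega> * z) *\<^sub>C b) ^ (2 ^ k) = - x"
      using \<open>\<omega> ^ (2 ^ k) = -1\<close> by (simp add: x_def power_scaleC power_mult_distrib scaleC_minus_left)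
    then have v: "(1 + x) * G (\<omega> * z) = 1" "G (\<omega> * z) * (1 + x) = 1"
      using G(1,2)[of "\<omega> * z"] z n\<omega>[of z] by simp_all
    have u: "(1 - x) * G z = 1" "G z * (1 - x) = 1" using G(1,2)[of z] z by (simp_all add: x_def)
    have "(1 - x * x) * G z = (1 + x) * ((1 - x) * G z)"
      "(1 - x * x) * G (\<omega> * z) = (1 - x) * ((1 + x) * G (\<omega> * z))"
      "G z * (1 - x * x) = (G z * (1 - x)) * (1 + x)"
      "G (\<omega> * z) * (1 - x * x) = (G (\<omega> * z) * (1 + x)) * (1 - x)"
      by (simp_all add: algebra_simps)
    then have
      "(1 - x * x) * (G z + G (\<omega> * z)) = 2 *\<^sub>R 1" "(G z + G (\<omega> * z)) * (1 - x * x) = 2 *\<^sub>R 1"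
      by (simp_all only: u v distrib_left[of _ "G z"] distrib_right[of "G z"]) (simp_all add: scaleR_2)
    then show ?thesis unfolding x2 H_def by simp
  qed
  moreover have "dist (H z) (H w) < \<epsilon>" if zw: "cmod z \<le> \<rho>" "cmod w \<le> \<rho>" "dist z w < \<delta>" for z w
  proof -
    have "dist (\<omega> * z) (\<omega> * w) = dist z w"
      using n\<omega>[of "z - w"] by (simp add: dist_norm right_diff_distrib)
    then have "norm (G z - G w) < \<epsilon>" "norm (G (\<omega> * z) - G (\<omega> * w)) < \<epsilon>"
      using G(3)[of z w] G(3)[of "\<omega> * z" "\<omega> * w"] zw n\<omega> by (simp_all add: dist_norm)
    moreover have "norm (H z - H w) = norm ((G z - G w) + (G (\<omega> * z) - G (\<omega> * w))) / 2"
      by (simp add: H_def scaleR_diff_right[symmetric] del: scaleR_diff_right)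
        (simp add: algebra_simps)
    moreover note norm_triangle_ineq[of "G z - G w" "G (\<omega> * z) - G (\<omega> * w)"]
    ultimately show ?thesis by (simp add: dist_norm)
  qed
  ultimately show ?case by blast
qed

text \<open>The constants of the next two lemmas fit together because two errors of 1/4 add up to 1/2, for
  which an inverse is still bounded.\<close>

lemma norm_inverse_minus_one_le:
  fixes x g :: "'a :: cstar_algebra"
  assumes "g * (1 - x) = 1" "norm x \<le> 1 / 5"
  shows "norm (g - 1) \<le> 1 / 4"
proof -
  have "g - 1 = g * x" using assms(1) by (simp add: algebra_simps)
  then have "norm (g - 1) \<le> norm g * norm x" by (metis norm_mult_ineq)
  also have "\<dots> \<le> norm g * (1 / 5)" by (intro mult_left_mono assms) simp
  also have "norm g \<le> norm (g - 1) + 1"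
    using norm_triangle_sub[of g 1] norm_one_le[where 'a = 'a] by linarith
  finally show ?thesis by simp
qed

lemma norm_le_3_of_inverse:
  fixes x g :: "'a :: cstar_algebra"
  assumes "g * (1 - x) = 1" "norm (g - 1) \<le> 1 / 2"
  shows "norm x \<le> 3"
proof -
  have "1 - x = 1 - (g - 1) * (1 - x)" using assms(1) by (simp add: algebra_simps)
  then have "norm (1 - x) \<le> norm (1 :: 'a) + norm ((g - 1) * (1 - x))" by (metis norm_triangle_ineq4)
  also have "norm ((g - 1) * (1 - x)) \<le> 1 / 2 * norm (1 - x)"
    by (rule order.trans[OF norm_mult_ineq]) (intro mult_right_mono assms, simp)
  finally have "norm (1 - x) \<le> 2" using norm_one_le[where 'a = 'a] by linarith
  then show ?thesis
    using norm_triangle_ineq4[of 1 "1 - x"] norm_one_le[where 'a = 'a] by simp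
qed

text \<open>If \<open>\<parallel>b\<parallel> > C\<close>, then \<open>1 - zb\<close> is invertible in a disc of radius larger than \<open>1 / \<parallel>b\<parallel>\<close>. For real
  \<open>s\<close> slightly below \<open>1 / \<parallel>b\<parallel>\<close>, \<open>(sb) ^ 2 ^ k\<close> tends to 0 and its resolvent to 1; by
  equicontinuity the resolvent of \<open>(tb) ^ 2 ^ k\<close> stays near 1 for some \<open>t\<close> slightly above
  \<open>1 / \<parallel>b\<parallel>\<close>, although the norm \<open>(t \<parallel>b\<parallel>) ^ 2 ^ k\<close> of this power tends to infinity. This argument
  replaces Liouville's theorem for functions with values in the algebra.\<close>

lemma norm_le_of_spectrum_le:
  fixes b :: "'a :: cstar_algebra"
  assumes sa: "star b = b" and C: "0 \<le> C" "\<And>z. z \<in> spectrum b \<Longrightarrow> cmod z \<le> C"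
  shows "norm b \<le> C"
proof (rule ccontr)
  assume "\<not> norm b \<le> C"
  then obtain C' where C': "C < C'" "C' < norm b" using dense[of C "norm b"] by auto
  define \<rho> where "\<rho> = 1 / C'"
  have pos: "0 < C'" "0 < norm b" using C(1) C' by linarith+
  have \<rho>: "1 / norm b < \<rho>" "0 < \<rho>" using C' pos by (simp_all add: \<rho>_def field_simps)
  have "invertible_elem (1 - z *\<^sub>C b)" if z: "cmod z \<le> \<rho>" for z
  proof (cases "z = 0")
    case True
    then show ?thesis by (auto simp: invertible_elem_def)
  next
    case False
    have "C' \<le> cmod (1 / z)" using z False pos by (simp add: \<rho>_def norm_divide field_simps)
    then have "1 / z \<notin> spectrum b" using C(2)[of "1 / z"] C'(1) by linarith
    then have "invertible_elem ((- z) *\<^sub>C (b - (1 / z) *\<^sub>C 1))"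
      using False by (intro invertible_elem_scaleC) (auto simp: spectrum_iff)
    also have "(- z) *\<^sub>C (b - (1 / z) *\<^sub>C 1) = 1 - z *\<^sub>C b"
      using False by (simp add: scaleC_diff_right scaleC_scaleC scaleC_minus_left)
    finally show ?thesis .
  qed
  then obtain R where R: "\<And>z. cmod z \<le> \<rho> \<Longrightarrow> (1 - z *\<^sub>C b) * R z = 1 \<and> R z * (1 - z *\<^sub>C b) = 1"
    unfolding invertible_elem_def by metis
  have "continuous_on (cball 0 \<rho>) R" by (rule continuous_on_resolvent[of _ b]) (simp add: R)
  then have "uniformly_continuous_on (cball 0 \<rho>) R"
    by (rule compact_uniformly_continuous) simp
  then obtain \<delta> where \<delta>: "0 < \<delta>"
    and uc: "\<And>z w. cmod z \<le> \<rho> \<Longrightarrow> cmod w \<le> \<rho> \<Longrightarrow> dist z w < \<delta> \<Longrightarrow> dist (R z) (R w) < 1 / 4"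
    unfolding uniformly_continuous_on_def using zero_less_divide_1_iff
    by (metis dist_commute mem_cball_0 zero_less_numeral)
  define s where "s = max (1 / (2 * norm b)) (1 / norm b - \<delta> / 3)"
  define t where "t = min \<rho> (1 / norm b + \<delta> / 3)"
  have inv: "0 < 1 / norm b" "1 / (2 * norm b) = 1 / norm b / 2" using pos by simp_all
  have "1 / norm b / 2 \<le> s" by (simp add: s_def)
  moreover have "s < 1 / norm b"
  proof -
    have "max (q / 2) (q - \<delta> / 3) < q" if "0 < q" for q using that \<delta> by simp
    from this[OF inv(1)] show ?thesis unfolding s_def inv(2) .
  qed
  ultimately have s: "0 < s" "s < 1 / norm b" using inv(1) half_gt_zero[OF inv(1)] by linarith+
  have t: "1 / norm b < t" "t \<le> \<rho>" using \<rho> \<delta> by (simp_all add: t_def)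
  have st: "t - s < \<delta>"
  proof -
    have "1 / norm b - \<delta> / 3 \<le> s" "t \<le> 1 / norm b + \<delta> / 3" by (simp_all add: s_def t_def)
    then show ?thesis using \<delta> by linarith
  qed
  have s1: "0 < s * norm b" "s * norm b < 1" and t1: "1 < t * norm b"
    using s t pos by (simp_all add: field_simps)
  obtain n1 where n1: "(s * norm b) ^ n1 < 1 / 5"
    using real_arch_pow_inv[of "1 / 5" "s * norm b"] s1 by auto
  obtain n2 where n2: "3 < (t * norm b) ^ n2"
    using real_arch_pow[OF t1] by blast
  define k where "k = max n1 n2"
  have k: "n1 \<le> 2 ^ k" "n2 \<le> 2 ^ k" using less_exp[of k] max.cobounded1[of n1 n2] max.cobounded2[of n2 n1]
    unfolding k_def[symmetric] by linarith+
  obtain G where G: "\<And>z. cmod z \<le> \<rho> \<Longrightarrow> G z * (1 - (z *\<^sub>C b) ^ (2 ^ k)) = 1"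
      "\<And>z w. cmod z \<le> \<rho> \<Longrightarrow> cmod w \<le> \<rho> \<Longrightarrow> dist z w < \<delta> \<Longrightarrow> dist (G z) (G w) < 1 / 4"
    using resolvent_of_power_equicontinuous[of \<rho> b R \<delta> "1 / 4" k, OF R uc] by blast
  have norm_pow: "norm ((complex_of_real u *\<^sub>C b) ^ (2 ^ k)) = (u * norm b) ^ (2 ^ k)" if "0 < u" for u
    using norm_power_two_power_selfadjoint[of "complex_of_real u *\<^sub>C b" k] that
    by (simp add: star_scaleC sa norm_scaleC)
  have "norm ((complex_of_real s *\<^sub>C b) ^ (2 ^ k)) \<le> 1 / 5"
  proof -
    have "(s * norm b) ^ (2 ^ k) \<le> (s * norm b) ^ n1" using s1 by (intro power_decreasing k) auto
    then show ?thesis unfolding norm_pow[OF s(1)] using n1 by linarith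
  qed
  then have "norm (G s - 1) \<le> 1 / 4"
    using G(1)[of s] s t by (intro norm_inverse_minus_one_le[where x = "(complex_of_real s *\<^sub>C b) ^ (2 ^ k)"]) auto
  moreover have "norm (G t - G s) < 1 / 4"
    using G(2)[of t s] s t st by (simp add: dist_norm flip: of_real_diff)
  moreover have "norm (G t - 1) \<le> norm (G t - G s) + norm (G s - 1)"
    using norm_triangle_ineq[of "G t - G s" "G s - 1"] by simp
  ultimately have "norm (G t - 1) \<le> 1 / 2" by linarith
  moreover have "G t * (1 - (complex_of_real t *\<^sub>C b) ^ (2 ^ k)) = 1"
    using s t by (intro G(1)) simp
  ultimately have "norm ((complex_of_real t *\<^sub>C b) ^ (2 ^ k)) \<le> 3"
    by (intro norm_le_3_of_inverse)
  moreover have "0 < t" using t inv by linarith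
  ultimately have "(t * norm b) ^ (2 ^ k) \<le> 3" by (simp add: norm_pow)
  moreover have "(t * norm b) ^ n2 \<le> (t * norm b) ^ (2 ^ k)"
    using t1 by (intro power_increasing k) simp
  ultimately show False using n2 by linarith
qed

section \<open>The functional calculus of a self-adjoint element\<close>

definition alg_eval :: "complex poly \<Rightarrow> 'a :: cstar_algebra \<Rightarrow> 'a"
  where "alg_eval p a = (\<Sum>n\<le>degree p. coeff p n *\<^sub>C a ^ n)"

lemma alg_eval_superset:
  "degree p \<le> N \<Longrightarrow> alg_eval p a = (\<Sum>n\<le>N. coeff p n *\<^sub>C a ^ n)"
  unfolding alg_eval_def by (rule sum.mono_neutral_left) (auto simp: coeff_eq_0)

lemma alg_eval_add: "alg_eval (p + q) a = alg_eval p a + alg_eval q a"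
proof -
  define N where "N = max (degree p) (degree q)"
  have "degree (p + q) \<le> N" "degree p \<le> N" "degree q \<le> N"
    unfolding N_def by (auto intro: degree_add_le_max)
  then show ?thesis by (simp add: alg_eval_superset[of _ N] scaleC_add_left sum.distrib)
qed

lemma alg_eval_smult: "alg_eval (smult c p) a = c *\<^sub>C alg_eval p a"
  by (simp add: alg_eval_superset[OF degree_smult_le] alg_eval_def scaleC_sum_right scaleC_scaleC)

lemma alg_eval_0 [simp]: "alg_eval 0 a = 0"
  by (simp add: alg_eval_def)

lemma alg_eval_const [simp]: "alg_eval [:c:] a = c *\<^sub>C 1"
  by (simp add: alg_eval_def)

lemma alg_eval_diff: "alg_eval (p - q) a = alg_eval p a - alg_eval q a"
  using alg_eval_add[of "p - q" q a] by simp

lemma alg_eval_pCons: "alg_eval (pCons c p) a = c *\<^sub>C 1 + a * alg_eval p a"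
  by (cases "p = 0")
    (simp_all add: alg_eval_def sum.atMost_Suc_shift sum_distrib_left mult_scaleC_right
      del: sum.atMost_Suc)

lemma alg_eval_mult: "alg_eval (p * q) a = alg_eval p a * alg_eval q a"
  by (induction p)
    (simp_all add: alg_eval_add alg_eval_smult alg_eval_pCons distrib_right mult_scaleC_left mult.assoc)

lemma alg_eval_X [simp]: "alg_eval [:0, 1:] a = a"
  by (simp add: alg_eval_pCons)

lemma alg_eval_commute: "alg_eval p a * a = a * alg_eval p a"
  using alg_eval_mult[of p "[:0, 1:]" a] alg_eval_mult[of "[:0, 1:]" p a]
  by (simp add: mult.commute[of p])

lemma star_alg_eval:
  assumes "star a = a"
  shows "star (alg_eval p a) = alg_eval (map_poly cnj p) a"
  by (induction p)
    (simp_all add: map_poly_pCons alg_eval_pCons star_add star_scaleC star_mult assms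
      flip: alg_eval_commute)

lemma poly_map_cnj: "poly (map_poly cnj p) (cnj z) = cnj (poly p z)"
  by (induction p) (simp_all add: map_poly_pCons)

text \<open>Over the complex numbers, \<open>p(a)\<close> is a product of a nonzero scalar and of factors
  \<open>a - z\<close> where \<open>z\<close> runs through the roots of \<open>p\<close>.\<close>

lemma invertible_alg_eval:
  assumes "p \<noteq> 0" "\<And>z. z \<in> spectrum a \<Longrightarrow> poly p z \<noteq> 0"
  shows "invertible_elem (alg_eval p a)"
  using assms
proof (induction "degree p" arbitrary: p)
  case 0
  then obtain c where "p = [:c:]" "c \<noteq> 0" by (auto elim!: degree_eq_zeroE)
  moreover have "invertible_elem (c *\<^sub>C 1 :: 'a)"
    using \<open>c \<noteq> 0\<close> by (intro invertible_elem_scaleC) (auto simp: invertible_elem_def)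
  ultimately show ?case by simp
next
  case (Suc n)
  then have "\<not> constant (poly p)" by (simp add: constant_degree)
  then obtain z where "poly p z = 0" using fundamental_theorem_of_algebra by blast
  then obtain q where q: "p = [:- z, 1:] * q" by (auto simp: poly_eq_0_iff_dvd)
  then have "q \<noteq> 0" using Suc.prems(1) by auto
  then have "degree p = Suc (degree q)" unfolding q by (subst degree_mult_eq) auto
  then have "invertible_elem (alg_eval q a)"
    using Suc.hyps(2) \<open>q \<noteq> 0\<close> Suc.prems(2) by (intro Suc.hyps(1)) (auto simp: q)
  moreover have "z \<notin> spectrum a" using Suc.prems(2)[of z] by (auto simp: q)
  then have "invertible_elem (alg_eval [:- z, 1:] a)"
    by (simp add: spectrum_iff alg_eval_pCons scaleC_minus_left)
  ultimately show ?case unfolding q alg_eval_mult by (intro invertible_elem_mult)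
qed

text \<open>By the C*-identity it suffices to bound the self-adjoint element \<open>p(a)* p(a) = (cnj p p)(a)\<close>,
  whose spectrum is contained in the image of that of \<open>a\<close> under \<open>\<bar>p\<bar>\<^sup>2\<close>.\<close>

lemma norm_alg_eval_le:
  fixes a :: "'a :: cstar_algebra"
  assumes sa: "star a = a" and C: "0 \<le> C" "\<And>z. z \<in> spectrum a \<Longrightarrow> cmod (poly p z) \<le> C"
  shows "norm (alg_eval p a) \<le> C"
proof -
  define q where "q = map_poly cnj p * p"
  have q: "alg_eval q a = star (alg_eval p a) * alg_eval p a"
    by (simp add: q_def alg_eval_mult star_alg_eval[OF sa])
  have "norm (alg_eval q a) \<le> C\<^sup>2"
  proof (rule norm_le_of_spectrum_le)
    show "star (alg_eval q a) = alg_eval q a" by (simp add: q star_mult star_star)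
    fix w assume w: "w \<in> spectrum (alg_eval q a)"
    have ninv: "\<not> invertible_elem (alg_eval (q - [:w:]) a)"
      using w by (simp add: spectrum_iff alg_eval_diff)
    \<comment> \<open>The spectrum is nonempty because its emptiness would force \<open>a = 0\<close> and then \<open>1 = 0\<close>.\<close>
    have "spectrum a \<noteq> {}"
    proof
      assume empty: "spectrum a = {}"
      then have "norm a \<le> 0" by (intro norm_le_of_spectrum_le sa) auto
      then have "a = 0" by simp
      moreover have "0 \<notin> spectrum a" using empty by blast
      ultimately have one: "(1 :: 'a) = 0" by (simp add: spectrum_iff invertible_elem_def)
      have zero: "x = 0" for x :: 'a
      proof -
        have "x = x * 1" by simp
        also have "\<dots> = 0" unfolding one by simp
        finally show ?thesis .
      qed
      have eq: "x = y" for x y :: 'a unfolding zero[of x] zero[of y] ..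
      have "invertible_elem x" for x :: 'a unfolding invertible_elem_def by (intro exI conjI; rule eq)
      then show False using ninv by blast
    qed
    then have "\<exists>z\<in>spectrum a. poly (q - [:w:]) z = 0"
      using ninv invertible_alg_eval[of "q - [:w:]" a] by (metis ex_in_conv poly_0)
    then obtain z where z: "z \<in> spectrum a" "poly q z = w" by auto
    have "cnj z = z" using Im_spectrum_selfadjoint[OF sa z(1)] by (simp add: complex_eq_iff)
    then have "w = cnj (poly p z) * poly p z"
      using z(2) poly_map_cnj[of p z] by (simp add: q_def)
    then have "cmod w = (cmod (poly p z))\<^sup>2" by (simp add: norm_mult power2_eq_square)
    then show "cmod w \<le> C\<^sup>2" using C(2)[OF z(1)] by (simp add: power_mono)
  qed (simp add: C)
  then have "(norm (alg_eval p a))\<^sup>2 \<le> C\<^sup>2" by (simp add: q cstar_identity)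
  then show ?thesis using C(1) by (rule power2_le_imp_le)
qed

lemma complex_polynomial_approximation:
  fixes X :: "complex set"
  assumes X: "compact X" "\<And>z. z \<in> X \<Longrightarrow> Im z = 0" and \<phi>: "continuous_on X \<phi>" and e: "0 < e"
  shows "\<exists>p. \<forall>z\<in>X. cmod (\<phi> z - poly p z) \<le> e"
proof -
  have re: "complex_of_real (Re z) = z" if "z \<in> X" for z
    using X(2)[OF that] by (simp add: complex_eq_iff)
  have "compact (Re ` X)" by (intro compact_continuous_image X continuous_intros)
  moreover have "continuous_on (Re ` X) (\<lambda>x. \<phi> (complex_of_real x))"
    by (intro continuous_on_compose2[OF \<phi>] continuous_intros) (auto simp: re)
  ultimately have "\<exists>g. polynomial_function g \<and> (\<forall>x\<in>Re ` X. cmod (\<phi> (complex_of_real x) - g x) < e)"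
    using e by (rule Stone_Weierstrass_polynomial_function)
  then obtain g where g: "polynomial_function g"
    "\<And>x. x \<in> Re ` X \<Longrightarrow> cmod (\<phi> (complex_of_real x) - g x) < e" by auto
  have ex: "\<exists>a n. L \<circ> g = (\<lambda>x. \<Sum>i\<le>n. a i * x ^ i)" if "bounded_linear L" for L :: "complex \<Rightarrow> real"
  proof -
    have "real_polynomial_function (L \<circ> g)" using g(1) that by (simp add: polynomial_function_def)
    then show ?thesis by (simp only: real_polynomial_function_iff_sum)
  qed
  obtain a n where a: "Re \<circ> g = (\<lambda>x. \<Sum>i\<le>n. a i * x ^ i)" using ex[OF bounded_linear_Re] by auto
  obtain b m where b: "Im \<circ> g = (\<lambda>x. \<Sum>i\<le>m. b i * x ^ i)" using ex[OF bounded_linear_Im] by auto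
  define p where "p = (\<Sum>i\<le>n. monom (complex_of_real (a i)) i) + smult \<i> (\<Sum>i\<le>m. monom (complex_of_real (b i)) i)"
  have p: "poly p (complex_of_real x) = g x" for x
  proof -
    have "poly p (complex_of_real x) = complex_of_real (Re (g x)) + \<i> * complex_of_real (Im (g x))"
      using fun_cong[OF a, of x] fun_cong[OF b, of x] by (simp add: p_def poly_sum poly_monom)
    then show ?thesis by (simp only: complex_eq[symmetric])
  qed
  have "cmod (\<phi> z - poly p z) \<le> e" if "z \<in> X" for z
    using g(2)[of "Re z"] p[of "Re z"] re[OF that] that by (simp add: less_imp_le)
  then show ?thesis by blast
qed

text \<open>\<open>x\<close> is the value \<open>\<phi>(a)\<close> as a limit of \<open>p(a)\<close> for polynomials \<open>p\<close> tending to \<open>\<phi>\<close>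
  uniformly on the spectrum.\<close>

definition is_cfc_value :: "'a :: cstar_algebra \<Rightarrow> (complex \<Rightarrow> complex) \<Rightarrow> 'a \<Rightarrow> bool"
  where "is_cfc_value a \<phi> x \<longleftrightarrow>
    (\<forall>\<delta>>0. \<exists>p. (\<forall>z\<in>spectrum a. cmod (\<phi> z - poly p z) \<le> \<delta>) \<and> norm (x - alg_eval p a) \<le> \<delta>)"

lemma is_cfc_valueE:
  assumes "is_cfc_value a \<phi> x" "0 < \<delta>"
  obtains p where "\<And>z. z \<in> spectrum a \<Longrightarrow> cmod (\<phi> z - poly p z) \<le> \<delta>" "norm (x - alg_eval p a) \<le> \<delta>"
  using assms unfolding is_cfc_value_def by blast

lemma is_cfc_value_dist:
  fixes a :: "'a :: cstar_algebra"
  assumes sa: "star a = a" and x: "is_cfc_value a \<phi> x"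
    and C: "0 \<le> C" "\<And>z. z \<in> spectrum a \<Longrightarrow> cmod (\<phi> z - poly q z) \<le> C"
  shows "norm (x - alg_eval q a) \<le> C"
proof (rule field_le_epsilon)
  fix e :: real assume "0 < e"
  then have e2: "0 < e / 2" by simp
  obtain p where p: "\<And>z. z \<in> spectrum a \<Longrightarrow> cmod (\<phi> z - poly p z) \<le> e / 2" "norm (x - alg_eval p a) \<le> e / 2"
    by (rule is_cfc_valueE[OF x e2]) blast
  have "norm (alg_eval (p - q) a) \<le> e / 2 + C"
  proof (rule norm_alg_eval_le[OF sa])
    fix z assume z: "z \<in> spectrum a"
    have "cmod ((\<phi> z - poly q z) - (\<phi> z - poly p z)) \<le> C + e / 2"
      by (intro order.trans[OF norm_triangle_ineq4] add_mono p C z)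
    then show "cmod (poly (p - q) z) \<le> e / 2 + C" by (simp add: algebra_simps)
  qed (use C \<open>0 < e\<close> in auto)
  moreover have "norm (x - alg_eval q a) \<le> norm (x - alg_eval p a) + norm (alg_eval (p - q) a)"
    using norm_triangle_ineq[of "x - alg_eval p a" "alg_eval (p - q) a"] by (simp add: alg_eval_diff)
  ultimately show "norm (x - alg_eval q a) \<le> C + e" using p(2) by linarith
qed

lemma is_cfc_value_unique:
  fixes a :: "'a :: cstar_algebra"
  assumes sa: "star a = a" and x: "is_cfc_value a \<phi> x" and y: "is_cfc_value a \<phi> y"
  shows "x = y"
proof -
  have "norm (x - y) \<le> 0 + e" if "0 < e" for e
  proof -
    have e2: "0 < e / 2" using that by simp
    obtain p where p: "\<And>z. z \<in> spectrum a \<Longrightarrow> cmod (\<phi> z - poly p z) \<le> e / 2" "norm (x - alg_eval p a) \<le> e / 2"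
      by (rule is_cfc_valueE[OF x e2]) blast
    have "norm (y - alg_eval p a) \<le> e / 2"
      by (rule is_cfc_value_dist[OF sa y]) (use p that in auto)
    then show ?thesis using p(2) dist_triangle2[of x y "alg_eval p a"] by (simp add: dist_norm)
  qed
  then have "norm (x - y) \<le> 0" by (rule field_le_epsilon)
  then show ?thesis by simp
qed

lemma is_cfc_value_exists:
  fixes a :: "'a :: cstar_algebra"
  assumes sa: "star a = a" and \<phi>: "continuous_on (spectrum a) \<phi>"
  shows "\<exists>x. is_cfc_value a \<phi> x"
proof -
  define S where "S = {(p :: complex poly, \<epsilon> :: real). 0 \<le> \<epsilon> \<and> (\<forall>z\<in>spectrum a. cmod (\<phi> z - poly p z) \<le> \<epsilon>)}"
  have approx: "\<exists>p. \<forall>z\<in>spectrum a. cmod (\<phi> z - poly p z) \<le> e" if "0 < e" for e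
    by (intro complex_polynomial_approximation compact_spectrum Im_spectrum_selfadjoint[OF sa] \<phi> that)
  have "\<exists>!x. \<forall>s\<in>S. norm (x - alg_eval (fst s) a) \<le> 1 * snd s"
  proof (rule unique_limit_of_values)
    fix s t assume st: "s \<in> S" "t \<in> S"
    have "norm (alg_eval (fst s - fst t) a) \<le> snd s + snd t"
    proof (rule norm_alg_eval_le[OF sa])
      fix z assume z: "z \<in> spectrum a"
      have "cmod (\<phi> z - poly (fst t) z) \<le> snd t" "cmod (\<phi> z - poly (fst s) z) \<le> snd s"
        using st z by (auto simp: S_def)
      then have "cmod ((\<phi> z - poly (fst t) z) - (\<phi> z - poly (fst s) z)) \<le> snd t + snd s"
        by (rule order.trans[OF norm_triangle_ineq4 add_mono])
      then show "cmod (poly (fst s - fst t) z) \<le> snd s + snd t" by (simp add: algebra_simps)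
    qed (use st in \<open>auto simp: S_def\<close>)
    then show "norm (alg_eval (fst s) a - alg_eval (fst t) a) \<le> 1 * (snd s + snd t)"
      by (simp add: alg_eval_diff)
  next
    fix e :: real assume "0 < e"
    then obtain p where "\<forall>z\<in>spectrum a. cmod (\<phi> z - poly p z) \<le> e / 2" using approx[of "e / 2"] by auto
    then show "\<exists>s\<in>S. snd s < e" using \<open>0 < e\<close> by (intro bexI[of _ "(p, e / 2)"]) (auto simp: S_def)
  qed (auto simp: S_def)
  then obtain x where x: "\<And>s. s \<in> S \<Longrightarrow> norm (x - alg_eval (fst s) a) \<le> snd s" by auto
  have "is_cfc_value a \<phi> x" unfolding is_cfc_value_def
  proof (intro allI impI)
    fix \<delta> :: real assume "0 < \<delta>"
    then obtain p where "\<forall>z\<in>spectrum a. cmod (\<phi> z - poly p z) \<le> \<delta>" using approx by blast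
    then show "\<exists>p. (\<forall>z\<in>spectrum a. cmod (\<phi> z - poly p z) \<le> \<delta>) \<and> norm (x - alg_eval p a) \<le> \<delta>"
      using x[of "(p, \<delta>)"] \<open>0 < \<delta>\<close> by (auto simp: S_def)
  qed
  then show ?thesis by blast
qed

lemma is_cfc_value_cong:
  assumes "is_cfc_value a \<phi> x" "\<And>z. z \<in> spectrum a \<Longrightarrow> \<phi> z = \<psi> z"
  shows "is_cfc_value a \<psi> x"
proof -
  have "(\<forall>z\<in>spectrum a. cmod (\<psi> z - poly p z) \<le> \<delta>) = (\<forall>z\<in>spectrum a. cmod (\<phi> z - poly p z) \<le> \<delta>)" for p \<delta>
    using assms(2) by simp
  then show ?thesis using assms(1) unfolding is_cfc_value_def by simp
qed

lemma is_cfc_value_poly: "is_cfc_value a (poly p) (alg_eval p a)"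
  unfolding is_cfc_value_def by (auto intro!: exI[of _ p])

lemma is_cfc_value_add:
  assumes "is_cfc_value a \<phi> x" "is_cfc_value a \<psi> y"
  shows "is_cfc_value a (\<lambda>z. \<phi> z + \<psi> z) (x + y)"
  unfolding is_cfc_value_def
proof (intro allI impI)
  fix \<delta> :: real assume \<delta>: "0 < \<delta>"
  obtain p where p: "\<And>z. z \<in> spectrum a \<Longrightarrow> cmod (\<phi> z - poly p z) \<le> \<delta> / 2" "norm (x - alg_eval p a) \<le> \<delta> / 2"
    by (rule is_cfc_valueE[OF assms(1) half_gt_zero[OF \<delta>]]) blast
  obtain q where q: "\<And>z. z \<in> spectrum a \<Longrightarrow> cmod (\<psi> z - poly q z) \<le> \<delta> / 2" "norm (y - alg_eval q a) \<le> \<delta> / 2"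
    by (rule is_cfc_valueE[OF assms(2) half_gt_zero[OF \<delta>]]) blast
  have "norm (x + y - alg_eval (p + q) a) \<le> \<delta> / 2 + \<delta> / 2"
    unfolding alg_eval_add by (rule order.trans[OF norm_diff_triangle_ineq add_mono[OF p(2) q(2)]])
  moreover have "cmod (\<phi> z + \<psi> z - poly (p + q) z) \<le> \<delta> / 2 + \<delta> / 2" if "z \<in> spectrum a" for z
    unfolding poly_add by (rule order.trans[OF norm_diff_triangle_ineq add_mono[OF p(1) q(1)]]) fact+
  ultimately show "\<exists>p. (\<forall>z\<in>spectrum a. cmod (\<phi> z + \<psi> z - poly p z) \<le> \<delta>) \<and> norm (x + y - alg_eval p a) \<le> \<delta>"
    by (intro exI[of _ "p + q"]) auto
qed

lemma norm_mult_diff_le: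
  fixes x y :: "'b :: real_normed_algebra"
  assumes "norm x \<le> M" "norm y \<le> M" "norm (x - p) \<le> \<eta>" "norm (y - q) \<le> \<eta>" "0 \<le> M" "0 \<le> \<eta>" "\<eta> \<le> 1"
  shows "norm (x * y - p * q) \<le> \<eta> * (2 * M + 1)"
proof -
  have "x * y - p * q = (x - p) * y + x * (y - q) - (x - p) * (y - q)" by (simp add: algebra_simps)
  then have "norm (x * y - p * q) \<le> norm ((x - p) * y) + norm (x * (y - q)) + norm ((x - p) * (y - q))"
    using norm_triangle_ineq4[of "(x - p) * y + x * (y - q)" "(x - p) * (y - q)"]
      norm_triangle_ineq[of "(x - p) * y" "x * (y - q)"] by simp
  also have "\<dots> \<le> \<eta> * M + M * \<eta> + \<eta> * 1"
    using assms by (intro add_mono order.trans[OF norm_mult_ineq] mult_mono) auto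
  finally show ?thesis by (simp add: algebra_simps)
qed

lemma is_cfc_value_mult:
  assumes "is_cfc_value a \<phi> x" "is_cfc_value a \<psi> y"
    and cont: "continuous_on (spectrum a) \<phi>" "continuous_on (spectrum a) \<psi>"
  shows "is_cfc_value a (\<lambda>z. \<phi> z * \<psi> z) (x * y)"
  unfolding is_cfc_value_def
proof (intro allI impI)
  fix \<delta> :: real assume \<delta>: "0 < \<delta>"
  have "\<exists>B. \<forall>z\<in>spectrum a. cmod (f z) \<le> B" if "continuous_on (spectrum a) f" for f
    using compact_imp_bounded[OF compact_continuous_image[OF that compact_spectrum]]
    by (auto simp: bounded_iff)
  then obtain B1 B2 where B: "\<And>z. z \<in> spectrum a \<Longrightarrow> cmod (\<phi> z) \<le> B1" "\<And>z. z \<in> spectrum a \<Longrightarrow> cmod (\<psi> z) \<le> B2"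
    using cont by meson
  define M where "M = max (max \<bar>B1\<bar> \<bar>B2\<bar>) (max (norm x) (norm y))"
  have M: "0 \<le> M" "B1 \<le> M" "B2 \<le> M" "norm x \<le> M" "norm y \<le> M" by (auto simp: M_def)
  define \<eta> where "\<eta> = min 1 (\<delta> / (2 * M + 1))"
  have "0 < 2 * M + 1" using M(1) by linarith
  moreover have "\<eta> \<le> \<delta> / (2 * M + 1)" by (simp add: \<eta>_def)
  ultimately have \<eta>: "0 < \<eta>" "\<eta> \<le> 1" "\<eta> * (2 * M + 1) \<le> \<delta>"
    using \<delta> by (auto simp only: pos_le_divide_eq) (auto simp: \<eta>_def)
  obtain p where p: "\<And>z. z \<in> spectrum a \<Longrightarrow> cmod (\<phi> z - poly p z) \<le> \<eta>" "norm (x - alg_eval p a) \<le> \<eta>"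
    by (rule is_cfc_valueE[OF assms(1) \<eta>(1)]) blast
  obtain q where q: "\<And>z. z \<in> spectrum a \<Longrightarrow> cmod (\<psi> z - poly q z) \<le> \<eta>" "norm (y - alg_eval q a) \<le> \<eta>"
    by (rule is_cfc_valueE[OF assms(2) \<eta>(1)]) blast
  have "norm (x * y - alg_eval p a * alg_eval q a) \<le> \<eta> * (2 * M + 1)"
    using M \<eta> p q by (intro norm_mult_diff_le) auto
  moreover have "cmod (\<phi> z * \<psi> z - poly p z * poly q z) \<le> \<eta> * (2 * M + 1)" if z: "z \<in> spectrum a" for z
    using M(1) \<eta> p(1)[OF z] q(1)[OF z] order.trans[OF B(1)[OF z] M(2)] order.trans[OF B(2)[OF z] M(3)]
    by (intro norm_mult_diff_le) auto
  ultimately show "\<exists>p. (\<forall>z\<in>spectrum a. cmod (\<phi> z * \<psi> z - poly p z) \<le> \<delta>) \<and> norm (x * y - alg_eval p a) \<le> \<delta>"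
    using \<eta>(3) by (intro exI[of _ "p * q"]) (fastforce simp: alg_eval_mult)
qed

lemma is_cfc_value_cnj:
  assumes sa: "star a = a" and x: "is_cfc_value a \<phi> x"
  shows "is_cfc_value a (\<lambda>z. cnj (\<phi> z)) (star x)"
  unfolding is_cfc_value_def
proof (intro allI impI)
  fix \<delta> :: real assume "0 < \<delta>"
  then obtain p where p: "\<And>z. z \<in> spectrum a \<Longrightarrow> cmod (\<phi> z - poly p z) \<le> \<delta>" "norm (x - alg_eval p a) \<le> \<delta>"
    by (rule is_cfc_valueE[OF x]) blast
  have "cmod (cnj (\<phi> z) - poly (map_poly cnj p) z) \<le> \<delta>" if z: "z \<in> spectrum a" for z
  proof -
    have "cnj z = z" using Im_spectrum_selfadjoint[OF sa z] by (simp add: complex_eq_iff)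
    then have "poly (map_poly cnj p) z = cnj (poly p z)" using poly_map_cnj[of p z] by simp
    then show ?thesis using p(1)[OF z] by (metis complex_cnj_diff complex_mod_cnj)
  qed
  moreover have "norm (star x - alg_eval (map_poly cnj p) a) \<le> \<delta>"
    using p(2) by (simp add: star_alg_eval[OF sa, symmetric] flip: star_diff)
  ultimately show "\<exists>p. (\<forall>z\<in>spectrum a. cmod (cnj (\<phi> z) - poly p z) \<le> \<delta>) \<and> norm (star x - alg_eval p a) \<le> \<delta>"
    by blast
qed

lemma Cfun_restrictI: "continuous_on X g \<Longrightarrow> restrict g X \<in> Cfun X"
  by (auto simp: Cfun_def cong: continuous_on_cong)

lemma Cfun_continuous: "g \<in> Cfun X \<Longrightarrow> continuous_on X g"
  by (simp add: Cfun_def)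

text \<open>A unital *-homomorphism on \<open>C(X)\<close> does not increase norms: if \<open>\<bar>\<phi>\<bar> \<le> C\<close> and \<open>\<bar>z\<bar> > C\<^sup>2\<close>, then
  \<open>\<bar>\<phi>\<bar>\<^sup>2 - z\<close> is invertible in \<open>C(X)\<close>, so that the spectrum of \<open>\<Phi>(\<phi>)* \<Phi>(\<phi>) = \<Phi>(\<bar>\<phi>\<bar>\<^sup>2)\<close> lies in
  the disc of radius \<open>C\<^sup>2\<close>.\<close>

lemma unital_star_hom_contractive:
  fixes \<Phi> :: "('x :: topological_space \<Rightarrow> complex) \<Rightarrow> 'a :: cstar_algebra"
  assumes hom: "unital_star_hom X \<Phi>" and \<phi>: "\<phi> \<in> Cfun X"
    and C: "0 \<le> C" "\<And>x. x \<in> X \<Longrightarrow> cmod (\<phi> x) \<le> C"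
  shows "norm (\<Phi> \<phi>) \<le> C"
proof -
  note H = hom[unfolded unital_star_hom_def]
  have cont: "continuous_on X \<phi>" using \<phi> by (simp add: Cfun_def)
  define \<psi> where "\<psi> = (\<lambda>x\<in>X. cnj (\<phi> x))"
  define \<omega> where "\<omega> = (\<lambda>x\<in>X. \<psi> x * \<phi> x)"
  have \<psi>: "\<psi> \<in> Cfun X" unfolding \<psi>_def by (intro Cfun_restrictI continuous_intros cont)
  have "continuous_on X \<psi>" using \<psi> by (simp add: Cfun_def)
  then have \<omega>: "\<omega> \<in> Cfun X" unfolding \<omega>_def by (intro Cfun_restrictI continuous_intros cont)
  have \<Phi>\<omega>: "\<Phi> \<omega> = star (\<Phi> \<phi>) * \<Phi> \<phi>"
  proof -
    have "\<Phi> \<omega> = \<Phi> \<psi> * \<Phi> \<phi>" unfolding \<omega>_def using H \<psi> \<phi> by blast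
    also have "\<Phi> \<psi> = star (\<Phi> \<phi>)" unfolding \<psi>_def using H \<phi> by blast
    finally show ?thesis .
  qed
  have "norm (\<Phi> \<omega>) \<le> C\<^sup>2"
  proof (rule norm_le_of_spectrum_le)
    show "star (\<Phi> \<omega>) = \<Phi> \<omega>" by (simp add: \<Phi>\<omega> star_mult star_star)
    fix z assume z: "z \<in> spectrum (\<Phi> \<omega>)"
    show "cmod z \<le> C\<^sup>2"
    proof (rule ccontr)
      assume large: "\<not> cmod z \<le> C\<^sup>2"
      have nz: "\<omega> x - z \<noteq> 0" if "x \<in> X" for x
      proof -
        have "cmod (\<omega> x) = (cmod (\<phi> x))\<^sup>2"
          using that by (simp add: \<omega>_def \<psi>_def norm_mult power2_eq_square)
        then have "cmod (\<omega> x) \<le> C\<^sup>2" using C(2)[OF that] by (simp add: power_mono)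
        then show ?thesis using large by auto
      qed
      have cont\<omega>: "continuous_on X \<omega>" using \<omega> by (simp add: Cfun_def)
      define one where "one = (\<lambda>x\<in>X. 1 :: complex)"
      define g where "g = (\<lambda>x\<in>X. inverse (\<omega> x - z))"
      define m where "m = (\<lambda>x\<in>X. (- z) * one x)"
      define d where "d = (\<lambda>x\<in>X. \<omega> x + m x)"
      have one: "one \<in> Cfun X" unfolding one_def by (intro Cfun_restrictI continuous_intros)
      have g: "g \<in> Cfun X" unfolding g_def using nz by (intro Cfun_restrictI continuous_intros cont\<omega>) auto
      have "continuous_on X one" using one by (simp add: Cfun_def)
      then have m: "m \<in> Cfun X" unfolding m_def by (intro Cfun_restrictI continuous_intros)
      have "continuous_on X m" using m by (simp add: Cfun_def)
      then have d: "d \<in> Cfun X" unfolding d_def by (intro Cfun_restrictI continuous_intros cont\<omega>)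
      have "\<Phi> m = (- z) *\<^sub>C \<Phi> one" using H one unfolding m_def by blast
      moreover have "\<Phi> one = 1" using H unfolding one_def by blast
      moreover have "\<Phi> d = \<Phi> \<omega> + \<Phi> m" using H \<omega> m unfolding d_def by blast
      ultimately have \<Phi>d: "\<Phi> d = \<Phi> \<omega> - z *\<^sub>C 1" by (simp add: scaleC_minus_left)
      have "(\<lambda>x\<in>X. d x * g x) = (\<lambda>x\<in>X. 1)" "(\<lambda>x\<in>X. g x * d x) = (\<lambda>x\<in>X. 1)"
        using nz by (auto simp: d_def m_def one_def g_def)
      then have "\<Phi> d * \<Phi> g = 1" "\<Phi> g * \<Phi> d = 1" using H d g by metis+
      then show False using z by (auto simp: spectrum_iff invertible_elem_def \<Phi>d)
    qed
  qed simp
  then have "(norm (\<Phi> \<phi>))\<^sup>2 \<le> C\<^sup>2" by (simp add: \<Phi>\<omega> cstar_identity)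
  then show ?thesis using C(1) by (rule power2_le_imp_le)
qed

lemma unital_star_hom_poly:
  fixes a :: "'a :: cstar_algebra"
  assumes hom: "unital_star_hom X \<Phi>" and id: "\<Phi> (\<lambda>z\<in>X. z) = a"
  shows "\<Phi> (\<lambda>z\<in>X. poly p z) = alg_eval p a"
proof -
  note H = hom[unfolded unital_star_hom_def]
  have scale: "\<Phi> (\<lambda>z\<in>X. c * g z) = c *\<^sub>C \<Phi> (restrict g X)" if "continuous_on X g" for c g
  proof -
    have "(\<lambda>z\<in>X. c * g z) = (\<lambda>z\<in>X. c * restrict g X z)" by auto
    then show ?thesis using H Cfun_restrictI[OF that] by metis
  qed
  have add: "\<Phi> (\<lambda>z\<in>X. g z + h z) = \<Phi> (restrict g X) + \<Phi> (restrict h X)"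
    if "continuous_on X g" "continuous_on X h" for g h
  proof -
    have "(\<lambda>z\<in>X. g z + h z) = (\<lambda>z\<in>X. restrict g X z + restrict h X z)" by auto
    then show ?thesis using H Cfun_restrictI[OF that(1)] Cfun_restrictI[OF that(2)] by metis
  qed
  have mult: "\<Phi> (\<lambda>z\<in>X. g z * h z) = \<Phi> (restrict g X) * \<Phi> (restrict h X)"
    if "continuous_on X g" "continuous_on X h" for g h
  proof -
    have "(\<lambda>z\<in>X. g z * h z) = (\<lambda>z\<in>X. restrict g X z * restrict h X z)" by auto
    then show ?thesis using H Cfun_restrictI[OF that(1)] Cfun_restrictI[OF that(2)] by metis
  qed
  have const: "\<Phi> (\<lambda>z\<in>X. c) = c *\<^sub>C 1" for c
    using scale[of "\<lambda>_. 1" c] H by simp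
  show ?thesis
  proof (induction p)
    case 0
    then show ?case using const[of 0] by (simp only: poly_0 alg_eval_0 scaleC_zero_left)
  next
    case (pCons c p)
    have "\<Phi> (\<lambda>z\<in>X. poly (pCons c p) z) = \<Phi> (\<lambda>z\<in>X. c) + \<Phi> (\<lambda>z\<in>X. z * poly p z)"
      using add[of "\<lambda>_. c" "\<lambda>z. z * poly p z"] by (simp add: continuous_intros)
    also have "\<Phi> (\<lambda>z\<in>X. z * poly p z) = a * alg_eval p a"
      using mult[of "\<lambda>z. z" "poly p"] id pCons by (simp add: continuous_intros)
    finally show ?case by (simp only: const alg_eval_pCons)
  qed
qed

text \<open>The limits of polynomials form a unital *-homomorphism. Any other one that sends the identity
  to \<open>a\<close> agrees with it on polynomials and does not increase norms, hence agrees with it everywhere. So the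
  description in \<open>cfc\<close> determines it.\<close>

theorem is_cfc_value_cfc:
  fixes a :: "'a :: cstar_algebra"
  assumes sa: "star a = a" and \<phi>: "\<phi> \<in> Cfun (spectrum a)"
  shows "is_cfc_value a \<phi> (cfc a \<phi>)"
proof -
  let ?X = "spectrum a"
  define \<Psi> where "\<Psi> = (\<lambda>\<phi>\<in>Cfun ?X. THE x. is_cfc_value a \<phi> x)"
  have \<Psi>I: "\<Psi> \<phi> = x" if "\<phi> \<in> Cfun ?X" "is_cfc_value a \<phi> x" for \<phi> x
    using that is_cfc_value_unique[OF sa] by (auto simp: \<Psi>_def)
  have \<Psi>D: "is_cfc_value a \<phi> (\<Psi> \<phi>)" if \<phi>: "\<phi> \<in> Cfun ?X" for \<phi>
    using is_cfc_value_exists[OF sa Cfun_continuous[OF \<phi>]] \<Psi>I[OF \<phi>] by blast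
  have \<Psi>Cfun_restrictI: "\<Psi> (restrict g ?X) = x" if "continuous_on ?X g" "is_cfc_value a g x" for g x
    by (intro \<Psi>I Cfun_restrictI that) (rule is_cfc_value_cong[OF that(2)], simp)
  have "unital_star_hom ?X \<Psi>"
    unfolding unital_star_hom_def
  proof (intro conjI ballI allI)
    show "\<Psi> (\<lambda>x\<in>?X. 1) = 1"
      by (rule \<Psi>Cfun_restrictI) (use is_cfc_value_cong[OF is_cfc_value_poly[of a "[:1:]"], of "\<lambda>_. 1"] in simp_all)
  next
    fix \<phi> \<psi> assume "\<phi> \<in> Cfun ?X" "\<psi> \<in> Cfun ?X"
    then show "\<Psi> (\<lambda>x\<in>?X. \<phi> x + \<psi> x) = \<Psi> \<phi> + \<Psi> \<psi>"
      by (intro \<Psi>Cfun_restrictI is_cfc_value_add \<Psi>D Cfun_continuous continuous_intros)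
  next
    fix \<phi> \<psi> assume "\<phi> \<in> Cfun ?X" "\<psi> \<in> Cfun ?X"
    then show "\<Psi> (\<lambda>x\<in>?X. \<phi> x * \<psi> x) = \<Psi> \<phi> * \<Psi> \<psi>"
      by (intro \<Psi>Cfun_restrictI is_cfc_value_mult \<Psi>D Cfun_continuous continuous_intros)
  next
    fix \<phi> c assume \<phi>: "\<phi> \<in> Cfun ?X"
    have "is_cfc_value a (\<lambda>z. poly [:c:] z * \<phi> z) (alg_eval [:c:] a * \<Psi> \<phi>)"
      by (intro is_cfc_value_mult is_cfc_value_poly \<Psi>D Cfun_continuous \<phi> continuous_intros)
    then show "\<Psi> (\<lambda>x\<in>?X. c * \<phi> x) = c *\<^sub>C \<Psi> \<phi>"
      by (intro \<Psi>Cfun_restrictI continuous_intros Cfun_continuous \<phi>) (simp add: mult_scaleC_left)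
  next
    fix \<phi> assume \<phi>: "\<phi> \<in> Cfun ?X"
    then show "\<Psi> (\<lambda>x\<in>?X. cnj (\<phi> x)) = star (\<Psi> \<phi>)"
      by (intro \<Psi>Cfun_restrictI is_cfc_value_cnj[OF sa] \<Psi>D continuous_intros Cfun_continuous)
  qed
  moreover have "\<Psi> (\<lambda>z\<in>?X. z) = a"
    by (rule \<Psi>Cfun_restrictI) (use is_cfc_value_cong[OF is_cfc_value_poly[of a "[:0, 1:]"], of "\<lambda>z. z"] in simp_all)
  moreover have "\<Psi> \<in> extensional (Cfun ?X)" by (simp add: \<Psi>_def)
  moreover have "\<Phi> = \<Psi>"
    if ext: "\<Phi> \<in> extensional (Cfun ?X)" and hom: "unital_star_hom ?X \<Phi>" and id: "\<Phi> (\<lambda>z\<in>?X. z) = a" for \<Phi>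
  proof (rule extensionalityI[OF ext \<open>\<Psi> \<in> extensional (Cfun ?X)\<close>])
    note H = hom[unfolded unital_star_hom_def]
    fix \<phi> assume \<phi>: "\<phi> \<in> Cfun ?X"
    have "is_cfc_value a \<phi> (\<Phi> \<phi>)" unfolding is_cfc_value_def
    proof (intro allI impI)
      fix \<delta> :: real assume \<delta>: "0 < \<delta>"
      obtain p where p: "\<And>z. z \<in> ?X \<Longrightarrow> cmod (\<phi> z - poly p z) \<le> \<delta>"
        using complex_polynomial_approximation[OF compact_spectrum Im_spectrum_selfadjoint[OF sa] Cfun_continuous[OF \<phi>] \<delta>]
        by blast
      define \<pi> where "\<pi> = (\<lambda>z\<in>?X. poly p z)"
      define \<mu> where "\<mu> = (\<lambda>z\<in>?X. (-1) * \<pi> z)"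
      define d where "d = (\<lambda>z\<in>?X. \<phi> z + \<mu> z)"
      have \<pi>: "\<pi> \<in> Cfun ?X" unfolding \<pi>_def by (intro Cfun_restrictI continuous_intros)
      then have \<mu>: "\<mu> \<in> Cfun ?X" unfolding \<mu>_def by (intro Cfun_restrictI continuous_intros Cfun_continuous)
      then have d: "d \<in> Cfun ?X" unfolding d_def by (intro Cfun_restrictI continuous_intros Cfun_continuous \<phi>)
      have "\<Phi> \<pi> = alg_eval p a" unfolding \<pi>_def by (rule unital_star_hom_poly[OF hom id])
      moreover have "\<Phi> \<mu> = (-1) *\<^sub>C \<Phi> \<pi>" unfolding \<mu>_def using H \<pi> by blast
      moreover have "\<Phi> d = \<Phi> \<phi> + \<Phi> \<mu>" unfolding d_def using H \<phi> \<mu> by blast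
      ultimately have "\<Phi> d = \<Phi> \<phi> - alg_eval p a" by (simp add: scaleC_minus_left)
      moreover have "norm (\<Phi> d) \<le> \<delta>"
        using \<delta> p by (intro unital_star_hom_contractive[OF hom d]) (auto simp: d_def \<mu>_def \<pi>_def)
      ultimately show "\<exists>p. (\<forall>z\<in>?X. cmod (\<phi> z - poly p z) \<le> \<delta>) \<and> norm (\<Phi> \<phi> - alg_eval p a) \<le> \<delta>"
        using p by auto
    qed
    then show "\<Phi> \<phi> = \<Psi> \<phi>" using \<Psi>I[OF \<phi>] by simp
  qed
  ultimately have "cfc a = \<Psi>"
    unfolding cfc_def by (intro the_equality) blast+
  then show ?thesis using \<Psi>D[OF \<phi>] by simp
qed

lemma op_fun_dist_alg_eval:
  fixes a :: "'a :: cstar_algebra sa"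
  assumes f: "continuous_on UNIV f" and a: "norm a \<le> r" and C: "0 \<le> C"
    and approx: "\<And>x. \<bar>x\<bar> \<le> r \<Longrightarrow> cmod (f x - poly p (complex_of_real x)) \<le> C"
  shows "norm (op_fun f a - alg_eval p (sa_elem a)) \<le> C"
proof -
  have sa: "star (sa_elem a) = sa_elem a" using sa_elem[of a] by simp
  let ?X = "spectrum (sa_elem a)"
  have "continuous_on ?X (\<lambda>z. f (Re z))" by (intro continuous_on_compose2[OF f] continuous_intros) auto
  then have "(\<lambda>z\<in>?X. f (Re z)) \<in> Cfun ?X" by (rule Cfun_restrictI)
  then have "is_cfc_value (sa_elem a) (\<lambda>z\<in>?X. f (Re z)) (op_fun f a)"
    unfolding op_fun_def by (rule is_cfc_value_cfc[OF sa])
  then show ?thesis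
  proof (rule is_cfc_value_dist[OF sa _ C])
    fix z assume z: "z \<in> ?X"
    have "z = complex_of_real (Re z)" using Im_spectrum_selfadjoint[OF sa z] by (simp add: complex_eq_iff)
    moreover have "\<bar>Re z\<bar> \<le> r"
      using norm_le_of_mem_spectrum[OF z] abs_Re_le_cmod[of z] a by (simp add: norm_sa.rep_eq)
    ultimately show "cmod ((\<lambda>z\<in>?X. f (Re z)) z - poly p z) \<le> C" using approx[of "Re z"] z by simp
  qed
qed

section \<open>Divided differences\<close>

lemma inj_on_collapse:
  assumes "inj_on s {..Suc i}"
  shows "inj_on (s(i := s (Suc i))) {..i}"
proof (rule inj_onI)
  fix x y assume xy: "x \<in> {..i}" "y \<in> {..i}" "(s(i := s (Suc i))) x = (s(i := s (Suc i))) y"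
  have "a = b" if "a \<le> Suc i" "b \<le> Suc i" "s a = s b" for a b
    using inj_onD[OF assms, of a b] that by simp
  from this[of x y] this[of "Suc i" y] this[of x "Suc i"] show "x = y"
    using xy by (auto split: if_splits)
qed

text \<open>A divided difference at fixed points is a linear combination of values of \<open>f\<close>; this gives
  its compatibility with sums and integrals.\<close>

lemma dd_weights: "\<exists>w. \<forall>f. dd f i s = (\<Sum>j\<le>i. w j * f (s j))"
proof (induction i arbitrary: s)
  case 0
  show ?case by (intro exI[of _ "\<lambda>_. 1"]) simp
next
  case (Suc i)
  obtain w where w: "\<And>f. dd f i s = (\<Sum>j\<le>i. w j * f (s j))" using Suc by meson
  obtain w' where w': "\<And>f. dd f i (s(i := s (Suc i))) = (\<Sum>j\<le>i. w' j * f ((s(i := s (Suc i))) j))"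
    using Suc by meson
  define d where "d = complex_of_real (s i - s (Suc i))"
  define v where "v j = (if j < i then (w j - w' j) / d else if j = i then w i / d else - w' i / d)" for j
  have "dd f (Suc i) s = (\<Sum>j\<le>Suc i. v j * f (s j))" for f
  proof -
    have "dd f i s = (\<Sum>j<i. w j * f (s j)) + w i * f (s i)"
      by (simp add: w flip: lessThan_Suc_atMost)
    moreover have "dd f i (s(i := s (Suc i))) = (\<Sum>j<i. w' j * f (s j)) + w' i * f (s (Suc i))"
      by (simp add: w' flip: lessThan_Suc_atMost)
    moreover have "(\<Sum>j\<le>Suc i. v j * f (s j)) =
        (\<Sum>j<i. (w j * f (s j) - w' j * f (s j)) / d) + w i / d * f (s i) + (- w' i / d) * f (s (Suc i))"
      by (simp add: v_def flip: lessThan_Suc_atMost) (simp add: left_diff_distrib)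
    moreover have "dd f (Suc i) s = (dd f i s - dd f i (s(i := s (Suc i)))) / d"
      by (simp add: d_def)
    ultimately show ?thesis
      by (simp only:) (simp add: sum_subtractf sum_divide_distrib[symmetric] diff_divide_distrib add_divide_distrib)
  qed
  then show ?case by blast
qed

lemma dd_diff: "dd (\<lambda>x. f x - g x) i s = dd f i s - dd g i s"
  by (induction i arbitrary: s) (simp_all add: diff_divide_distrib)

lemma dd_linear_combination:
  "dd (\<lambda>x. \<Sum>n\<in>A. c n * F n x) i s = (\<Sum>n\<in>A. c n * dd (F n) i s)"
proof -
  obtain w where w: "\<And>f. dd f i s = (\<Sum>j\<le>i. w j * f (s j))" using dd_weights by meson
  have "(\<Sum>j\<le>i. w j * (\<Sum>n\<in>A. c n * F n (s j))) = (\<Sum>n\<in>A. c n * (\<Sum>j\<le>i. w j * F n (s j)))"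
    by (simp add: sum_distrib_left sum.swap[of _ A] mult.left_commute)
  then show ?thesis by (simp add: w)
qed

lemma dd_affine:
  "dd (\<lambda>x. g (c + u * x)) i t = complex_of_real u ^ i * dd g i (\<lambda>j. c + u * t j)"
proof (induction i arbitrary: t)
  case (Suc i)
  have upd: "(\<lambda>j. c + u * (t(i := t (Suc i))) j) = (\<lambda>j. c + u * t j)(i := c + u * t (Suc i))"
    by auto
  show ?case
  proof (cases "u = 0")
    case False
    have "complex_of_real (c + u * t i - (c + u * t (Suc i))) = of_real u * of_real (t i - t (Suc i))"
      by (simp add: algebra_simps flip: of_real_mult)
    moreover have "(U ^ i * A - U ^ i * B) / D = U ^ Suc i * ((A - B) / (U * D))" if "U \<noteq> 0" for U A B D :: complex
      using that by (simp add: right_diff_distrib[symmetric])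
    ultimately show ?thesis using False by (simp only: dd.simps Suc upd of_real_eq_0_iff not_False_eq_True)
  next
    case True
    have "dd (\<lambda>x. g (c + u * x)) i t = dd (\<lambda>x. g (c + u * x)) i (t(i := t (Suc i)))"
      unfolding Suc by (simp add: True)
    then show ?thesis using True by (simp only: dd.simps) simp
  qed
qed simp

text \<open>Splitting off the first point instead of the last one.\<close>

lemma dd_Suc_first:
  "dd f (Suc i) s = dd (\<lambda>x. (f (s 0) - f x) / complex_of_real (s 0 - x)) i (\<lambda>j. s (Suc j))"
proof (induction i arbitrary: s)
  case (Suc i)
  have upd: "(\<lambda>j. (s(Suc i := s (Suc (Suc i)))) (Suc j)) = (\<lambda>j. s (Suc j))(i := s (Suc (Suc i)))"
    by auto
  have "dd f (Suc (Suc i)) s = (dd f (Suc i) s - dd f (Suc i) (s(Suc i := s (Suc (Suc i))))) /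
      complex_of_real (s (Suc i) - s (Suc (Suc i)))"
    by (rule dd.simps(2))
  also have "\<dots> = dd (\<lambda>x. (f (s 0) - f x) / complex_of_real (s 0 - x)) (Suc i) (\<lambda>j. s (Suc j))"
    unfolding Suc upd unfolding dd.simps(2) by simp
  finally show ?case .
qed simp

text \<open>The Leibniz rule for multiplication by the coordinate. Taking powers for \<open>g\<close>, it says how the
  divided differences of \<open>x ^ Suc n\<close> arise from those of \<open>x ^ n\<close>.\<close>

lemma dd_mult_id:
  assumes "inj_on s {..Suc i}"
  shows "dd (\<lambda>x. complex_of_real x * g x) (Suc i) s =
    complex_of_real (s 0) * dd g (Suc i) s + dd g i (\<lambda>j. s (Suc j))"
  using assms
proof (induction i arbitrary: s)
  case 0
  then have "s 0 \<noteq> s (Suc 0)" by (auto simp: inj_on_def)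
  then show ?case by (simp add: field_simps)
next
  case (Suc i)
  define s' where "s' = s(Suc i := s (Suc (Suc i)))"
  have "inj_on s {..Suc i}" by (rule inj_on_subset[OF Suc.prems]) auto
  note IH = Suc.IH[OF this]
  have "inj_on s' {..Suc i}" unfolding s'_def by (rule inj_on_collapse[OF Suc.prems])
  note IH' = Suc.IH[OF this]
  have upd: "(\<lambda>j. s' (Suc j)) = (\<lambda>j. s (Suc j))(i := s (Suc (Suc i)))" by (auto simp: s'_def)
  have s'0: "s' 0 = s 0" by (simp add: s'_def)
  define d where "d = complex_of_real (s (Suc i) - s (Suc (Suc i)))"
  have rec: "dd h (Suc (Suc i)) s = (dd h (Suc i) s - dd h (Suc i) s') / d" for h
    unfolding s'_def d_def by (subst dd.simps(2)) simp
  have rec': "dd g (Suc i) (\<lambda>j. s (Suc j)) = (dd g i (\<lambda>j. s (Suc j)) - dd g i (\<lambda>j. s' (Suc j))) / d"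
    unfolding upd d_def by (subst dd.simps(2)) simp
  show ?case unfolding rec rec' IH IH' s'0
    by (simp add: right_diff_distrib diff_divide_distrib add_divide_distrib)
qed

subsection \<open>Functions of class \<open>C\<^sup>k\<close>\<close>

lemma continuous_on_UNIV_of_differentiable:
  "(\<And>x. f differentiable (at x)) \<Longrightarrow> continuous_on UNIV (f :: real \<Rightarrow> complex)"
  by (simp add: continuous_at_imp_continuous_on differentiable_imp_continuous_within)

lemma Ck_real_Suc_imp: "Ck_real (Suc k) f \<Longrightarrow> Ck_real k f"
proof (induction k arbitrary: f)
  case 0
  then show ?case by (auto intro: continuous_on_UNIV_of_differentiable)
next
  case (Suc k)
  have "Ck_real (Suc k) (\<lambda>x. vector_derivative f (at x))" using Suc.prems by simp
  from Suc.IH[OF this] Suc.prems show ?case by simp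
qed

lemma Ck_real_mono: "Ck_real k f \<Longrightarrow> i \<le> k \<Longrightarrow> Ck_real i f"
  by (induction k) (auto simp: le_Suc_eq dest: Ck_real_Suc_imp simp del: Ck_real.simps(2))

lemma Ck_real_continuous: "Ck_real k f \<Longrightarrow> continuous_on UNIV f"
  using Ck_real_mono[of k f 0] by simp

subsection \<open>Continuous extension of divided differences\<close>

text \<open>The Hermite--Genocchi integral of \<open>f\<^bsup>(i)\<^esup>\<close> over the simplex spanned by
  \<open>s 0, \<dots>, s i\<close>, organised as a recursion in which the simplex is the cone with apex \<open>s 0\<close>
  over the opposite face.\<close>

primrec hermite_genocchi :: "nat \<Rightarrow> (real \<Rightarrow> complex) \<Rightarrow> (nat \<Rightarrow> real) \<Rightarrow> complex"
  where
    "hermite_genocchi 0 f s = f (s 0)"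
  | "hermite_genocchi (Suc i) f s = integral {0..1} (\<lambda>u. complex_of_real u ^ i *
      hermite_genocchi i (\<lambda>x. vector_derivative f (at x)) (\<lambda>j. (1 - u) * s 0 + u * s (Suc j)))"

lemma continuous_on_hermite_genocchi:
  "Ck_real i f \<Longrightarrow> continuous_on UNIV (hermite_genocchi i f)"
proof (induction i arbitrary: f)
  case 0
  then have "continuous_on UNIV f" by simp
  then have "continuous_on UNIV (\<lambda>s :: nat \<Rightarrow> real. f (s 0))"
    by (rule continuous_on_compose2) (auto intro: continuous_on_product_coordinates)
  moreover have "hermite_genocchi 0 f = (\<lambda>s. f (s 0))" by auto
  ultimately show ?case by simp
next
  case (Suc i)
  define f' where "f' = (\<lambda>x. vector_derivative f (at x))"
  have "Ck_real i f'" using Suc.prems by (simp add: f'_def)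
  note cont = Suc.IH[OF this]
  have coord: "continuous_on A (\<lambda>p. fst p j)" for A :: "((nat \<Rightarrow> real) \<times> real) set" and j
    by (rule continuous_on_product_then_coordinatewise) (intro continuous_intros)
  have "continuous_on (UNIV \<times> cbox 0 1) (\<lambda>(s, u). complex_of_real u ^ i *
      hermite_genocchi i f' (\<lambda>j. (1 - u) * s 0 + u * s (Suc j)))"
    unfolding split_beta
    by (intro continuous_intros continuous_on_compose2[OF cont]
        continuous_on_coordinatewise_then_product coord) auto
  then have "continuous_on UNIV (\<lambda>s. integral (cbox 0 1) (\<lambda>u. complex_of_real u ^ i *
      hermite_genocchi i f' (\<lambda>j. (1 - u) * s 0 + u * s (Suc j))))"
    by (rule integral_continuous_on_param)
  then show ?case by (simp add: f'_def)
qed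

lemma difference_quotient_eq_integral:
  assumes f: "Ck_real 1 f" and "x \<noteq> c"
  shows "((\<lambda>u. vector_derivative f (at ((1 - u) * c + u * x))) has_integral
    (f c - f x) / complex_of_real (c - x)) {0..1}"
proof -
  have fd: "(f has_vector_derivative vector_derivative f (at y)) (at y)" for y
    using f unfolding One_nat_def Ck_real.simps vector_derivative_works by blast
  have "((\<lambda>u. f ((1 - u) * c + u * x)) has_vector_derivative
      (x - c) *\<^sub>R vector_derivative f (at ((1 - u) * c + u * x))) (at u within {0..1})" for u
  proof -
    have "((\<lambda>u. (1 - u) * c + u * x) has_real_derivative x - c) (at u within {0..1})"
      by (auto intro!: derivative_eq_intros)
    then have "((\<lambda>u. (1 - u) * c + u * x) has_vector_derivative x - c) (at u within {0..1})"
      by (simp only: has_real_derivative_iff_has_vector_derivative)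
    from vector_diff_chain_within[OF this has_vector_derivative_at_within[OF fd]]
    show ?thesis by (simp only: o_def)
  qed
  then have "((\<lambda>u. (x - c) *\<^sub>R vector_derivative f (at ((1 - u) * c + u * x))) has_integral
      f ((1 - 1) * c + 1 * x) - f ((1 - 0) * c + 0 * x)) {0..1}"
    by (intro fundamental_theorem_of_calculus) auto
  from has_integral_cmul[OF this, of "1 / (x - c)"]
  have "((\<lambda>u. vector_derivative f (at ((1 - u) * c + u * x))) has_integral
      (1 / (x - c)) *\<^sub>R (f x - f c)) {0..1}"
    using \<open>x \<noteq> c\<close> by simp
  moreover have "(1 / (x - c)) *\<^sub>R (f x - f c) = (f c - f x) / complex_of_real (c - x)"
    by (simp add: scaleR_conv_of_real divide_simps) (simp add: algebra_simps)
  ultimately show ?thesis by simp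
qed

text \<open>By the choice of the first point as apex, the divided difference of order \<open>i + 1\<close> is one
  of order \<open>i\<close> of the difference quotient of \<open>f\<close> at \<open>s 0\<close>, and this quotient is an average of
  rescaled copies of \<open>f'\<close>.\<close>

lemma hermite_genocchi_eq_dd:
  "Ck_real i f \<Longrightarrow> inj_on s {..i} \<Longrightarrow> hermite_genocchi i f s = dd f i s"
proof (induction i arbitrary: f s)
  case (Suc i)
  define f' where "f' = (\<lambda>x. vector_derivative f (at x))"
  define h where "h x = (f (s 0) - f x) / complex_of_real (s 0 - x)" for x
  define t where "t j = s (Suc j)" for j
  define F where "F u = dd (\<lambda>x. f' ((1 - u) * s 0 + u * x)) i t" for u
  have f1: "Ck_real 1 f" using Ck_real_mono[OF Suc.prems(1), of 1] by simp
  obtain w where w: "\<And>g. dd g i t = (\<Sum>j\<le>i. w j * g (t j))" using dd_weights by meson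
  have "(F has_integral (\<Sum>j\<le>i. w j * h (t j))) {0..1}"
    unfolding F_def w f'_def h_def
  proof (intro has_integral_sum has_integral_mult_right difference_quotient_eq_integral f1)
    fix j assume "j \<in> {..i}"
    then show "t j \<noteq> s 0" using inj_onD[OF Suc.prems(2), of "Suc j" 0] by (auto simp: t_def)
  qed simp
  then have F: "integral {0..1} F = dd f (Suc i) s"
  proof -
    have "dd f (Suc i) s = dd h i t" by (simp only: dd_Suc_first h_def[abs_def] t_def[abs_def])
    also have "\<dots> = (\<Sum>j\<le>i. w j * h (t j))" by (rule w)
    finally show ?thesis using \<open>(F has_integral _) _\<close> by (simp only: integral_unique)
  qed
  have "integral {0..1} (\<lambda>u. complex_of_real u ^ i *
      hermite_genocchi i f' (\<lambda>j. (1 - u) * s 0 + u * s (Suc j))) = integral {0..1} F"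
  proof (rule integral_spike[of "{0}"])
    fix u :: real assume u: "u \<in> {0..1} - {0}"
    have "inj_on (\<lambda>j. (1 - u) * s 0 + u * s (Suc j)) {..i}"
      using u Suc.prems(2) by (auto simp: inj_on_def)
    then have "hermite_genocchi i f' (\<lambda>j. (1 - u) * s 0 + u * s (Suc j)) =
        dd f' i (\<lambda>j. (1 - u) * s 0 + u * t j)"
      unfolding t_def using Suc.prems(1) by (intro Suc.IH) (auto simp: f'_def)
    then show "F u = complex_of_real u ^ i * hermite_genocchi i f' (\<lambda>j. (1 - u) * s 0 + u * s (Suc j))"
      by (simp add: F_def dd_affine)
  qed simp
  then show ?case by (simp add: F f'_def)
qed simp

text \<open>Points with distinct coordinates are dense: moving \<open>s\<close> in the direction \<open>(0, 1, \<dots>, i)\<close>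
  separates its coordinates for all but finitely many values of the parameter.\<close>

lemma Cfun_rspace_eqI:
  assumes g: "g \<in> Cfun (rspace (Suc i))" and h: "h \<in> Cfun (rspace (Suc i))"
    and eq: "\<And>s. s \<in> rspace (Suc i) \<Longrightarrow> inj_on s {..i} \<Longrightarrow> g s = h s"
  shows "g = h"
proof (rule extensionalityI[of g "rspace (Suc i)"])
  fix s assume s: "s \<in> rspace (Suc i)"
  define p where "p t = (\<lambda>j\<in>{..<Suc i}. s j + t * real j)" for t
  have p0: "p 0 = s" using s by (auto simp: p_def rspace_def PiE_def extensional_def)
  have p: "p t \<in> rspace (Suc i)" for t by (auto simp: p_def rspace_def)
  have cont_p: "continuous_on UNIV p"
  proof (rule continuous_on_coordinatewise_then_product)
    fix j
    show "continuous_on UNIV (\<lambda>t. p t j)"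
      by (cases "j < Suc i") (auto simp: p_def intro!: continuous_intros)
  qed
  have lim: "((\<lambda>t. q (p t)) \<longlongrightarrow> q s) (at 0)" if "q \<in> Cfun (rspace (Suc i))" for q
  proof -
    have "continuous_on (rspace (Suc i)) q" using that by (simp add: Cfun_def)
    then have "continuous_on UNIV (\<lambda>t. q (p t))"
      using continuous_on_compose2[OF _ cont_p] p by blast
    then show ?thesis unfolding p0[symmetric]
      by (simp add: continuous_on_eq_continuous_at isCont_def)
  qed
  define B where "B = (\<lambda>(a, b). (s a - s b) / (real b - real a)) ` ({..i} \<times> {..i})"
  have "inj_on (p t) {..i}" if "t \<notin> B" for t
  proof (rule inj_onI, rule ccontr)
    fix a b assume ab: "a \<in> {..i}" "b \<in> {..i}" "p t a = p t b" "a \<noteq> b"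
    then have "t * (real b - real a) = s a - s b" by (simp add: p_def algebra_simps)
    then have "t = (s a - s b) / (real b - real a)" using ab(4) by (simp add: field_simps)
    then have "t \<in> B" using ab unfolding B_def by (intro image_eqI[of _ _ "(a, b)"]) auto
    then show False using that by blast
  qed
  moreover have "finite B" by (simp add: B_def)
  then have "\<forall>\<^sub>F t in at 0. t \<notin> B"
    using islimpt_finite islimpt_iff_eventually by blast
  ultimately have "\<forall>\<^sub>F t in at 0. g (p t) = h (p t)"
    by (auto elim!: eventually_mono intro: eq p)
  from Lim_transform_eventually[OF lim[OF g] this] lim[OF h] show "g s = h s"
    by (intro LIM_unique)
qed (use g h in \<open>auto simp: Cfun_def\<close>)

lemma divided_difference_eqI:
  assumes "g \<in> Cfun (rspace (Suc i))"
    and "\<And>s. s \<in> rspace (Suc i) \<Longrightarrow> inj_on s {..i} \<Longrightarrow> g s = dd f i s"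
  shows "divided_difference f i = g"
  unfolding divided_difference_def
  by (rule the_equality) (use assms in \<open>auto intro: Cfun_rspace_eqI\<close>)

lemma
  assumes "Ck_real i f"
  shows divided_difference_Cfun: "divided_difference f i \<in> Cfun (rspace (Suc i))"
    and divided_difference_eq_dd:
      "s \<in> rspace (Suc i) \<Longrightarrow> inj_on s {..i} \<Longrightarrow> divided_difference f i s = dd f i s"
proof -
  define g where "g = restrict (hermite_genocchi i f) (rspace (Suc i))"
  have "continuous_on (rspace (Suc i)) (hermite_genocchi i f)"
    using continuous_on_hermite_genocchi[OF assms] by (rule continuous_on_subset) simp
  then have g: "g \<in> Cfun (rspace (Suc i))" unfolding g_def by (rule Cfun_restrictI)
  have g_dd: "g s = dd f i s" if "s \<in> rspace (Suc i)" "inj_on s {..i}" for s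
    using that hermite_genocchi_eq_dd[OF assms] by (simp add: g_def)
  have "divided_difference f i = g" using g g_dd by (rule divided_difference_eqI)
  then show "divided_difference f i \<in> Cfun (rspace (Suc i))"
    and "s \<in> rspace (Suc i) \<Longrightarrow> inj_on s {..i} \<Longrightarrow> divided_difference f i s = dd f i s"
    using g g_dd by simp_all
qed

lemma divided_difference_diff:
  assumes "Ck_real i f" "Ck_real i g"
  shows "divided_difference (\<lambda>x. f x - g x) i =
    (\<lambda>s\<in>rspace (Suc i). divided_difference f i s - divided_difference g i s)"
proof (rule divided_difference_eqI)
  show "(\<lambda>s\<in>rspace (Suc i). divided_difference f i s - divided_difference g i s) \<in> Cfun (rspace (Suc i))"
    by (intro Cfun_restrictI continuous_intros Cfun_continuous divided_difference_Cfun assms)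
  fix s assume "s \<in> rspace (Suc i)" "inj_on s {..i}"
  then show "(\<lambda>s\<in>rspace (Suc i). divided_difference f i s - divided_difference g i s) s =
      dd (\<lambda>x. f x - g x) i s"
    using divided_difference_eq_dd[OF assms(1)] divided_difference_eq_dd[OF assms(2)] by (simp add: dd_diff)
qed

lemma divided_difference_0:
  assumes "continuous_on UNIV f"
  shows "divided_difference f 0 = (\<lambda>s\<in>rspace 1. f (s 0))"
proof -
  have "continuous_on (rspace 1) (\<lambda>s. f (s 0))"
    by (intro continuous_on_compose2[OF assms] continuous_on_subset[OF continuous_on_product_coordinates]) auto
  from Cfun_restrictI[OF this] show ?thesis
    by (intro divided_difference_eqI) simp_all
qed

section \<open>Limits of smooth maps and their derivatives\<close>

abbreviation prod_norm :: "nat \<Rightarrow> (nat \<Rightarrow> 'v :: real_normed_vector) \<Rightarrow> real"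
  where "prod_norm i b \<equiv> \<Prod>j<i. norm (b j)"

text \<open>\<open>E i a b\<close> is the value of the \<open>i\<close>-th derivative at \<open>a\<close> of a smooth map \<open>E 0\<close> in the directions
  \<open>b 0, \<dots>, b (i - 1)\<close>. The derivative is only taken along lines, since boundedness on balls turns
  this into Frechet differentiability.\<close>

definition smooth_jet :: "(nat \<Rightarrow> 'v :: real_normed_vector \<Rightarrow> (nat \<Rightarrow> 'v) \<Rightarrow> 'w :: real_normed_vector) \<Rightarrow> bool"
  where "smooth_jet E \<longleftrightarrow>
    (\<forall>i a b b'. (\<forall>j<i. b j = b' j) \<longrightarrow> E i a b = E i a b') \<and>
    (\<forall>i a b. \<forall>j<i. linear (\<lambda>v. E i a (b(j := v)))) \<and>
    (\<forall>i r. \<exists>K\<ge>0. \<forall>a b. norm a \<le> r \<longrightarrow> norm (E i a b) \<le> K * prod_norm i b) \<and>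
    (\<forall>i a h b t. ((\<lambda>t. E i (a + t *\<^sub>R h) b) has_vector_derivative
      E (Suc i) (a + t *\<^sub>R h) (case_nat h b)) (at t))"

lemma smooth_jet_cong: "smooth_jet E \<Longrightarrow> (\<And>j. j < i \<Longrightarrow> b j = b' j) \<Longrightarrow> E i a b = E i a b'"
  by (simp add: smooth_jet_def)

lemma smooth_jet_linear: "smooth_jet E \<Longrightarrow> j < i \<Longrightarrow> linear (\<lambda>v. E i a (b(j := v)))"
  by (simp add: smooth_jet_def)

lemma smooth_jet_bound:
  assumes "smooth_jet E"
  obtains K where "0 \<le> K" "\<And>a b. norm a \<le> r \<Longrightarrow> norm (E i a b) \<le> K * prod_norm i b"
  using assms[unfolded smooth_jet_def, THEN conjunct2, THEN conjunct2, THEN conjunct1, rule_format, of r i]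
  by auto

lemma smooth_jet_deriv:
  "smooth_jet E \<Longrightarrow>
    ((\<lambda>t. E i (a + t *\<^sub>R h) b) has_vector_derivative E (Suc i) (a + t *\<^sub>R h) (case_nat h b)) (at t)"
  by (simp add: smooth_jet_def)

lemma mean_value_inequality_unit_interval:
  fixes g :: "real \<Rightarrow> 'w :: banach"
  assumes "\<And>t. (g has_vector_derivative g' t) (at t)"
    and "\<And>t. 0 \<le> t \<Longrightarrow> t \<le> 1 \<Longrightarrow> norm (g' t - c) \<le> B"
  shows "norm (g 1 - g 0 - c) \<le> B"
proof -
  have "0 \<le> B" using assms(2)[of 0] norm_ge_zero[of "g' 0 - c"] by linarith
  have "((\<lambda>t. g' t) has_integral g 1 - g 0) {0..1}"
    by (rule fundamental_theorem_of_calculus) (auto intro: has_vector_derivative_at_within assms)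
  moreover have "((\<lambda>t. c) has_integral c) {0..1 :: real}"
    using has_integral_const_real[of c 0 1] by simp
  ultimately have "((\<lambda>t. g' t - c) has_integral g 1 - g 0 - c) (cbox 0 1)"
    by (simp add: has_integral_diff)
  from has_integral_bound[OF \<open>0 \<le> B\<close> this] show ?thesis using assms(2) by simp
qed

lemma norm_diff_add_le:
  fixes x y z :: "'w :: real_normed_vector"
  assumes "norm x \<le> A" "norm y \<le> B" "norm z \<le> C"
  shows "norm (x - y + z) \<le> A + B + C"
  using norm_triangle_ineq[of "x - y" z] norm_triangle_ineq4[of x y] assms by linarith

lemma le_of_le_add_small_multiple:
  fixes X A B :: real
  assumes "\<And>e. 0 < e \<Longrightarrow> X \<le> A + e * B"
  shows "X \<le> A"
proof (cases "B \<le> 0")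
  case True
  then show ?thesis using assms[of 1] by linarith
next
  case False
  show ?thesis
  proof (rule field_le_epsilon)
    fix e :: real assume "0 < e"
    then show "X \<le> A + e" using assms[of "e / B"] False by simp
  qed
qed

lemma eq_of_norm_diff_le_small_multiple:
  fixes x y :: "'w :: real_normed_vector"
  assumes "\<And>e. 0 < e \<Longrightarrow> norm (x - y) \<le> e * B"
  shows "x = y"
  using le_of_le_add_small_multiple[of "norm (x - y)" 0 B] assms by simp

lemma multilinear_norm_bounds:
  assumes C: "0 \<le> C" and M: "\<And>b. norm (M b) \<le> C * prod_norm i b"
  shows "0 \<le> multilinear_norm i M" "multilinear_norm i M \<le> C"
proof -
  define S where "S = {b :: nat \<Rightarrow> 'a. \<forall>j<i. norm (b j) \<le> 1}"
  have le: "norm (M b) \<le> C" if "b \<in> S" for b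
  proof -
    have "prod_norm i b \<le> 1" using that by (intro prod_le_1) (auto simp: S_def)
    then have "C * prod_norm i b \<le> C * 1" using C by (rule mult_left_mono)
    then show ?thesis using M[of b] by simp
  qed
  have ne: "(\<lambda>_. 0) \<in> S" by (simp add: S_def)
  have N: "multilinear_norm i M = (SUP b\<in>S. norm (M b))" by (simp add: multilinear_norm_def S_def)
  have "S \<noteq> {}" using ne by auto
  then show "multilinear_norm i M \<le> C" unfolding N using le by (rule cSUP_least)
  have "bdd_above ((\<lambda>b. norm (M b)) ` S)" using le by (intro bdd_aboveI[of _ C]) auto
  from cSUP_upper[OF ne this] show "0 \<le> multilinear_norm i M"
    unfolding N by (rule order.trans[OF norm_ge_zero])
qed

text \<open>\<open>D 0\<close> and its would-be derivatives \<open>D 1, \<dots>, D k\<close> are approximated, simultaneously and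
  uniformly on balls, by smooth maps and their derivatives. The approximating map may depend on the
  ball.\<close>

locale jet_limit =
  fixes k :: nat and D :: "nat \<Rightarrow> 'v :: real_normed_vector \<Rightarrow> (nat \<Rightarrow> 'v) \<Rightarrow> 'w :: banach"
  assumes approx: "\<And>r \<epsilon>. 0 < r \<Longrightarrow> 0 < \<epsilon> \<Longrightarrow> \<exists>E. smooth_jet E \<and>
    (\<forall>i\<le>k. \<forall>a b. norm a \<le> r \<longrightarrow> norm (D i a b - E i a b) \<le> \<epsilon> * prod_norm i b)"
begin

lemma approx_at:
  assumes "0 < \<epsilon>"
  obtains E where "smooth_jet E"
    "\<And>i x b. i \<le> k \<Longrightarrow> norm (x - a) \<le> 1 \<Longrightarrow> norm (D i x b - E i x b) \<le> \<epsilon> * prod_norm i b"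
proof -
  obtain E where E: "smooth_jet E"
    "\<And>i x b. i \<le> k \<Longrightarrow> norm x \<le> norm a + 1 \<Longrightarrow> norm (D i x b - E i x b) \<le> \<epsilon> * prod_norm i b"
    using approx[of "norm a + 1" \<epsilon>] assms by (auto simp: add_nonneg_pos)
  have "norm x \<le> norm a + 1" if "norm (x - a) \<le> 1" for x
    using norm_triangle_sub[of x a] that by linarith
  then show ?thesis using that E by blast
qed

lemma approx_at_point:
  assumes "i \<le> k" "0 < \<epsilon>"
  obtains E where "smooth_jet E" "\<And>b. norm (D i a b - E i a b) \<le> \<epsilon> * prod_norm i b"
proof -
  obtain E where "smooth_jet E"
    "\<And>i x b. i \<le> k \<Longrightarrow> norm (x - a) \<le> 1 \<Longrightarrow> norm (D i x b - E i x b) \<le> \<epsilon> * prod_norm i b"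
    using approx_at[OF assms(2), of a] by blast
  then show ?thesis using assms(1) by (intro that[of E]) auto
qed

lemma bounded_multilinear_limit:
  assumes i: "i \<le> k"
  shows "bounded_multilinear i (D i a)"
  unfolding bounded_multilinear_def
proof (intro conjI allI impI)
  fix b b' :: "nat \<Rightarrow> 'v" assume eq: "\<forall>j<i. b j = b' j"
  show "D i a b = D i a b'"
  proof (rule eq_of_norm_diff_le_small_multiple)
    fix e :: real assume "0 < e"
    obtain E where E: "smooth_jet E"
      "\<And>b. norm (D i a b - E i a b) \<le> e * prod_norm i b"
      using approx_at_point[OF i \<open>0 < e\<close>, of a] by blast
    have "E i a b = E i a b'" using smooth_jet_cong[OF E(1)] eq by blast
    moreover have "(D i a b - E i a b) - (D i a b' - E i a b') = D i a b - D i a b' - (E i a b - E i a b')"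
      by simp
    ultimately have "norm (D i a b - D i a b') \<le> norm (D i a b - E i a b) + norm (D i a b' - E i a b')"
      by (metis diff_self diff_zero norm_triangle_ineq4)
    then show "norm (D i a b - D i a b') \<le> e * (prod_norm i b + prod_norm i b')"
      using E(2)[of b] E(2)[of b'] by (simp add: distrib_left)
  qed
next
  fix b :: "nat \<Rightarrow> 'v" and j assume j: "j < i"
  let ?p = "\<lambda>v. \<Prod>l<i. norm ((b(j := v)) l)"
  show "linear (\<lambda>v. D i a (b(j := v)))"
  proof (rule linearI)
    fix v w
    show "D i a (b(j := v + w)) = D i a (b(j := v)) + D i a (b(j := w))"
    proof (rule eq_of_norm_diff_le_small_multiple)
      fix e :: real assume "0 < e"
      obtain E where E: "smooth_jet E"
        "\<And>b. norm (D i a b - E i a b) \<le> e * prod_norm i b"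
        using approx_at_point[OF i \<open>0 < e\<close>, of a] by blast
      have "linear (\<lambda>v. E i a (b(j := v)))" using E(1) j by (rule smooth_jet_linear)
      from linear_add[OF this, of v w]
      have eq: "D i a (b(j := v + w)) - (D i a (b(j := v)) + D i a (b(j := w))) =
          (D i a (b(j := v + w)) - E i a (b(j := v + w))) -
          ((D i a (b(j := v)) - E i a (b(j := v))) + (D i a (b(j := w)) - E i a (b(j := w))))"
        by simp
      show "norm (D i a (b(j := v + w)) - (D i a (b(j := v)) + D i a (b(j := w))))
          \<le> e * (?p (v + w) + (?p v + ?p w))"
        unfolding eq distrib_left
        by (intro order.trans[OF norm_triangle_ineq4] add_mono E(2) order.trans[OF norm_triangle_ineq])
    qed
  next
    fix c :: real and v
    show "D i a (b(j := c *\<^sub>R v)) = c *\<^sub>R D i a (b(j := v))"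
    proof (rule eq_of_norm_diff_le_small_multiple)
      fix e :: real assume "0 < e"
      obtain E where E: "smooth_jet E"
        "\<And>b. norm (D i a b - E i a b) \<le> e * prod_norm i b"
        using approx_at_point[OF i \<open>0 < e\<close>, of a] by blast
      have "linear (\<lambda>v. E i a (b(j := v)))" using E(1) j by (rule smooth_jet_linear)
      from linear_scale[OF this, of c v]
      have eq: "D i a (b(j := c *\<^sub>R v)) - c *\<^sub>R D i a (b(j := v)) =
          (D i a (b(j := c *\<^sub>R v)) - E i a (b(j := c *\<^sub>R v))) - c *\<^sub>R (D i a (b(j := v)) - E i a (b(j := v)))"
        by (simp add: scaleR_diff_right)
      have "\<bar>c\<bar> * norm (D i a (b(j := v)) - E i a (b(j := v))) \<le> \<bar>c\<bar> * (e * ?p v)"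
        by (intro mult_left_mono E(2)) simp
      then have "norm (c *\<^sub>R (D i a (b(j := v)) - E i a (b(j := v)))) \<le> e * (\<bar>c\<bar> * ?p v)"
        by (simp only: norm_scaleR mult.left_commute[of e])
      then show "norm (D i a (b(j := c *\<^sub>R v)) - c *\<^sub>R D i a (b(j := v)))
          \<le> e * (?p (c *\<^sub>R v) + \<bar>c\<bar> * ?p v)"
        unfolding eq distrib_left by (intro order.trans[OF norm_triangle_ineq4] add_mono E(2))
    qed
  qed
next
  obtain E where E: "smooth_jet E" "\<And>b. norm (D i a b - E i a b) \<le> 1 * prod_norm i b"
    using approx_at_point[OF i zero_less_one, of a] by blast
  obtain K where K: "\<And>b. norm (E i a b) \<le> K * prod_norm i b"
    using smooth_jet_bound[OF E(1), of "norm a" i] by (metis order.refl)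
  have "norm (D i a b) \<le> (K + 1) * prod_norm i b" for b
    using norm_triangle_sub[of "D i a b" "E i a b"] E(2)[of b] K[of b] by (simp add: distrib_right)
  then show "\<exists>K. \<forall>b. norm (D i a b) \<le> K * prod_norm i b" by blast
qed

lemma continuity_limit:
  assumes i: "i \<le> k" and \<epsilon>: "0 < \<epsilon>"
  shows "\<exists>\<delta>>0. \<delta> \<le> 1 \<and> (\<forall>x. norm (x - a) < \<delta> \<longrightarrow> (\<forall>b. norm (D i x b - D i a b) \<le> \<epsilon> * prod_norm i b))"
proof -
  have "0 < \<epsilon> / 3" using \<epsilon> by simp
  then obtain E where E1: "smooth_jet E"
    and E2: "\<And>j x b. j \<le> k \<Longrightarrow> norm (x - a) \<le> 1 \<Longrightarrow> norm (D j x b - E j x b) \<le> \<epsilon> / 3 * (\<Prod>l<j. norm (b l))"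
    using approx_at[of "\<epsilon> / 3" a] by blast
  note E = E1 E2[OF i]
  obtain K where K: "0 \<le> K"
    "\<And>x b. norm x \<le> norm a + 1 \<Longrightarrow> norm (E (Suc i) x b) \<le> K * (\<Prod>j<Suc i. norm (b j))"
    using smooth_jet_bound[OF E(1), of "norm a + 1" "Suc i"] by blast
  have lip: "norm (E i x b - E i a b) \<le> K * (norm (x - a) * prod_norm i b)"
    if x: "norm (x - a) \<le> 1" for x b
  proof -
    define h where "h = x - a"
    have "norm (E i (a + 1 *\<^sub>R h) b - E i (a + 0 *\<^sub>R h) b - 0) \<le> K * (norm h * prod_norm i b)"
    proof (rule mean_value_inequality_unit_interval)
      fix t :: real
      show "((\<lambda>t. E i (a + t *\<^sub>R h) b) has_vector_derivative E (Suc i) (a + t *\<^sub>R h) (case_nat h b)) (at t)"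
        using E(1) by (rule smooth_jet_deriv)
      assume t: "0 \<le> t" "t \<le> 1"
      have "norm (a + t *\<^sub>R h) \<le> norm a + t * norm h"
        using norm_triangle_ineq[of a "t *\<^sub>R h"] t by simp
      also have "\<dots> \<le> norm a + 1" using t x by (simp add: h_def mult_le_one)
      finally show "norm (E (Suc i) (a + t *\<^sub>R h) (case_nat h b) - 0) \<le> K * (norm h * prod_norm i b)"
        using K(2)[of "a + t *\<^sub>R h" "case_nat h b"] by (simp add: prod.lessThan_Suc_shift del: prod.lessThan_Suc)
    qed
    then show ?thesis by (simp add: h_def)
  qed
  define \<delta> where "\<delta> = min 1 (\<epsilon> / 3 / (K + 1))"
  have \<delta>: "0 < \<delta>" "\<delta> \<le> 1" using \<epsilon> K(1) by (simp_all add: \<delta>_def)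
  have "norm (D i x b - D i a b) \<le> \<epsilon> * prod_norm i b" if x: "norm (x - a) < \<delta>" for x b
  proof -
    let ?P = "\<Prod>j<i. norm (b j)"
    have "0 \<le> ?P" by (simp add: prod_nonneg)
    have "norm (x - a) \<le> \<epsilon> / 3 / (K + 1)" using x by (simp add: \<delta>_def)
    moreover have "0 < K + 1" using K(1) by linarith
    ultimately have "norm (x - a) * (K + 1) \<le> \<epsilon> / 3" by (simp only: pos_le_divide_eq)
    then have "K * norm (x - a) \<le> \<epsilon> / 3"
      using norm_ge_zero[of "x - a"] unfolding distrib_left mult.commute[of K] by linarith
    then have "K * norm (x - a) * ?P \<le> \<epsilon> / 3 * ?P" using \<open>0 \<le> ?P\<close> by (rule mult_right_mono)
    then have "norm (E i x b - E i a b) \<le> \<epsilon> / 3 * ?P" using lip[of x b] x \<delta> by (simp add: mult.assoc)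
    moreover have "D i x b - D i a b = (D i x b - E i x b) + (E i x b - E i a b) - (D i a b - E i a b)" by simp
    then have "norm (D i x b - D i a b) \<le> norm (D i x b - E i x b) + norm (E i x b - E i a b) + norm (D i a b - E i a b)"
      using norm_triangle_ineq4[of "(D i x b - E i x b) + (E i x b - E i a b)" "D i a b - E i a b"]
        norm_triangle_ineq[of "D i x b - E i x b" "E i x b - E i a b"] by simp
    ultimately show ?thesis using E(2)[of x b] E(2)[of a b] x \<delta> by simp
  qed
  then show ?thesis using \<delta> by blast
qed

text \<open>The mean value inequality bounds the remainder of an approximating jet by the oscillation of
  its next derivative, which is close to that of \<open>D (Suc i)\<close>; only the latter survives when the
  approximation improves.\<close>

lemma remainder_limit:
  assumes i: "i < k" and \<epsilon>: "0 < \<epsilon>"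
  shows "\<exists>\<delta>>0. \<forall>h. norm h < \<delta> \<longrightarrow> (\<forall>b. norm (D i (a + h) b - D i a b - D (Suc i) a (case_nat h b))
    \<le> \<epsilon> * norm h * prod_norm i b)"
proof -
  obtain \<delta> where \<delta>: "0 < \<delta>" "\<delta> \<le> 1"
    and cont: "\<And>x b. norm (x - a) < \<delta> \<Longrightarrow>
      norm (D (Suc i) x b - D (Suc i) a b) \<le> \<epsilon> * (\<Prod>j<Suc i. norm (b j))"
    using continuity_limit[of "Suc i" \<epsilon> a] i \<epsilon> by auto
  have "norm (D i (a + h) b - D i a b - D (Suc i) a (case_nat h b)) \<le> \<epsilon> * norm h * prod_norm i b"
    if h: "norm h < \<delta>" for h b
  proof (rule le_of_le_add_small_multiple)
    fix e :: real assume "0 < e"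
    let ?P = "\<Prod>j<i. norm (b j)"
    obtain E where E: "smooth_jet E"
      "\<And>i x b. i \<le> k \<Longrightarrow> norm (x - a) \<le> 1 \<Longrightarrow> norm (D i x b - E i x b) \<le> e * prod_norm i b"
      using approx_at[OF \<open>0 < e\<close>, of a] by blast
    have P: "(\<Prod>j<Suc i. norm (case_nat h b j)) = norm h * ?P"
      by (simp add: prod.lessThan_Suc_shift del: prod.lessThan_Suc)
    have E': "norm (D (Suc i) x (case_nat h b) - E (Suc i) x (case_nat h b)) \<le> e * (norm h * ?P)"
      if "norm (x - a) \<le> 1" for x
      using E(2)[of "Suc i" x "case_nat h b"] i that unfolding P by simp
    have "norm (E i (a + 1 *\<^sub>R h) b - E i (a + 0 *\<^sub>R h) b - E (Suc i) a (case_nat h b))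
        \<le> \<epsilon> * (norm h * ?P) + e * (norm h * ?P) + e * (norm h * ?P)"
    proof (rule mean_value_inequality_unit_interval)
      fix t :: real
      show "((\<lambda>t. E i (a + t *\<^sub>R h) b) has_vector_derivative E (Suc i) (a + t *\<^sub>R h) (case_nat h b)) (at t)"
        using E(1) by (rule smooth_jet_deriv)
      assume t: "0 \<le> t" "t \<le> 1"
      let ?x = "a + t *\<^sub>R h" and ?b = "case_nat h b"
      have x: "norm (?x - a) < \<delta>" using t h mult_left_le_one_le[of "norm h" t] by simp
      have "norm (D (Suc i) ?x ?b - D (Suc i) a ?b) \<le> \<epsilon> * (norm h * ?P)"
        using cont[OF x, of ?b] unfolding P .
      moreover have "norm (D (Suc i) ?x ?b - E (Suc i) ?x ?b) \<le> e * (norm h * ?P)"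
        using E' x \<delta> by simp
      moreover have "norm (D (Suc i) a ?b - E (Suc i) a ?b) \<le> e * (norm h * ?P)"
        using E'[of a] by simp
      moreover have "E (Suc i) ?x ?b - E (Suc i) a ?b = (D (Suc i) ?x ?b - D (Suc i) a ?b) -
          (D (Suc i) ?x ?b - E (Suc i) ?x ?b) + (D (Suc i) a ?b - E (Suc i) a ?b)" by simp
      ultimately show "norm (E (Suc i) ?x ?b - E (Suc i) a ?b)
          \<le> \<epsilon> * (norm h * ?P) + e * (norm h * ?P) + e * (norm h * ?P)"
        by (metis norm_diff_add_le)
    qed
    then have Er: "norm (E i (a + h) b - E i a b - E (Suc i) a (case_nat h b))
        \<le> \<epsilon> * (norm h * ?P) + e * (norm h * ?P) + e * (norm h * ?P)" by simp
    have eq: "D i (a + h) b - D i a b - D (Suc i) a (case_nat h b) =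
        ((E i (a + h) b - E i a b - E (Suc i) a (case_nat h b)) - (D i a b - E i a b) + (D i (a + h) b - E i (a + h) b))
        - (D (Suc i) a (case_nat h b) - E (Suc i) a (case_nat h b))" by simp
    have "norm (D i (a + h) b - D i a b - D (Suc i) a (case_nat h b))
        \<le> (\<epsilon> * (norm h * ?P) + e * (norm h * ?P) + e * (norm h * ?P)) + e * ?P + e * ?P + e * (norm h * ?P)"
      unfolding eq using h \<delta> i
      by (intro order.trans[OF norm_triangle_ineq4 add_mono] norm_diff_add_le Er E(2) E') auto
    then show "norm (D i (a + h) b - D i a b - D (Suc i) a (case_nat h b))
        \<le> \<epsilon> * norm h * ?P + e * (3 * (norm h * ?P) + 2 * ?P)" by (simp add: algebra_simps)
  qed
  then show ?thesis using \<delta> by blast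
qed

theorem frechet_derivatives_limit:
  assumes D0: "\<And>a b. D 0 a b = F a"
  shows "frechet_derivatives k F D"
  unfolding frechet_derivatives_def
proof (intro conjI allI impI)
  fix i and a :: 'v assume i: "i < k"
  show "((\<lambda>h. multilinear_norm i (\<lambda>b. D i (a + h) b - D i a b - D (Suc i) a (case_nat h b)) / norm h) \<longlongrightarrow> 0) (at 0)"
  proof (rule LIM_I)
    fix e :: real assume e: "0 < e"
    then obtain \<delta> where \<delta>: "0 < \<delta>"
      and rem: "\<And>h b. norm h < \<delta> \<Longrightarrow> norm (D i (a + h) b - D i a b - D (Suc i) a (case_nat h b))
        \<le> e / 2 * norm h * prod_norm i b"
      using remainder_limit[OF i, of "e / 2" a] by auto
    show "\<exists>s>0. \<forall>h. h \<noteq> 0 \<and> norm (h - 0) < s \<longrightarrow>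
        norm (multilinear_norm i (\<lambda>b. D i (a + h) b - D i a b - D (Suc i) a (case_nat h b)) / norm h - 0) < e"
    proof (intro exI[of _ \<delta>] conjI allI impI \<delta>)
      fix h :: 'v assume h: "h \<noteq> 0 \<and> norm (h - 0) < \<delta>"
      define N where "N = multilinear_norm i (\<lambda>b. D i (a + h) b - D i a b - D (Suc i) a (case_nat h b))"
      have hd: "norm h < \<delta>" and nonneg: "0 \<le> e / 2 * norm h" using h e by simp_all
      have "0 \<le> N" "N \<le> e / 2 * norm h"
        unfolding N_def using multilinear_norm_bounds[OF nonneg rem[OF hd]] .
      moreover have "e / 2 * norm h < e * norm h" using h e by simp
      ultimately have "0 \<le> N" "N < e * norm h" by linarith+
      then show "norm (N / norm h - 0) < e" using h by (simp add: pos_divide_less_eq)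
    qed
  qed
qed (simp_all add: D0 bounded_multilinear_limit)

theorem Ck_frechet_limit:
  assumes D0: "\<And>a b. D 0 a b = F a"
  shows "Ck_frechet k F"
  unfolding Ck_frechet_def
proof (intro exI[of _ D] conjI frechet_derivatives_limit D0 allI impI)
  fix i and a :: 'v assume i: "i \<le> k"
  show "((\<lambda>x. multilinear_norm i (\<lambda>b. D i x b - D i a b)) \<longlongrightarrow> 0) (at a)"
  proof (rule LIM_I)
    fix e :: real assume e: "0 < e"
    then obtain \<delta> where \<delta>: "0 < \<delta>"
      and cont: "\<And>x b. norm (x - a) < \<delta> \<Longrightarrow> norm (D i x b - D i a b) \<le> e / 2 * prod_norm i b"
      using continuity_limit[OF i, of "e / 2" a] by auto
    show "\<exists>s>0. \<forall>x. x \<noteq> a \<and> norm (x - a) < s \<longrightarrow> norm (multilinear_norm i (\<lambda>b. D i x b - D i a b) - 0) < e"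
    proof (intro exI[of _ \<delta>] conjI allI impI \<delta>)
      fix x :: 'v assume x: "x \<noteq> a \<and> norm (x - a) < \<delta>"
      have xd: "norm (x - a) < \<delta>" and nonneg: "0 \<le> e / 2" using x e by simp_all
      have "0 \<le> multilinear_norm i (\<lambda>b. D i x b - D i a b)" "multilinear_norm i (\<lambda>b. D i x b - D i a b) \<le> e / 2"
        using multilinear_norm_bounds[OF nonneg cont[OF xd]] .
      then show "norm (multilinear_norm i (\<lambda>b. D i x b - D i a b) - 0) < e" using e by simp
    qed
  qed
qed

lemma dir_deriv_limit:
  assumes i: "i < k"
  shows "dir_deriv h (\<lambda>a. D i a b) a = D (Suc i) a (case_nat h b)"
  unfolding dir_deriv_def
proof (rule vector_derivative_at)
  define v where "v = D (Suc i) a (case_nat h b)"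
  have hom: "D (Suc i) a (case_nat (t *\<^sub>R h) b) = t *\<^sub>R v" for t
  proof -
    have "linear (\<lambda>w. D (Suc i) a ((case_nat h b)(0 := w)))"
      using bounded_multilinear_limit[of "Suc i" a] i by (simp add: bounded_multilinear_def)
    moreover have "(case_nat h b)(0 := w) = case_nat w b" for w by (auto split: nat.split)
    ultimately have "linear (\<lambda>w. D (Suc i) a (case_nat w b))" by simp
    from linear_scale[OF this, of t h] show ?thesis by (simp add: v_def)
  qed
  show "((\<lambda>t. D i (a + t *\<^sub>R h) b) has_vector_derivative v) (at 0)"
    unfolding has_vector_derivative_def has_derivative_at_alt
  proof (intro conjI allI impI)
    show "bounded_linear (\<lambda>t. t *\<^sub>R v)" by (rule bounded_linear_scaleR_left)
    fix e :: real assume e: "0 < e"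
    define B where "B = norm h * prod_norm i b + 1"
    have B: "0 < B" by (simp add: B_def add_nonneg_pos prod_nonneg)
    obtain \<delta> where \<delta>: "0 < \<delta>"
      and rem: "\<And>h b. norm h < \<delta> \<Longrightarrow> norm (D i (a + h) b - D i a b - D (Suc i) a (case_nat h b))
        \<le> e / B * norm h * prod_norm i b"
      using remainder_limit[OF i, of "e / B" a] e B by auto
    show "\<exists>d>0. \<forall>t. norm (t - 0) < d \<longrightarrow>
        norm (D i (a + t *\<^sub>R h) b - D i (a + 0 *\<^sub>R h) b - (t - 0) *\<^sub>R v) \<le> e * norm (t - 0)"
    proof (intro exI[of _ "\<delta> / (norm h + 1)"] conjI allI impI)
      show "0 < \<delta> / (norm h + 1)" using \<delta> by (simp add: add_nonneg_pos)
      fix t :: real assume "norm (t - 0) < \<delta> / (norm h + 1)"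
      then have "\<bar>t\<bar> * (norm h + 1) < \<delta>" by (simp add: pos_less_divide_eq add_nonneg_pos)
      then have "norm (t *\<^sub>R h) < \<delta>" by (simp add: distrib_left)
      from rem[OF this, of b]
      have "norm (D i (a + t *\<^sub>R h) b - D i a b - t *\<^sub>R v) \<le> e / B * (\<bar>t\<bar> * (B - 1))"
        by (simp add: hom B_def mult.assoc)
      also have "\<dots> \<le> e / B * (\<bar>t\<bar> * B)" using e B by (intro mult_left_mono) auto
      finally show "norm (D i (a + t *\<^sub>R h) b - D i (a + 0 *\<^sub>R h) b - (t - 0) *\<^sub>R v) \<le> e * norm (t - 0)"
        using B by simp
    qed
  qed
qed

text \<open>The directions come in reverse order because the newest one is the first argument of \<open>D\<close>.\<close>

theorem iter_dir_deriv_limit: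
  assumes D0: "\<And>a b. D 0 a b = F a"
  shows "i \<le> k \<Longrightarrow> iter_dir_deriv i b F = (\<lambda>a. D i a (\<lambda>j. b (i - Suc j)))"
proof (induction i)
  case 0
  then show ?case by (simp add: iter_dir_deriv_def D0)
next
  case (Suc i)
  have "iter_dir_deriv (Suc i) b F = dir_deriv (b i) (iter_dir_deriv i b F)"
    by (simp add: iter_dir_deriv_def)
  also have "\<dots> = (\<lambda>a. D (Suc i) a (case_nat (b i) (\<lambda>j. b (i - Suc j))))"
    using Suc by (auto simp: dir_deriv_limit)
  also have "case_nat (b i) (\<lambda>j. b (i - Suc j)) = (\<lambda>j. b (Suc i - Suc j))"
    by (auto split: nat.split)
  finally show ?case .
qed

end

section \<open>Tensor evaluation of polynomials in several variables\<close>

lemma sum_keys_add: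
  fixes F :: "'d \<Rightarrow> complex \<Rightarrow> 'v :: ab_group_add"
  assumes add: "\<And>\<delta> c d. F \<delta> (c + d) = F \<delta> c + F \<delta> d"
  shows "(\<Sum>\<delta>\<in>Poly_Mapping.keys (P + Q). F \<delta> (Poly_Mapping.lookup (P + Q) \<delta>)) =
    (\<Sum>\<delta>\<in>Poly_Mapping.keys P. F \<delta> (Poly_Mapping.lookup P \<delta>)) +
    (\<Sum>\<delta>\<in>Poly_Mapping.keys Q. F \<delta> (Poly_Mapping.lookup Q \<delta>))"
proof -
  have zero: "F \<delta> 0 = 0" for \<delta> using add[of \<delta> 0 0] by simp
  define A where "A = Poly_Mapping.keys P \<union> Poly_Mapping.keys Q"
  have super: "(\<Sum>\<delta>\<in>Poly_Mapping.keys R. F \<delta> (Poly_Mapping.lookup R \<delta>)) =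
      (\<Sum>\<delta>\<in>A. F \<delta> (Poly_Mapping.lookup R \<delta>))" if "Poly_Mapping.keys R \<subseteq> A" for R
    using that by (intro sum.mono_neutral_left) (auto simp: A_def in_keys_iff zero)
  have "Poly_Mapping.keys (P + Q) \<subseteq> A" "Poly_Mapping.keys P \<subseteq> A" "Poly_Mapping.keys Q \<subseteq> A"
    using keys_add[of P Q] by (auto simp: A_def)
  then show ?thesis by (simp only: super) (simp add: lookup_add add sum.distrib)
qed

definition mpoly_smult :: "complex \<Rightarrow> ((nat \<Rightarrow>\<^sub>0 nat) \<Rightarrow>\<^sub>0 complex) \<Rightarrow> ((nat \<Rightarrow>\<^sub>0 nat) \<Rightarrow>\<^sub>0 complex)"
  where "mpoly_smult c P = Poly_Mapping.map ((*) c) P"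

lemma lookup_mpoly_smult [simp]: "Poly_Mapping.lookup (mpoly_smult c P) \<delta> = c * Poly_Mapping.lookup P \<delta>"
  by (simp add: mpoly_smult_def map.rep_eq when_def)

lemma sum_keys_smult:
  assumes "\<And>\<delta>. F \<delta> 0 = 0"
  shows "(\<Sum>\<delta>\<in>Poly_Mapping.keys (mpoly_smult c P). F \<delta> (Poly_Mapping.lookup (mpoly_smult c P) \<delta>)) =
    (\<Sum>\<delta>\<in>Poly_Mapping.keys P. F \<delta> (c * Poly_Mapping.lookup P \<delta>))"
proof -
  have "(\<Sum>\<delta>\<in>Poly_Mapping.keys (mpoly_smult c P). F \<delta> (Poly_Mapping.lookup (mpoly_smult c P) \<delta>)) =
      (\<Sum>\<delta>\<in>Poly_Mapping.keys P. F \<delta> (Poly_Mapping.lookup (mpoly_smult c P) \<delta>))"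
    by (rule sum.mono_neutral_left) (auto simp: in_keys_iff assms)
  then show ?thesis by simp
qed

lemma zero_in_mpolys [simp]: "0 \<in> mpolys m"
  by (simp add: mpolys_def)

lemma mpolys_add: "P \<in> mpolys m \<Longrightarrow> Q \<in> mpolys m \<Longrightarrow> P + Q \<in> mpolys m"
  using keys_add[of P Q] unfolding mpolys_def by blast

lemma mpolys_smult: "P \<in> mpolys m \<Longrightarrow> mpoly_smult c P \<in> mpolys m"
  by (auto simp: mpolys_def in_keys_iff)

lemma mpoly_fun_add:
  "mpoly_fun m (P + Q) = (\<lambda>s\<in>rspace m. mpoly_fun m P s + mpoly_fun m Q s)"
  unfolding mpoly_fun_def
  by (rule restrict_ext) (simp add: distrib_right
      sum_keys_add[where F = "\<lambda>\<delta> c. c * (\<Prod>i<m. complex_of_real (_ i) ^ Poly_Mapping.lookup \<delta> i)"])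

lemma mpoly_fun_smult:
  "mpoly_fun m (mpoly_smult c P) = (\<lambda>s\<in>rspace m. c * mpoly_fun m P s)"
  unfolding mpoly_fun_def
  by (rule restrict_ext) (simp only: restrict_apply' sum_distrib_left mult.assoc mult_zero_left
      sum_keys_smult[where F = "\<lambda>\<delta> c. c * (\<Prod>i<m. complex_of_real (_ i) ^ Poly_Mapping.lookup \<delta> i)"])

lemma mpoly_tensor_add:
  "mpoly_tensor m (P + Q) a b = mpoly_tensor m P a b + mpoly_tensor m Q a b"
  unfolding mpoly_tensor_def by (rule sum_keys_add) (rule scaleC_add_left)

lemma mpoly_tensor_smult:
  "mpoly_tensor m (mpoly_smult c P) a b = c *\<^sub>C mpoly_tensor m P a b"
  unfolding mpoly_tensor_def
  by (simp only: scaleC_sum_right scaleC_scaleC scaleC_zero_left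
      sum_keys_smult[where F = "\<lambda>\<delta> c. c *\<^sub>C (prod_list (map (\<lambda>i. a i ^ Poly_Mapping.lookup \<delta> i * b i) [0..<m - 1]) *
        a (m - 1) ^ Poly_Mapping.lookup \<delta> (m - 1))"])

lemma mpoly_fun_0: "mpoly_fun m 0 = (\<lambda>s\<in>rspace m. 0)"
  by (simp add: mpoly_fun_def)

lemma mpoly_tensor_0: "mpoly_tensor m 0 a b = 0"
  by (simp add: mpoly_tensor_def)

section \<open>Sums of words and divided differences of polynomials\<close>

text \<open>The sum of all words with \<open>n\<close> letters that arise from the list \<open>bs\<close>, in its order, by
  inserting copies of \<open>a\<close>.\<close>

fun word_sum :: "nat \<Rightarrow> 'a :: cstar_algebra \<Rightarrow> 'a list \<Rightarrow> 'a" where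
  "word_sum n a [] = a ^ n"
| "word_sum 0 a (b # bs) = 0"
| "word_sum (Suc n) a (b # bs) = a * word_sum n a (b # bs) + b * word_sum n a bs"

text \<open>The exponents of the complete homogeneous symmetric polynomial of degree \<open>n - i\<close> in \<open>i + 1\<close>
  variables, in the order that the recursion of \<open>word_sum\<close> dictates.\<close>

fun exponent_lists :: "nat \<Rightarrow> nat \<Rightarrow> nat list list" where
  "exponent_lists n 0 = [[n]]"
| "exponent_lists 0 (Suc i) = []"
| "exponent_lists (Suc n) (Suc i) =
    map (\<lambda>ds. Suc (hd ds) # tl ds) (exponent_lists n (Suc i)) @ map ((#) 0) (exponent_lists n i)"

lemma length_exponent_lists: "ds \<in> set (exponent_lists n i) \<Longrightarrow> length ds = Suc i"
  by (induction n i arbitrary: ds rule: exponent_lists.induct) force+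

lemma exponent_lists_cases:
  "ds \<in> set (exponent_lists n i) \<Longrightarrow> \<exists>d es. ds = d # es"
  using length_exponent_lists[of ds n i] by (cases ds) auto

definition word :: "nat list \<Rightarrow> nat \<Rightarrow> 'a :: cstar_algebra \<Rightarrow> (nat \<Rightarrow> 'a) \<Rightarrow> 'a"
  where "word ds i a b = prod_list (map (\<lambda>j. a ^ (ds ! j) * b j) [0..<i]) * a ^ (ds ! i)"

lemma word_Cons: "word (d # ds) (Suc i) a b = a ^ d * b 0 * word ds i a (\<lambda>j. b (Suc j))"
proof -
  have "[0..<Suc i] = 0 # map Suc [0..<i]" by (simp add: upt_conv_Cons map_Suc_upt del: upt_Suc)
  then show ?thesis by (simp add: word_def o_def mult.assoc del: upt_Suc)
qed

lemma word_increment: "word (Suc d # ds) i a b = a * word (d # ds) i a b"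
  by (cases i) (simp_all add: word_Cons mult.assoc, simp add: word_def)

lemma sum_list_cong_set: "(\<And>x. x \<in> set xs \<Longrightarrow> f x = g x) \<Longrightarrow> sum_list (map f xs) = sum_list (map g xs)"
  by (metis map_eq_conv)

lemma word_sum_eq_sum_words:
  "word_sum n a (map b [0..<i]) = sum_list (map (\<lambda>ds. word ds i a b) (exponent_lists n i))"
proof (induction n i arbitrary: b rule: exponent_lists.induct)
  case (3 n i)
  have upt: "map b [0..<Suc i] = b 0 # map (\<lambda>j. b (Suc j)) [0..<i]"
    by (simp add: upt_conv_Cons map_Suc_upt[symmetric] o_def del: upt_Suc)
  have "sum_list (map (\<lambda>ds. word (Suc (hd ds) # tl ds) (Suc i) a b) (exponent_lists n (Suc i))) =
      sum_list (map (\<lambda>ds. a * word ds (Suc i) a b) (exponent_lists n (Suc i)))"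
    by (rule sum_list_cong_set) (use exponent_lists_cases word_increment in fastforce)
  then show ?case using "3.IH"(1)[of b] "3.IH"(2)[of "\<lambda>j. b (Suc j)"]
    unfolding upt by (simp add: o_def word_Cons sum_list_const_mult)
qed (simp_all add: word_def upt_conv_Cons del: upt_Suc)

lemma dd_const: "dd (\<lambda>_. c) (Suc i) s = 0"
proof (induction i arbitrary: s)
  case (Suc i)
  show ?case by (subst dd.simps(2)) (simp add: Suc del: dd.simps)
qed simp

lemma dd_power:
  "inj_on s {..i} \<Longrightarrow> dd (\<lambda>x. complex_of_real x ^ n) i s =
    sum_list (map (\<lambda>ds. \<Prod>j<Suc i. complex_of_real (s j) ^ (ds ! j)) (exponent_lists n i))"
proof (induction n i arbitrary: s rule: exponent_lists.induct)
  case (2 i)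
  then show ?case using dd_const[of 1 i s] by (simp del: dd.simps)
next
  case (3 n i)
  have "inj_on (\<lambda>j. s (Suc j)) {..i}" using "3.prems" by (auto simp: inj_on_def)
  note IH = "3.IH"(1)[OF "3.prems"] "3.IH"(2)[OF this]
  have "dd (\<lambda>x. complex_of_real x ^ Suc n) (Suc i) s =
      complex_of_real (s 0) * dd (\<lambda>x. complex_of_real x ^ n) (Suc i) s +
      dd (\<lambda>x. complex_of_real x ^ n) i (\<lambda>j. s (Suc j))"
    unfolding power_Suc by (rule dd_mult_id[OF "3.prems"])
  moreover have "sum_list (map (\<lambda>ds. \<Prod>j<Suc (Suc i). complex_of_real (s j) ^ ((Suc (hd ds) # tl ds) ! j)) (exponent_lists n (Suc i))) =
      sum_list (map (\<lambda>ds. complex_of_real (s 0) * (\<Prod>j<Suc (Suc i). complex_of_real (s j) ^ (ds ! j))) (exponent_lists n (Suc i)))"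
  proof (rule sum_list_cong_set)
    fix ds assume "ds \<in> set (exponent_lists n (Suc i))"
    then obtain d es where "ds = d # es" using exponent_lists_cases by blast
    then show "(\<Prod>j<Suc (Suc i). complex_of_real (s j) ^ ((Suc (hd ds) # tl ds) ! j)) =
        complex_of_real (s 0) * (\<Prod>j<Suc (Suc i). complex_of_real (s j) ^ (ds ! j))"
      by (simp add: prod.lessThan_Suc_shift mult.assoc del: prod.lessThan_Suc)
  qed
  moreover have "(\<Prod>j<Suc (Suc i). complex_of_real (s j) ^ ((0 # ds) ! j)) =
      (\<Prod>j<Suc i. complex_of_real (s (Suc j)) ^ (ds ! j))" for ds
    by (simp add: prod.lessThan_Suc_shift[of _ "Suc i"] del: prod.lessThan_Suc)
  ultimately show ?case using IH
    by (simp add: o_def sum_list_const_mult del: prod.lessThan_Suc dd.simps)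
qed (simp add: power_0)

definition poly_word_sum :: "complex poly \<Rightarrow> 'a :: cstar_algebra \<Rightarrow> 'a list \<Rightarrow> 'a"
  where "poly_word_sum p a bs = (\<Sum>n\<le>degree p. coeff p n *\<^sub>C word_sum n a bs)"

lemma poly_word_sum_Nil: "poly_word_sum p a [] = alg_eval p a"
  by (simp add: poly_word_sum_def alg_eval_def)

definition mpoly_of_exponents :: "complex \<Rightarrow> nat list list \<Rightarrow> ((nat \<Rightarrow>\<^sub>0 nat) \<Rightarrow>\<^sub>0 complex)"
  where "mpoly_of_exponents c L = sum_list (map (\<lambda>ds. Poly_Mapping.single (Poly_Mapping.nth ds) c) L)"

lemma monomial_in_mpolys:
  assumes "length ds = Suc i"
  shows "Poly_Mapping.single (Poly_Mapping.nth ds) c \<in> mpolys (Suc i)"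
proof -
  have "k \<le> i" if "k \<in> Poly_Mapping.keys (Poly_Mapping.nth ds)" for k
    using that assms unfolding in_keys_iff lookup_nth by (auto simp: nth_default_def split: if_splits)
  then show ?thesis by (auto simp: mpolys_def less_Suc_eq_le simp del: keys_nth)
qed

lemma mpoly_fun_monomial:
  assumes "length ds = Suc i"
  shows "mpoly_fun (Suc i) (Poly_Mapping.single (Poly_Mapping.nth ds) c) =
    (\<lambda>s\<in>rspace (Suc i). c * (\<Prod>j<Suc i. complex_of_real (s j) ^ (ds ! j)))"
  unfolding mpoly_fun_def by (rule restrict_ext) (simp add: nth_default_def assms)

lemma mpoly_tensor_monomial:
  assumes "length ds = Suc i"
  shows "mpoly_tensor (Suc i) (Poly_Mapping.single (Poly_Mapping.nth ds) c) (\<lambda>_. a) b = c *\<^sub>C word ds i a b"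
proof -
  have "map (\<lambda>j. a ^ nth_default 0 ds j * b j) [0..<i] = map (\<lambda>j. a ^ (ds ! j) * b j) [0..<i]"
    by (rule map_cong) (auto simp: nth_default_def assms)
  from arg_cong[OF this, of prod_list] show ?thesis
    by (simp add: mpoly_tensor_def word_def) (simp add: nth_default_def assms)
qed

lemma
  assumes "\<And>ds. ds \<in> set L \<Longrightarrow> length ds = Suc i"
  shows mpoly_of_exponents_in_mpolys: "mpoly_of_exponents c L \<in> mpolys (Suc i)"
    and mpoly_fun_of_exponents: "mpoly_fun (Suc i) (mpoly_of_exponents c L) =
      (\<lambda>s\<in>rspace (Suc i). c * sum_list (map (\<lambda>ds. \<Prod>j<Suc i. complex_of_real (s j) ^ (ds ! j)) L))"
  using assms
  by (induction L)
    (auto simp: mpoly_of_exponents_def mpoly_fun_0 mpoly_fun_add mpoly_fun_monomial distrib_left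
      intro!: mpolys_add monomial_in_mpolys restrict_ext simp del: prod.lessThan_Suc)

lemma mpoly_tensor_of_exponents:
  assumes "\<And>ds. ds \<in> set L \<Longrightarrow> length ds = Suc i"
  shows "mpoly_tensor (Suc i) (mpoly_of_exponents c L) (\<lambda>_. a) b = c *\<^sub>C sum_list (map (\<lambda>ds. word ds i a b) L)"
  using assms
  by (induction L)
    (auto simp: mpoly_of_exponents_def mpoly_tensor_0 mpoly_tensor_add mpoly_tensor_monomial scaleC_add_right)

text \<open>The divided difference \<open>p\<^bsup>[i]\<^esup>\<close> of a polynomial \<open>p\<close> is a polynomial whose tensor evaluation
  at \<open>(a, \<dots>, a)\<close> interlaces the powers of \<open>a\<close> with the \<open>b j\<close>.\<close>

definition divided_difference_mpoly :: "complex poly \<Rightarrow> nat \<Rightarrow> ((nat \<Rightarrow>\<^sub>0 nat) \<Rightarrow>\<^sub>0 complex)"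
  where "divided_difference_mpoly p i =
    (\<Sum>n\<le>degree p. mpoly_of_exponents (coeff p n) (exponent_lists n i))"

lemma mpolys_sum: "(\<And>n. n \<in> A \<Longrightarrow> P n \<in> mpolys m) \<Longrightarrow> sum P A \<in> mpolys m"
  by (induction A rule: infinite_finite_induct) (auto intro: mpolys_add)

lemma mpoly_fun_sum: "mpoly_fun m (sum P A) = (\<lambda>s\<in>rspace m. \<Sum>n\<in>A. mpoly_fun m (P n) s)"
  by (induction A rule: infinite_finite_induct)
    (auto simp: mpoly_fun_0 mpoly_fun_add intro!: restrict_ext)

lemma mpoly_tensor_sum: "mpoly_tensor m (sum P A) a b = (\<Sum>n\<in>A. mpoly_tensor m (P n) a b)"
  by (induction A rule: infinite_finite_induct) (auto simp: mpoly_tensor_0 mpoly_tensor_add)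

lemma divided_difference_mpoly_in_mpolys: "divided_difference_mpoly p i \<in> mpolys (Suc i)"
  unfolding divided_difference_mpoly_def
  by (intro mpolys_sum mpoly_of_exponents_in_mpolys length_exponent_lists)

lemma mpoly_fun_divided_difference_mpoly:
  "mpoly_fun (Suc i) (divided_difference_mpoly p i) = divided_difference (\<lambda>x. poly p (complex_of_real x)) i"
proof (rule divided_difference_eqI[symmetric])
  let ?h = "\<lambda>n s. sum_list (map (\<lambda>ds. \<Prod>j<Suc i. complex_of_real (s j) ^ (ds ! j)) (exponent_lists n i))"
  have eq: "mpoly_fun (Suc i) (divided_difference_mpoly p i) =
      (\<lambda>s\<in>rspace (Suc i). \<Sum>n\<le>degree p. coeff p n * ?h n s)"
    unfolding divided_difference_mpoly_def mpoly_fun_sum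
    by (rule restrict_ext) (simp add: mpoly_fun_of_exponents[OF length_exponent_lists] del: prod.lessThan_Suc)
  have "continuous_on (rspace (Suc i)) (\<lambda>s. sum_list (map (\<lambda>ds. \<Prod>j<Suc i. complex_of_real (s j) ^ (ds ! j)) L))" for L
    by (induction L) (auto intro!: continuous_intros
        continuous_on_subset[OF continuous_on_product_coordinates] simp del: prod.lessThan_Suc)
  then show "mpoly_fun (Suc i) (divided_difference_mpoly p i) \<in> Cfun (rspace (Suc i))"
    unfolding eq by (intro Cfun_restrictI continuous_intros)
  fix s assume s: "s \<in> rspace (Suc i)" "inj_on s {..i}"
  have "dd (\<lambda>x. poly p (complex_of_real x)) i s =
      dd (\<lambda>x. \<Sum>n\<le>degree p. coeff p n * complex_of_real x ^ n) i s"
    by (simp add: poly_altdef)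
  also have "\<dots> = (\<Sum>n\<le>degree p. coeff p n * dd (\<lambda>x. complex_of_real x ^ n) i s)"
    by (rule dd_linear_combination)
  finally show "mpoly_fun (Suc i) (divided_difference_mpoly p i) s = dd (\<lambda>x. poly p (complex_of_real x)) i s"
    using s by (simp add: eq dd_power del: prod.lessThan_Suc)
qed

lemma mpoly_tensor_divided_difference_mpoly:
  "mpoly_tensor (Suc i) (divided_difference_mpoly p i) (\<lambda>_. a) b = poly_word_sum p a (map b [0..<i])"
  unfolding divided_difference_mpoly_def mpoly_tensor_sum poly_word_sum_def
  by (intro sum.cong refl)
    (simp only: mpoly_tensor_of_exponents[OF length_exponent_lists] word_sum_eq_sum_words)

section \<open>Derivatives of polynomials on a C*-algebra\<close>

text \<open>By the product rule, the derivative in direction \<open>h\<close> is the sum of all words in which one copy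
  of \<open>a\<close> is replaced by \<open>h\<close>. They are grouped by the position that \<open>h\<close> takes among the \<open>bs\<close>.\<close>

lemma word_sum_has_vector_derivative:
  "((\<lambda>t. word_sum n (a + t *\<^sub>R h) bs) has_vector_derivative
    (\<Sum>j\<le>length bs. word_sum n (a + t *\<^sub>R h) (take j bs @ h # drop j bs))) (at t)"
proof (induction n "a + t *\<^sub>R h" bs rule: word_sum.induct)
  case (1 n)
  have line: "((\<lambda>t. a + t *\<^sub>R h) has_vector_derivative h) (at t)"
    by (auto intro!: derivative_eq_intros)
  have "((\<lambda>t. (a + t *\<^sub>R h) ^ n) has_vector_derivative word_sum n (a + t *\<^sub>R h) [h]) (at t)"
    by (induction n) (auto intro!: derivative_eq_intros has_vector_derivative_mult[THEN has_vector_derivative_eq_rhs] line)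
  then show ?case by simp
next
  case (2 b bs)
  then show ?case by (simp add: sum.atMost_Suc_shift del: sum.atMost_Suc)
next
  case (3 n b bs)
  have line: "((\<lambda>t. a + t *\<^sub>R h) has_vector_derivative h) (at t)"
    by (auto intro!: derivative_eq_intros)
  let ?W = "\<lambda>cs. word_sum n (a + t *\<^sub>R h) cs"
  have "((\<lambda>t. (a + t *\<^sub>R h) * word_sum n (a + t *\<^sub>R h) (b # bs) + b * word_sum n (a + t *\<^sub>R h) bs) has_vector_derivative
      (((a + t *\<^sub>R h) * (\<Sum>j\<le>length (b # bs). ?W (take j (b # bs) @ h # drop j (b # bs))) + h * ?W (b # bs)) +
       b * (\<Sum>j\<le>length bs. ?W (take j bs @ h # drop j bs)))) (at t)"
    by (intro has_vector_derivative_add has_vector_derivative_mult has_vector_derivative_mult_right line 3)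
  then show ?case
    unfolding word_sum.simps(3)
    by (rule has_vector_derivative_eq_rhs)
      (simp add: sum.atMost_Suc_shift sum_distrib_left sum.distrib algebra_simps del: sum.atMost_Suc)
qed

lemma insert_0_permutations_bij:
  "bij_betw (\<lambda>(xs, j). take j (map Suc xs) @ 0 # drop j (map Suc xs))
    (permutations_of_set {..<i} \<times> {..i}) (permutations_of_set {..<Suc i})"
proof -
  let ?F = "\<lambda>(xs, j). take j (map Suc xs) @ 0 # drop j (map Suc xs)"
  let ?A = "permutations_of_set {..<i} \<times> {..i}"
  have inj: "inj_on ?F ?A"
  proof (rule inj_onI, clarify)
    fix xs ys j l
    assume A: "xs \<in> permutations_of_set {..<i}" "ys \<in> permutations_of_set {..<i}" "j \<le> i" "l \<le> i"
      and eq: "take j (map Suc xs) @ 0 # drop j (map Suc xs) = take l (map Suc ys) @ 0 # drop l (map Suc ys)"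
    have len: "length xs = i" "length ys = i"
      using A length_finite_permutations_of_set by fastforce+
    have "takeWhile (\<lambda>x. x \<noteq> 0) (take n (map Suc zs) @ 0 # drop n (map Suc zs)) = take n (map Suc zs)" for n zs
      by (subst takeWhile_append2) (auto dest: in_set_takeD)
    then have t: "take j (map Suc xs) = take l (map Suc ys)" using eq by metis
    then have "length (take j (map Suc xs)) = length (take l (map Suc ys))" by simp
    then have "j = l" using A len by simp
    moreover have "drop j (map Suc xs) = drop l (map Suc ys)" using eq t by simp
    then have "map Suc xs = map Suc ys" using t by (metis append_take_drop_id)
    then have "xs = ys" by (simp add: inj_map_eq_map)
    ultimately show "xs = ys \<and> j = l" by simp
  qed
  have sub: "?F ` ?A \<subseteq> permutations_of_set {..<Suc i}"
  proof (rule image_subsetI, clarify)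
    fix xs j assume "xs \<in> permutations_of_set {..<i}"
    then have xs: "set xs = {..<i}" "distinct xs" by (auto simp: permutations_of_set_def)
    have "set (take j (map Suc xs)) \<union> set (drop j (map Suc xs)) = Suc ` {..<i}"
      by (metis append_take_drop_id list.set_map set_append xs(1))
    then have "set (take j (map Suc xs) @ 0 # drop j (map Suc xs)) = {..<Suc i}"
      by (auto simp: lessThan_Suc_eq_insert_0)
    moreover have "distinct (map Suc xs)" using xs(2) by (simp add: distinct_map)
    then have "distinct (take j (map Suc xs) @ 0 # drop j (map Suc xs))"
      using set_take_disj_set_drop_if_distinct[of "map Suc xs" j j]
      by (auto dest: in_set_takeD in_set_dropD)
    ultimately show "take j (map Suc xs) @ 0 # drop j (map Suc xs) \<in> permutations_of_set {..<Suc i}"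
      by (rule permutations_of_setI)
  qed
  have "card (?F ` ?A) = card (permutations_of_set {..<Suc i})"
    by (simp add: card_image[OF inj] card_cartesian_product mult.commute)
  then have "?F ` ?A = permutations_of_set {..<Suc i}"
    using sub by (intro card_subset_eq) auto
  then show ?thesis using inj by (simp add: bij_betw_def)
qed

lemma sum_permutes_eq_sum_lists:
  "(\<Sum>\<pi> | \<pi> permutes {..<i}. G (map \<pi> [0..<i])) = (\<Sum>xs\<in>permutations_of_set {..<i}. G xs)"
proof -
  let ?P = "{\<pi>. \<pi> permutes {..<i}}" and ?F = "\<lambda>\<pi> :: nat \<Rightarrow> nat. map \<pi> [0..<i]"
  have inj: "inj_on ?F ?P"
  proof (rule inj_onI, clarify)
    fix \<pi> \<sigma> :: "nat \<Rightarrow> nat" assume P: "\<pi> permutes {..<i}" "\<sigma> permutes {..<i}" and eq: "?F \<pi> = ?F \<sigma>"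
    show "\<pi> = \<sigma>"
    proof
      fix x show "\<pi> x = \<sigma> x"
        using eq permutes_not_in[OF P(1), of x] permutes_not_in[OF P(2), of x] by (cases "x < i") auto
    qed
  qed
  have "?F ` ?P \<subseteq> permutations_of_set {..<i}"
  proof (rule image_subsetI, clarify)
    fix \<pi> assume P: "\<pi> permutes {..<i}"
    have "set (map \<pi> [0..<i]) = {..<i}" using permutes_image[OF P] by (simp add: atLeast0LessThan)
    moreover have "distinct (map \<pi> [0..<i])"
      using permutes_inj_on[OF P] by (simp add: distinct_map)
    ultimately show "map \<pi> [0..<i] \<in> permutations_of_set {..<i}" by (rule permutations_of_setI)
  qed
  moreover have "card (?F ` ?P) = card (permutations_of_set {..<i})"
    by (simp add: card_image[OF inj] card_permutations)
  ultimately have "?F ` ?P = permutations_of_set {..<i}" by (intro card_subset_eq) auto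
  then have "(\<Sum>xs\<in>permutations_of_set {..<i}. G xs) = (\<Sum>xs\<in>?F ` ?P. G xs)" by simp
  also have "\<dots> = (\<Sum>\<pi>\<in>?P. G (?F \<pi>))" by (rule sum.reindex_cong[OF inj]) auto
  finally show ?thesis by simp
qed

text \<open>A permutation of \<open>0, \<dots>, i\<close>, written as a list, arises in exactly one way by inserting 0
  into a permutation of \<open>1, \<dots>, i\<close>.\<close>

lemma sum_permutes_Suc:
  "(\<Sum>\<pi> | \<pi> permutes {..<Suc i}. G (map (\<lambda>j. case_nat h c (\<pi> j)) [0..<Suc i])) =
    (\<Sum>\<pi> | \<pi> permutes {..<i}. \<Sum>j\<le>i. G (take j (map (\<lambda>l. c (\<pi> l)) [0..<i]) @ h # drop j (map (\<lambda>l. c (\<pi> l)) [0..<i])))"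
proof -
  have map_c: "map (case_nat h c) (take j (map Suc xs) @ 0 # drop j (map Suc xs)) =
      take j (map c xs) @ h # drop j (map c xs)" for j xs
    by (simp add: take_map drop_map)
  have "(\<Sum>\<pi> | \<pi> permutes {..<Suc i}. G (map (\<lambda>j. case_nat h c (\<pi> j)) [0..<Suc i])) =
      (\<Sum>xs\<in>permutations_of_set {..<Suc i}. G (map (case_nat h c) xs))"
    using sum_permutes_eq_sum_lists[where i = "Suc i" and G = "\<lambda>xs. G (map (case_nat h c) xs)"] by (simp add: o_def)
  also have "\<dots> = (\<Sum>(xs, j)\<in>permutations_of_set {..<i} \<times> {..i}. G (take j (map c xs) @ h # drop j (map c xs)))"
    unfolding sum.reindex_bij_betw[OF insert_0_permutations_bij, symmetric]
    by (rule sum.cong) (auto simp only: split_beta map_c fst_conv snd_conv)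
  also have "\<dots> = (\<Sum>xs\<in>permutations_of_set {..<i}. \<Sum>j\<le>i. G (take j (map c xs) @ h # drop j (map c xs)))"
    by (rule sum.cartesian_product[symmetric])
  also have "\<dots> = (\<Sum>\<pi> | \<pi> permutes {..<i}. \<Sum>j\<le>i. G (take j (map (\<lambda>l. c (\<pi> l)) [0..<i]) @ h # drop j (map (\<lambda>l. c (\<pi> l)) [0..<i])))"
    using sum_permutes_eq_sum_lists[where i = i and G = "\<lambda>xs. \<Sum>j\<le>i. G (take j (map c xs) @ h # drop j (map c xs))"]
    by (simp add: o_def)
  finally show ?thesis .
qed

abbreviation permuted_dirs :: "nat \<Rightarrow> (nat \<Rightarrow> 'a :: cstar_algebra sa) \<Rightarrow> (nat \<Rightarrow> nat) \<Rightarrow> 'a list"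
  where "permuted_dirs i b \<pi> \<equiv> map (\<lambda>j. sa_elem (b (\<pi> j))) [0..<i]"

text \<open>The derivatives of \<open>p(a)\<close>.\<close>

definition poly_jet :: "complex poly \<Rightarrow> nat \<Rightarrow> 'a :: cstar_algebra sa \<Rightarrow> (nat \<Rightarrow> 'a sa) \<Rightarrow> 'a"
  where "poly_jet p i a b =
    (\<Sum>\<pi> | \<pi> permutes {..<i}. poly_word_sum p (sa_elem a) (permuted_dirs i b \<pi>))"

lemma poly_jet_0: "poly_jet p 0 a b = alg_eval p (sa_elem a)"
  by (simp add: poly_jet_def poly_word_sum_Nil)

lemma poly_word_sum_has_vector_derivative:
  "((\<lambda>t. poly_word_sum p (a + t *\<^sub>R h) bs) has_vector_derivative
    (\<Sum>j\<le>length bs. poly_word_sum p (a + t *\<^sub>R h) (take j bs @ h # drop j bs))) (at t)"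
proof -
  have "((\<lambda>t. poly_word_sum p (a + t *\<^sub>R h) bs) has_vector_derivative
      (\<Sum>n\<le>degree p. coeff p n *\<^sub>C (\<Sum>j\<le>length bs. word_sum n (a + t *\<^sub>R h) (take j bs @ h # drop j bs)))) (at t)"
    unfolding poly_word_sum_def
    by (intro has_vector_derivative_sum
        bounded_linear.has_vector_derivative[OF bounded_linear_scaleC] word_sum_has_vector_derivative)
  then show ?thesis
    by (rule has_vector_derivative_eq_rhs)
      (simp add: poly_word_sum_def scaleC_sum_right sum.swap[of _ "{..degree p}"])
qed

lemma word_sum_linear:
  "j < length bs \<Longrightarrow> linear (\<lambda>v. word_sum n a (bs[j := v]))"
proof (induction n a bs arbitrary: j rule: word_sum.induct)
  case (2 a b bs)
  then show ?case by (cases j) (simp_all add: linear_zero)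
next
  case (3 n a b bs)
  show ?case
  proof (cases j)
    case 0
    have L: "linear (\<lambda>v. word_sum n a (v # bs))" using "3.IH"(1)[of 0] by simp
    show ?thesis using 0 linear_add[OF L] linear_scale[OF L]
      by (intro linearI) (simp_all add: algebra_simps)
  next
    case (Suc l)
    have L: "linear (\<lambda>v. word_sum n a (b # bs[l := v]))" "linear (\<lambda>v. word_sum n a (bs[l := v]))"
      using "3.IH"(1)[of "Suc l"] "3.IH"(2)[of l] "3.prems" Suc by simp_all
    show ?thesis using Suc linear_add[OF L(1)] linear_scale[OF L(1)] linear_add[OF L(2)] linear_scale[OF L(2)]
      by (intro linearI) (simp_all add: algebra_simps)
  qed
qed simp

lemma norm_word_sum_le:
  fixes a :: "'a :: cstar_algebra"
  assumes "norm a \<le> r"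
  shows "norm (word_sum n a bs) \<le> (1 + r) ^ n * prod_list (map norm bs)"
  using assms
proof (induction n a bs rule: word_sum.induct)
  case (1 n a)
  have "norm (a ^ n) \<le> norm (1 :: 'a) * norm a ^ n" by (rule norm_power_le)
  also have "\<dots> \<le> 1 * (1 + r) ^ n"
    using 1 norm_ge_zero[of a] by (intro mult_mono power_mono norm_one_le) auto
  finally show ?case by simp
next
  case (2 a b bs)
  have "0 \<le> prod_list (map norm bs)" by (induction bs) auto
  then show ?case by simp
next
  case (3 n a b bs)
  have r: "0 \<le> r" using "3.prems" norm_ge_zero[of a] by linarith
  have P: "0 \<le> prod_list (map norm bs)" by (induction bs) auto
  let ?M = "(1 + r) ^ n * (norm b * prod_list (map norm bs))"
  have "norm (a * word_sum n a (b # bs)) \<le> r * ?M"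
    using "3.IH"(1) "3.prems" r by (intro order.trans[OF norm_mult_ineq] mult_mono) auto
  moreover have "norm (b * word_sum n a bs) \<le> norm b * ((1 + r) ^ n * prod_list (map norm bs))"
    using "3.IH"(2) "3.prems" by (intro order.trans[OF norm_mult_ineq] mult_left_mono) auto
  moreover have "r * ?M + norm b * ((1 + r) ^ n * prod_list (map norm bs)) =
      (1 + r) ^ Suc n * prod_list (map norm (b # bs))" by (simp add: algebra_simps)
  ultimately show ?case
    using norm_triangle_ineq[of "a * word_sum n a (b # bs)" "b * word_sum n a bs"] by simp
qed

lemma sa_elem_simps [simp]:
  "sa_elem (a + b) = sa_elem a + sa_elem b" "sa_elem (t *\<^sub>R a) = t *\<^sub>R sa_elem a"
  "norm (sa_elem a) = norm a"
  by (simp_all add: plus_sa.rep_eq scaleR_sa.rep_eq norm_sa.rep_eq)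

lemma star_sa_elem [simp]: "star (sa_elem a) = sa_elem a"
  using sa_elem[of a] by simp

lemma prod_permutes: "\<pi> permutes {..<i} \<Longrightarrow> (\<Prod>j<i. f (\<pi> j)) = (\<Prod>j<i :: nat. f j)"
  using prod.permute[of \<pi> "{..<i}" f] by (simp add: o_def)

text \<open>Differentiating the sum over the permutations of the directions \<open>b 0, \<dots>, b (i - 1)\<close> inserts the
  new direction \<open>h\<close> in all places, which gives the sum over the permutations of \<open>h, b 0, \<dots>\<close>.\<close>

theorem smooth_jet_poly: "smooth_jet (poly_jet p :: nat \<Rightarrow> 'a :: cstar_algebra sa \<Rightarrow> _)"
  unfolding smooth_jet_def
proof (intro conjI allI impI)
  fix i :: nat and a :: "'a sa" and b b' :: "nat \<Rightarrow> 'a sa" assume eq: "\<forall>j<i. b j = b' j"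
  show "poly_jet p i a b = poly_jet p i a b'"
    unfolding poly_jet_def
  proof (rule sum.cong[OF refl])
    fix \<pi> assume "\<pi> \<in> {\<pi>. \<pi> permutes {..<i}}"
    then have "\<pi> j < i" if "j < i" for j using permutes_in_image[of \<pi> "{..<i}" j] that by simp
    then have "permuted_dirs i b \<pi> = map (\<lambda>j. sa_elem (b' (\<pi> j))) [0..<i]"
      using eq by auto
    then show "poly_word_sum p (sa_elem a) (permuted_dirs i b \<pi>) =
        poly_word_sum p (sa_elem a) (map (\<lambda>j. sa_elem (b' (\<pi> j))) [0..<i])" by (rule arg_cong)
  qed
next
  fix i j :: nat and a :: "'a sa" and b :: "nat \<Rightarrow> 'a sa" assume j: "j < i"
  show "linear (\<lambda>v. poly_jet p i a (b(j := v)))"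
    unfolding poly_jet_def poly_word_sum_def
  proof (intro linear_compose_sum ballI)
    fix \<pi> n assume "\<pi> \<in> {\<pi>. \<pi> permutes {..<i}}"
    then have \<pi>: "\<pi> permutes {..<i}" by simp
    define l where "l = inv \<pi> j"
    have l: "l < i" using permutes_in_image[OF permutes_inv[OF \<pi>], of j] j by (simp add: l_def)
    have \<pi>l: "\<pi> x = j \<longleftrightarrow> x = l" for x using permutes_inv_eq[OF \<pi>, of j x] by (auto simp: l_def)
    let ?bs = "permuted_dirs i b \<pi>"
    have upd: "map (\<lambda>x. sa_elem ((b(j := v)) (\<pi> x))) [0..<i] = ?bs[l := sa_elem v]" for v
      by (rule nth_equalityI) (auto simp: nth_list_update \<pi>l)
    have L: "linear (\<lambda>v. word_sum n (sa_elem a) (?bs[l := v]))"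
      by (rule word_sum_linear) (use l in simp)
    show "linear (\<lambda>v. coeff p n *\<^sub>C word_sum n (sa_elem a) (map (\<lambda>x. sa_elem ((b(j := v)) (\<pi> x))) [0..<i]))"
      unfolding upd by (intro linearI)
        (simp_all only: sa_elem_simps linear_add[OF L] linear_scale[OF L] scaleC_add_right scaleC_scaleR)
  qed
next
  fix i :: nat and r :: real
  define K where "K = (\<Sum>\<pi> | \<pi> permutes {..<i}. \<Sum>n\<le>degree p. cmod (coeff p n) * (1 + \<bar>r\<bar>) ^ n)"
  have "norm (poly_jet p i a b) \<le> K * prod_norm i b" if a: "norm a \<le> r" for a :: "'a sa" and b
    unfolding poly_jet_def K_def poly_word_sum_def sum_distrib_right
  proof (intro sum_norm_le)
    fix \<pi> n assume "\<pi> \<in> {\<pi>. \<pi> permutes {..<i}}"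
    then have \<pi>: "\<pi> permutes {..<i}" by simp
    let ?bs = "permuted_dirs i b \<pi>"
    have "prod_list (map norm ?bs) = (\<Prod>j<i. norm (b (\<pi> j)))"
      by (simp add: o_def prod.list_conv_set_nth atLeast0LessThan)
    also have "\<dots> = prod_norm i b" by (rule prod_permutes[OF \<pi>, of "\<lambda>j. norm (b j)"])
    finally have prod: "prod_list (map norm ?bs) = prod_norm i b" .
    have "norm (word_sum n (sa_elem a) ?bs) \<le> (1 + \<bar>r\<bar>) ^ n * prod_list (map norm ?bs)"
      by (rule norm_word_sum_le) (use a in simp)
    then have "norm (word_sum n (sa_elem a) ?bs) \<le> (1 + \<bar>r\<bar>) ^ n * prod_norm i b"
      unfolding prod .
    then show "norm (coeff p n *\<^sub>C word_sum n (sa_elem a) ?bs) \<le> cmod (coeff p n) * (1 + \<bar>r\<bar>) ^ n * prod_norm i b"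
      unfolding norm_scaleC mult.assoc by (intro mult_left_mono) auto
  qed
  moreover have "0 \<le> K" unfolding K_def by (intro sum_nonneg) auto
  ultimately show "\<exists>K\<ge>0. \<forall>a b. norm (a :: 'a sa) \<le> r \<longrightarrow> norm (poly_jet p i a b) \<le> K * prod_norm i b"
    by blast
next
  fix i :: nat and t and a h :: "'a sa" and b :: "nat \<Rightarrow> 'a sa"
  have sa_case: "sa_elem (case_nat h b x) = case_nat (sa_elem h) (\<lambda>j. sa_elem (b j)) x" for x
    by (simp split: nat.split)
  show "((\<lambda>t. poly_jet p i (a + t *\<^sub>R h) b) has_vector_derivative
      poly_jet p (Suc i) (a + t *\<^sub>R h) (case_nat h b)) (at t)"
    unfolding poly_jet_def sa_case sum_permutes_Suc sa_elem_simps
  proof (intro has_vector_derivative_sum)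
    fix \<pi>
    show "((\<lambda>t. poly_word_sum p (sa_elem a + t *\<^sub>R sa_elem h) (permuted_dirs i b \<pi>)) has_vector_derivative
        (\<Sum>j\<le>i. poly_word_sum p (sa_elem a + t *\<^sub>R sa_elem h)
          (take j (permuted_dirs i b \<pi>) @ sa_elem h # drop j (permuted_dirs i b \<pi>)))) (at t)"
      using poly_word_sum_has_vector_derivative[of p "sa_elem a" "sa_elem h" "permuted_dirs i b \<pi>" t]
      by simp
  qed
qed

section \<open>Topologies generated by seminorms\<close>

text \<open>Both the topology on functions of \<open>m\<close> variables and the one on functions of class \<open>C\<^sup>k\<close> are of
  this kind; in the latter case the seminorms depend on divided differences. The subbasic open sets
  have arbitrary centres, and the triangle inequality allows them to be recentred.\<close>

locale distance_topology =
  fixes V :: "'f set" and I :: "'i set" and d :: "'i \<Rightarrow> 'f \<Rightarrow> 'f \<Rightarrow> ennreal" and T :: "'f topology"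
  assumes T_eq: "T = topology_generated_by {{\<psi>\<in>V. d i \<psi> \<phi> < ennreal \<epsilon>} | i \<phi> \<epsilon>. i \<in> I \<and> \<phi> \<in> V \<and> 0 < \<epsilon>}"
    and nonempty: "I \<noteq> {}"
    and dist_refl: "\<And>i \<phi>. i \<in> I \<Longrightarrow> \<phi> \<in> V \<Longrightarrow> d i \<phi> \<phi> = 0"
    and triangle: "\<And>i \<phi> \<psi> \<omega>. i \<in> I \<Longrightarrow> \<phi> \<in> V \<Longrightarrow> \<psi> \<in> V \<Longrightarrow> \<omega> \<in> V \<Longrightarrow> d i \<phi> \<omega> \<le> d i \<phi> \<psi> + d i \<psi> \<omega>"
begin

lemma openin_ball: "i \<in> I \<Longrightarrow> \<phi> \<in> V \<Longrightarrow> 0 < \<epsilon> \<Longrightarrow> openin T {\<psi>\<in>V. d i \<psi> \<phi> < ennreal \<epsilon>}"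
  unfolding T_eq by (rule topology_generated_by_Basis) blast

lemma topspace_T: "topspace T = V"
proof
  show "topspace T \<subseteq> V" unfolding T_eq topology_generated_by_topspace by blast
  obtain i where i: "i \<in> I" using nonempty by blast
  have "\<phi> \<in> topspace T" if "\<phi> \<in> V" for \<phi>
  proof -
    have "\<phi> \<in> {\<psi>\<in>V. d i \<psi> \<phi> < ennreal 1}" using that dist_refl[OF i that] by simp
    then show ?thesis using openin_subset[OF openin_ball[OF i that, of 1]] by auto
  qed
  then show "V \<subseteq> topspace T" by blast
qed

lemma open_contains_ball:
  assumes "openin T U" "\<phi> \<in> U"
  shows "\<exists>J \<epsilon>. finite J \<and> J \<subseteq> I \<and> 0 < \<epsilon> \<and> (\<forall>\<psi>\<in>V. (\<forall>i\<in>J. d i \<psi> \<phi> < ennreal \<epsilon>) \<longrightarrow> \<psi> \<in> U)"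
proof -
  have "generate_topology_on {{\<psi>\<in>V. d i \<psi> \<phi> < ennreal \<epsilon>} | i \<phi> \<epsilon>. i \<in> I \<and> \<phi> \<in> V \<and> 0 < \<epsilon>} U"
    using assms(1) unfolding T_eq by (rule openin_topology_generated_by)
  then show ?thesis using assms(2)
  proof (induction rule: generate_topology_on.induct)
    case Empty
    then show ?case by simp
  next
    case (Int A B)
    then obtain J \<epsilon> J' \<epsilon>' where J: "finite J" "J \<subseteq> I" "0 < \<epsilon>" "\<forall>\<psi>\<in>V. (\<forall>i\<in>J. d i \<psi> \<phi> < ennreal \<epsilon>) \<longrightarrow> \<psi> \<in> A"
      and J': "finite J'" "J' \<subseteq> I" "0 < \<epsilon>'" "\<forall>\<psi>\<in>V. (\<forall>i\<in>J'. d i \<psi> \<phi> < ennreal \<epsilon>') \<longrightarrow> \<psi> \<in> B"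
      by auto
    have "ennreal (min \<epsilon> \<epsilon>') \<le> ennreal \<epsilon>" "ennreal (min \<epsilon> \<epsilon>') \<le> ennreal \<epsilon>'"
      using J(3) J'(3) by (auto intro: ennreal_leI)
    then have "\<psi> \<in> A \<inter> B" if "\<psi> \<in> V" "\<forall>i\<in>J \<union> J'. d i \<psi> \<phi> < ennreal (min \<epsilon> \<epsilon>')" for \<psi>
      using that J(4) J'(4) by (meson IntI UnI1 UnI2 order_less_le_trans)
    then show ?case using J J'
      by (intro exI[of _ "J \<union> J'"] exI[of _ "min \<epsilon> \<epsilon>'"]) auto
  next
    case (UN K)
    then obtain k where "k \<in> K" "\<phi> \<in> k" by blast
    then show ?case using UN.IH[of k] by (meson UnionI)
  next
    case (Basis B)
    then obtain i \<omega> \<delta> where B: "B = {\<psi>\<in>V. d i \<psi> \<omega> < ennreal \<delta>}" "i \<in> I" "\<omega> \<in> V" "0 < \<delta>" by blast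
    then have \<phi>: "\<phi> \<in> V" "d i \<phi> \<omega> < ennreal \<delta>" using Basis.prems by auto
    obtain x where x: "d i \<phi> \<omega> = ennreal x" "0 \<le> x" using \<phi>(2) by (cases "d i \<phi> \<omega>") auto
    have x\<delta>: "x < \<delta>" using \<phi>(2) x B(4) by (simp add: ennreal_less_iff)
    have "d i \<psi> \<omega> < ennreal \<delta>" if \<psi>: "\<psi> \<in> V" "d i \<psi> \<phi> < ennreal (\<delta> - x)" for \<psi>
    proof -
      obtain y where y: "d i \<psi> \<phi> = ennreal y" "0 \<le> y" using \<psi>(2) by (cases "d i \<psi> \<phi>") auto
      have "y < \<delta> - x" using \<psi>(2) y x\<delta> by (simp add: ennreal_less_iff)
      have "d i \<psi> \<omega> \<le> ennreal y + ennreal x"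
        using triangle[OF B(2) \<psi>(1) \<phi>(1) B(3)] by (simp add: x y)
      also have "\<dots> = ennreal (y + x)" using x y by (simp only: ennreal_plus)
      also have "\<dots> < ennreal \<delta>" using \<open>y < \<delta> - x\<close> x y by (intro ennreal_lessI) linarith+
      finally show ?thesis .
    qed
    then show ?case using B x\<delta>
      by (intro exI[of _ "{i}"] exI[of _ "\<delta> - x"]) auto
  qed
qed

lemma closure_approx:
  assumes "\<phi> \<in> T closure_of S" "finite J" "J \<subseteq> I" "0 < \<epsilon>"
  shows "\<exists>\<psi>\<in>S. \<psi> \<in> V \<and> (\<forall>i\<in>J. d i \<psi> \<phi> < ennreal \<epsilon>)"
proof -
  have \<phi>: "\<phi> \<in> V" using assms(1) by (simp add: in_closure_of topspace_T)
  define U where "U = (\<Inter>i\<in>J. {\<psi>\<in>V. d i \<psi> \<phi> < ennreal \<epsilon>}) \<inter> topspace T"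
  have "openin T U" unfolding U_def
    by (intro openin_INT assms(2) openin_ball \<phi> assms(4)) (use assms(3) in blast)
  moreover have "\<phi> \<in> U" using \<phi> dist_refl assms(3,4) by (auto simp: U_def topspace_T)
  ultimately have "\<exists>\<psi>. \<psi> \<in> S \<and> \<psi> \<in> U" using assms(1) by (auto simp: in_closure_of)
  then show ?thesis by (auto simp: U_def topspace_T)
qed

lemma closure_ofI:
  assumes \<phi>: "\<phi> \<in> V" and S: "S \<subseteq> V"
    and approx: "\<And>J \<epsilon>. finite J \<Longrightarrow> J \<subseteq> I \<Longrightarrow> 0 < \<epsilon> \<Longrightarrow> \<exists>\<psi>\<in>S. \<forall>i\<in>J. d i \<psi> \<phi> < ennreal \<epsilon>"
  shows "\<phi> \<in> T closure_of S"
  unfolding in_closure_of topspace_T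
proof (intro conjI allI impI)
  show "\<phi> \<in> V" by (rule \<phi>)
  fix U assume "\<phi> \<in> U \<and> openin T U"
  then obtain J \<epsilon> where J: "finite J" "J \<subseteq> I" "0 < \<epsilon>"
    and U: "\<And>\<psi>. \<psi> \<in> V \<Longrightarrow> (\<forall>i\<in>J. d i \<psi> \<phi> < ennreal \<epsilon>) \<Longrightarrow> \<psi> \<in> U"
    using open_contains_ball[of U \<phi>] by auto
  obtain \<psi> where "\<psi> \<in> S" "\<forall>i\<in>J. d i \<psi> \<phi> < ennreal \<epsilon>" using approx[OF J] by auto
  then show "\<exists>\<psi>. \<psi> \<in> S \<and> \<psi> \<in> U" using U[of \<psi>] S by auto
qed

end

section \<open>Distances given by a family of norms\<close>

lemma cube_subset_rspace: "cube r m \<subseteq> rspace m"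
  by (auto simp: cube_def rspace_def PiE_def)

definition norm_dist :: "norm_family \<Rightarrow> real \<Rightarrow> nat \<Rightarrow> ((nat \<Rightarrow> real) \<Rightarrow> complex) \<Rightarrow> ((nat \<Rightarrow> real) \<Rightarrow> complex) \<Rightarrow> ennreal"
  where "norm_dist \<alpha> r m \<phi> \<psi> = seminorm \<alpha> r m (\<lambda>s\<in>rspace m. \<phi> s - \<psi> s)"

locale cube_norms =
  fixes \<alpha> :: norm_family and m :: nat
  assumes norms: "\<And>r. 0 < r \<Longrightarrow> inf_norm_on (cube r m) (\<alpha> r m)"
begin

abbreviation "Crm \<equiv> Cfun (rspace m)"

abbreviation fun_plus (infixl "\<oplus>" 65) where "\<phi> \<oplus> \<psi> \<equiv> \<lambda>s\<in>rspace m. \<phi> s + \<psi> s :: complex"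
abbreviation fun_minus (infixl "\<ominus>" 65) where "\<phi> \<ominus> \<psi> \<equiv> \<lambda>s\<in>rspace m. \<phi> s - \<psi> s :: complex"
abbreviation fun_scale (infixr "\<odot>" 75) where "c \<odot> \<phi> \<equiv> \<lambda>s\<in>rspace m. c * \<phi> s :: complex"

lemma restrict_cube: "\<phi> \<in> Crm \<Longrightarrow> restrict \<phi> (cube r m) \<in> Cfun (cube r m)"
  by (intro Cfun_restrictI continuous_on_subset[OF _ cube_subset_rspace] Cfun_continuous)

lemma seminorm_cong:
  "(\<And>s. s \<in> cube r m \<Longrightarrow> \<phi> s = \<psi> s) \<Longrightarrow> seminorm \<alpha> r m \<phi> = seminorm \<alpha> r m \<psi>"
  unfolding seminorm_def by (metis restrict_ext)

lemma
  assumes "0 < r" "f \<in> Cfun (cube r m)"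
  shows norm_scale_cube: "\<alpha> r m (\<lambda>s\<in>cube r m. c * f s) = ennreal (cmod c) * \<alpha> r m f"
    and norm_add_cube: "g \<in> Cfun (cube r m) \<Longrightarrow> \<alpha> r m (\<lambda>s\<in>cube r m. f s + g s) \<le> \<alpha> r m f + \<alpha> r m g"
  using norms[OF assms(1)] assms(2) unfolding inf_norm_on_def by blast+

lemma seminorm_add:
  assumes "0 < r" "\<phi> \<in> Crm" "\<psi> \<in> Crm"
  shows "seminorm \<alpha> r m (\<phi> \<oplus> \<psi>) \<le> seminorm \<alpha> r m \<phi> + seminorm \<alpha> r m \<psi>"
proof -
  have "restrict (\<phi> \<oplus> \<psi>) (cube r m) =
      (\<lambda>s\<in>cube r m. restrict \<phi> (cube r m) s + restrict \<psi> (cube r m) s)"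
    using cube_subset_rspace[of r m] by (auto simp: restrict_def fun_eq_iff)
  then show ?thesis
    unfolding seminorm_def by (simp only:) (intro norm_add_cube restrict_cube assms)
qed

lemma seminorm_scale:
  assumes "0 < r" "\<phi> \<in> Crm"
  shows "seminorm \<alpha> r m (c \<odot> \<phi>) = ennreal (cmod c) * seminorm \<alpha> r m \<phi>"
proof -
  have "restrict (c \<odot> \<phi>) (cube r m) = (\<lambda>s\<in>cube r m. c * restrict \<phi> (cube r m) s)"
    using cube_subset_rspace[of r m] by (auto simp: restrict_def fun_eq_iff)
  then show ?thesis
    unfolding seminorm_def by (simp only:) (intro norm_scale_cube restrict_cube assms)
qed

lemma seminorm_zero:
  assumes "0 < r"
  shows "seminorm \<alpha> r m (\<lambda>s\<in>rspace m. 0) = 0"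
proof -
  have "(\<lambda>s\<in>cube r m. 0 :: complex) \<in> Cfun (cube r m)" by (intro Cfun_restrictI continuous_intros)
  moreover have "restrict (\<lambda>s\<in>rspace m. 0) (cube r m) = (\<lambda>s\<in>cube r m. 0 :: complex)"
    using cube_subset_rspace[of r m] by (auto simp: restrict_def fun_eq_iff)
  ultimately show ?thesis using norms[OF assms] unfolding seminorm_def inf_norm_on_def by simp
qed

lemma Crm_add: "\<phi> \<in> Crm \<Longrightarrow> \<psi> \<in> Crm \<Longrightarrow> (\<phi> \<oplus> \<psi>) \<in> Crm"
  by (intro Cfun_restrictI continuous_intros Cfun_continuous)

lemma Crm_diff: "\<phi> \<in> Crm \<Longrightarrow> \<psi> \<in> Crm \<Longrightarrow> (\<phi> \<ominus> \<psi>) \<in> Crm"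
  by (intro Cfun_restrictI continuous_intros Cfun_continuous)

lemma Crm_scale: "\<phi> \<in> Crm \<Longrightarrow> (c \<odot> \<phi>) \<in> Crm"
  by (intro Cfun_restrictI continuous_intros Cfun_continuous)

lemma norm_dist_refl: "0 < r \<Longrightarrow> norm_dist \<alpha> r m \<phi> \<phi> = 0"
  using seminorm_zero by (simp add: norm_dist_def)

lemma norm_dist_add:
  assumes r: "0 < r" and C: "\<phi> \<in> Crm" "\<psi> \<in> Crm" "\<phi>' \<in> Crm" "\<psi>' \<in> Crm"
  shows "norm_dist \<alpha> r m (\<phi> \<oplus> \<phi>') (\<psi> \<oplus> \<psi>')
    \<le> norm_dist \<alpha> r m \<phi> \<psi> + norm_dist \<alpha> r m \<phi>' \<psi>'"
proof -
  have "norm_dist \<alpha> r m (\<phi> \<oplus> \<phi>') (\<psi> \<oplus> \<psi>') =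
      seminorm \<alpha> r m (\<lambda>s\<in>rspace m. (\<phi> \<ominus> \<psi>) s + (\<phi>' \<ominus> \<psi>') s)"
    unfolding norm_dist_def using cube_subset_rspace[of r m] by (intro seminorm_cong) auto
  also have "\<dots> \<le> norm_dist \<alpha> r m \<phi> \<psi> + norm_dist \<alpha> r m \<phi>' \<psi>'"
    unfolding norm_dist_def by (intro seminorm_add r Crm_diff C)
  finally show ?thesis .
qed

lemma norm_dist_triangle:
  assumes r: "0 < r" and C: "\<phi> \<in> Crm" "\<psi> \<in> Crm" "\<omega> \<in> Crm"
  shows "norm_dist \<alpha> r m \<phi> \<omega> \<le> norm_dist \<alpha> r m \<phi> \<psi> + norm_dist \<alpha> r m \<psi> \<omega>"
proof -
  have "norm_dist \<alpha> r m \<phi> \<omega> =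
      seminorm \<alpha> r m (\<lambda>s\<in>rspace m. (\<phi> \<ominus> \<psi>) s + (\<psi> \<ominus> \<omega>) s)"
    unfolding norm_dist_def using cube_subset_rspace[of r m] by (intro seminorm_cong) auto
  also have "\<dots> \<le> norm_dist \<alpha> r m \<phi> \<psi> + norm_dist \<alpha> r m \<psi> \<omega>"
    unfolding norm_dist_def by (intro seminorm_add r Crm_diff C)
  finally show ?thesis .
qed

lemma norm_dist_scale:
  assumes r: "0 < r" and C: "\<phi> \<in> Crm" "\<psi> \<in> Crm"
  shows "norm_dist \<alpha> r m (c \<odot> \<phi>) (c \<odot> \<psi>) = ennreal (cmod c) * norm_dist \<alpha> r m \<phi> \<psi>"
proof -
  have "norm_dist \<alpha> r m (c \<odot> \<phi>) (c \<odot> \<psi>) =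
      seminorm \<alpha> r m (\<lambda>s\<in>rspace m. c * (\<phi> \<ominus> \<psi>) s)"
    unfolding norm_dist_def using cube_subset_rspace[of r m]
    by (intro seminorm_cong) (auto simp: right_diff_distrib)
  also have "\<dots> = ennreal (cmod c) * norm_dist \<alpha> r m \<phi> \<psi>"
    unfolding norm_dist_def by (intro seminorm_scale r Crm_diff C)
  finally show ?thesis .
qed

lemma norm_dist_commute:
  assumes r: "0 < r" and C: "\<phi> \<in> Crm" "\<psi> \<in> Crm"
  shows "norm_dist \<alpha> r m \<phi> \<psi> = norm_dist \<alpha> r m \<psi> \<phi>"
proof -
  have "norm_dist \<alpha> r m \<phi> \<psi> = seminorm \<alpha> r m (\<lambda>s\<in>rspace m. (-1) * (\<psi> \<ominus> \<phi>) s)"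
    unfolding norm_dist_def using cube_subset_rspace[of r m] by (intro seminorm_cong) auto
  also have "\<dots> = norm_dist \<alpha> r m \<psi> \<phi>"
    unfolding norm_dist_def using seminorm_scale[OF r Crm_diff[OF C(2,1)], of "-1"] by simp
  finally show ?thesis .
qed

abbreviation "V \<equiv> finite_seminorm_funs \<alpha> m"

lemma V_Crm: "\<phi> \<in> V \<Longrightarrow> \<phi> \<in> Crm"
  by (simp add: finite_seminorm_funs_def)

lemma V_add: "\<phi> \<in> V \<Longrightarrow> \<psi> \<in> V \<Longrightarrow> (\<phi> \<oplus> \<psi>) \<in> V"
  unfolding finite_seminorm_funs_def
  by (auto intro!: Crm_add intro: order.strict_trans1[OF seminorm_add])

lemma V_scale: "\<phi> \<in> V \<Longrightarrow> (c \<odot> \<phi>) \<in> V"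
  unfolding finite_seminorm_funs_def
  by (auto intro!: Crm_scale simp: seminorm_scale ennreal_mult_less_top)

lemma norm_dist_finite:
  assumes "0 < r" "\<phi> \<in> V" "\<psi> \<in> V"
  shows "norm_dist \<alpha> r m \<phi> \<psi> < \<infinity>"
proof -
  have "norm_dist \<alpha> r m \<phi> \<psi> = seminorm \<alpha> r m (\<lambda>s\<in>rspace m. \<phi> s + (\<lambda>s\<in>rspace m. (-1) * \<psi> s) s)"
    unfolding norm_dist_def using cube_subset_rspace[of r m] by (intro seminorm_cong) auto
  also have "\<dots> < \<infinity>"
    using V_add[OF assms(2) V_scale[OF assms(3), of "-1"]] assms(1) by (simp add: finite_seminorm_funs_def)
  finally show ?thesis .
qed

sublocale distance_topology V "{0<..}" "\<lambda>r. norm_dist \<alpha> r m" "finite_seminorm_top \<alpha> m"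
proof
  show "finite_seminorm_top \<alpha> m = topology_generated_by
      {{\<psi>\<in>V. norm_dist \<alpha> i m \<psi> \<phi> < ennreal \<epsilon>} | i \<phi> \<epsilon>. i \<in> {0<..} \<and> \<phi> \<in> V \<and> 0 < \<epsilon>}"
    by (simp only: finite_seminorm_top_def seminorm_topology_def norm_dist_def)
qed (auto intro: norm_dist_refl norm_dist_triangle V_Crm)

end

section \<open>The lexicographic functional calculus\<close>

text \<open>The points \<open>a\<close> and \<open>b\<close> of the calculus are fixed. The bound is meant for a radius \<open>r\<close> that
  dominates the norms of the \<open>a i\<close> and for the product \<open>C\<close> of the norms of the \<open>b i\<close>; one such radius
  suffices to control the values.\<close>

locale lex_point = cube_norms \<alpha> m for \<alpha> m +
  fixes a b :: "nat \<Rightarrow> 'a :: cstar_algebra" and r C :: real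
  assumes r: "0 < r" and C: "0 \<le> C"
    and polys: "mpoly_fun m ` mpolys m \<subseteq> V"
    and bound: "\<And>P. P \<in> mpolys m \<Longrightarrow>
      ennreal (norm (mpoly_tensor m P a b)) \<le> seminorm \<alpha> r m (mpoly_fun m P) * ennreal C"
begin

abbreviation "CA \<equiv> C_alpha \<alpha> m"

definition rdist :: "((nat \<Rightarrow> real) \<Rightarrow> complex) \<Rightarrow> ((nat \<Rightarrow> real) \<Rightarrow> complex) \<Rightarrow> real"
  where "rdist \<phi> \<psi> = enn2real (norm_dist \<alpha> r m \<phi> \<psi>)"

lemma ennreal_rdist: "\<phi> \<in> V \<Longrightarrow> \<psi> \<in> V \<Longrightarrow> norm_dist \<alpha> r m \<phi> \<psi> = ennreal (rdist \<phi> \<psi>)"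
  using norm_dist_finite[OF r] by (simp add: rdist_def infinity_ennreal_def)

lemma rdist_nonneg [simp]: "0 \<le> rdist \<phi> \<psi>"
  by (simp add: rdist_def)

lemma rdist_commute: "\<phi> \<in> V \<Longrightarrow> \<psi> \<in> V \<Longrightarrow> rdist \<phi> \<psi> = rdist \<psi> \<phi>"
  using norm_dist_commute[OF r V_Crm V_Crm] by (simp add: rdist_def)

lemma ennreal_le_plusD: "ennreal x \<le> ennreal y + ennreal z \<Longrightarrow> 0 \<le> y \<Longrightarrow> 0 \<le> z \<Longrightarrow> x \<le> y + z"
  by (metis add_nonneg_nonneg ennreal_le_iff ennreal_plus)

lemma rdist_triangle: "\<phi> \<in> V \<Longrightarrow> \<psi> \<in> V \<Longrightarrow> \<omega> \<in> V \<Longrightarrow> rdist \<phi> \<omega> \<le> rdist \<phi> \<psi> + rdist \<psi> \<omega>"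
  by (intro ennreal_le_plusD) (auto simp: ennreal_rdist[symmetric] intro!: norm_dist_triangle r V_Crm)

lemma rdist_add:
  assumes "\<phi> \<in> V" "\<psi> \<in> V" "\<phi>' \<in> V" "\<psi>' \<in> V"
  shows "rdist (\<phi> \<oplus> \<phi>') (\<psi> \<oplus> \<psi>') \<le> rdist \<phi> \<psi> + rdist \<phi>' \<psi>'"
proof (rule ennreal_le_plusD)
  show "ennreal (rdist (\<phi> \<oplus> \<phi>') (\<psi> \<oplus> \<psi>'))
      \<le> ennreal (rdist \<phi> \<psi>) + ennreal (rdist \<phi>' \<psi>')"
    unfolding ennreal_rdist[OF assms(1,2), symmetric] ennreal_rdist[OF assms(3,4), symmetric]
      ennreal_rdist[OF V_add[OF assms(1,3)] V_add[OF assms(2,4)], symmetric]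
    by (intro norm_dist_add r V_Crm assms)
qed simp_all

lemma rdist_scale:
  assumes "\<phi> \<in> V" "\<psi> \<in> V"
  shows "rdist (c \<odot> \<phi>) (c \<odot> \<psi>) = cmod c * rdist \<phi> \<psi>"
  unfolding rdist_def norm_dist_scale[OF r V_Crm[OF assms(1)] V_Crm[OF assms(2)]]
  by (simp add: enn2real_mult)

lemma poly_in_V: "P \<in> mpolys m \<Longrightarrow> mpoly_fun m P \<in> V"
  using polys by blast

lemma CA_V: "\<phi> \<in> CA \<Longrightarrow> \<phi> \<in> V"
  using closure_of_subset_topspace[of "finite_seminorm_top \<alpha> m"] by (auto simp: C_alpha_def topspace_T)

lemma poly_in_CA: "P \<in> mpolys m \<Longrightarrow> mpoly_fun m P \<in> CA"
  using closure_of_subset[of "mpoly_fun m ` mpolys m" "finite_seminorm_top \<alpha> m"] polys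
  by (auto simp: C_alpha_def topspace_T)

lemma CA_approx:
  assumes "\<phi> \<in> CA" "finite J" "J \<subseteq> {0<..}" "0 < \<epsilon>"
  shows "\<exists>P\<in>mpolys m. \<forall>i\<in>J. norm_dist \<alpha> i m (mpoly_fun m P) \<phi> < ennreal \<epsilon>"
  using closure_approx[OF assms(1)[unfolded C_alpha_def] assms(2-4)] by blast

lemma CA_approx_r:
  assumes "\<phi> \<in> CA" "0 < \<epsilon>"
  shows "\<exists>P\<in>mpolys m. rdist \<phi> (mpoly_fun m P) < \<epsilon>"
proof -
  obtain P where P: "P \<in> mpolys m" "norm_dist \<alpha> r m (mpoly_fun m P) \<phi> < ennreal \<epsilon>"
    using CA_approx[OF assms(1), of "{r}" \<epsilon>] r assms(2) by auto
  then have "rdist (mpoly_fun m P) \<phi> < \<epsilon>"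
    using assms by (simp add: ennreal_rdist poly_in_V CA_V ennreal_less_iff)
  then have "rdist \<phi> (mpoly_fun m P) < \<epsilon>"
    by (simp only: rdist_commute[OF CA_V[OF assms(1)] poly_in_V[OF P(1)]])
  then show ?thesis using P(1) by blast
qed

lemma CA_I:
  assumes "\<phi> \<in> V"
    and "\<And>J \<epsilon>. finite J \<Longrightarrow> J \<subseteq> {0<..} \<Longrightarrow> 0 < \<epsilon> \<Longrightarrow> \<exists>P\<in>mpolys m. \<forall>i\<in>J. norm_dist \<alpha> i m (mpoly_fun m P) \<phi> < ennreal \<epsilon>"
  shows "\<phi> \<in> CA"
  unfolding C_alpha_def by (rule closure_ofI) (use assms polys in auto)

lemma CA_add:
  assumes "\<phi> \<in> CA" "\<psi> \<in> CA"
  shows "(\<phi> \<oplus> \<psi>) \<in> CA"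
proof (rule CA_I)
  fix J :: "real set" and \<epsilon> :: real assume J: "finite J" "J \<subseteq> {0<..}" "0 < \<epsilon>"
  then have "0 < \<epsilon> / 2" by simp
  obtain P where P: "P \<in> mpolys m" "\<And>i. i \<in> J \<Longrightarrow> norm_dist \<alpha> i m (mpoly_fun m P) \<phi> < ennreal (\<epsilon> / 2)"
    using CA_approx[OF assms(1) J(1,2) \<open>0 < \<epsilon> / 2\<close>] by blast
  obtain Q where Q: "Q \<in> mpolys m" "\<And>i. i \<in> J \<Longrightarrow> norm_dist \<alpha> i m (mpoly_fun m Q) \<psi> < ennreal (\<epsilon> / 2)"
    using CA_approx[OF assms(2) J(1,2) \<open>0 < \<epsilon> / 2\<close>] by blast
  have "norm_dist \<alpha> i m (mpoly_fun m (P + Q)) (\<phi> \<oplus> \<psi>) < ennreal \<epsilon>" if i: "i \<in> J" for i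
  proof -
    have "norm_dist \<alpha> i m (mpoly_fun m (P + Q)) (\<phi> \<oplus> \<psi>)
        \<le> norm_dist \<alpha> i m (mpoly_fun m P) \<phi> + norm_dist \<alpha> i m (mpoly_fun m Q) \<psi>"
      unfolding mpoly_fun_add using J(2) i
      by (intro norm_dist_add V_Crm poly_in_V CA_V assms P(1) Q(1)) auto
    also have "\<dots> < ennreal (\<epsilon> / 2) + ennreal (\<epsilon> / 2)"
      by (intro add_strict_mono P Q i)
    also have "\<dots> = ennreal \<epsilon>" using J(3) by (simp flip: ennreal_plus)
    finally show ?thesis .
  qed
  then show "\<exists>P\<in>mpolys m. \<forall>i\<in>J. norm_dist \<alpha> i m (mpoly_fun m P) (\<phi> \<oplus> \<psi>) < ennreal \<epsilon>"
    using mpolys_add[OF P(1) Q(1)] by blast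
qed (intro V_add CA_V assms)

lemma CA_scale:
  assumes "\<phi> \<in> CA"
  shows "(c \<odot> \<phi>) \<in> CA"
proof (rule CA_I)
  fix J :: "real set" and \<epsilon> :: real assume J: "finite J" "J \<subseteq> {0<..}" "0 < \<epsilon>"
  define \<delta> where "\<delta> = \<epsilon> / (cmod c + 1)"
  have \<delta>: "0 < \<delta>" using J(3) by (simp add: \<delta>_def add_nonneg_pos)
  have "(cmod c + 1) * \<delta> = \<epsilon>" using add_nonneg_pos[OF norm_ge_zero[of c] zero_less_one] by (simp add: \<delta>_def)
  then have c\<delta>: "cmod c * \<delta> < \<epsilon>" using \<delta> by (simp add: distrib_right)
  obtain P where P: "P \<in> mpolys m" "\<And>i. i \<in> J \<Longrightarrow> norm_dist \<alpha> i m (mpoly_fun m P) \<phi> < ennreal \<delta>"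
    using CA_approx[OF assms J(1,2) \<delta>] by blast
  have "norm_dist \<alpha> i m (mpoly_fun m (mpoly_smult c P)) (c \<odot> \<phi>) < ennreal \<epsilon>" if i: "i \<in> J" for i
  proof -
    have "norm_dist \<alpha> i m (mpoly_fun m (mpoly_smult c P)) (c \<odot> \<phi>) =
        ennreal (cmod c) * norm_dist \<alpha> i m (mpoly_fun m P) \<phi>"
      unfolding mpoly_fun_smult using J(2) i
      by (intro norm_dist_scale V_Crm poly_in_V CA_V assms P(1)) auto
    also have "\<dots> \<le> ennreal (cmod c) * ennreal \<delta>" using P(2)[OF i] by (intro mult_left_mono) auto
    also have "\<dots> = ennreal (cmod c * \<delta>)" using \<delta> by (simp add: ennreal_mult)
    also have "\<dots> < ennreal \<epsilon>" using c\<delta> \<delta> J(3) by (intro ennreal_lessI)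
    finally show ?thesis .
  qed
  then show "\<exists>P\<in>mpolys m. \<forall>i\<in>J. norm_dist \<alpha> i m (mpoly_fun m P) (c \<odot> \<phi>) < ennreal \<epsilon>"
    using mpolys_smult[OF P(1)] by blast
qed (intro V_scale CA_V assms)

lemma tensor_dist:
  assumes "P \<in> mpolys m" "Q \<in> mpolys m"
  shows "norm (mpoly_tensor m P a b - mpoly_tensor m Q a b) \<le> C * rdist (mpoly_fun m P) (mpoly_fun m Q)"
proof -
  define R where "R = P + mpoly_smult (-1) Q"
  have R: "R \<in> mpolys m" unfolding R_def by (intro mpolys_add mpolys_smult assms)
  have "seminorm \<alpha> r m (mpoly_fun m R) = norm_dist \<alpha> r m (mpoly_fun m P) (mpoly_fun m Q)"
    unfolding norm_dist_def R_def mpoly_fun_add mpoly_fun_smult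
    using cube_subset_rspace[of r m] by (intro seminorm_cong) auto
  also have "\<dots> = ennreal (rdist (mpoly_fun m P) (mpoly_fun m Q))"
    by (intro ennreal_rdist poly_in_V assms)
  finally have "ennreal (norm (mpoly_tensor m R a b)) \<le> ennreal (rdist (mpoly_fun m P) (mpoly_fun m Q)) * ennreal C"
    using bound[OF R] by simp
  also have "\<dots> = ennreal (C * rdist (mpoly_fun m P) (mpoly_fun m Q))"
    using C by (simp add: ennreal_mult mult.commute)
  finally have "norm (mpoly_tensor m R a b) \<le> C * rdist (mpoly_fun m P) (mpoly_fun m Q)"
    using C by (simp add: ennreal_le_iff)
  then show ?thesis by (simp add: R_def mpoly_tensor_add mpoly_tensor_smult scaleC_minus_left)
qed

lemma ex1_value:
  assumes "\<phi> \<in> CA"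
  shows "\<exists>!x. \<forall>P\<in>mpolys m. norm (x - mpoly_tensor m P a b) \<le> C * rdist \<phi> (mpoly_fun m P)"
proof (rule unique_limit_of_values)
  fix P Q assume PQ: "P \<in> mpolys m" "Q \<in> mpolys m"
  have "rdist (mpoly_fun m P) (mpoly_fun m Q) \<le> rdist (mpoly_fun m P) \<phi> + rdist \<phi> (mpoly_fun m Q)"
    by (intro rdist_triangle poly_in_V CA_V PQ assms)
  also have "rdist (mpoly_fun m P) \<phi> = rdist \<phi> (mpoly_fun m P)"
    by (intro rdist_commute poly_in_V CA_V PQ assms)
  finally show "norm (mpoly_tensor m P a b - mpoly_tensor m Q a b) \<le> C * (rdist \<phi> (mpoly_fun m P) + rdist \<phi> (mpoly_fun m Q))"
    using tensor_dist[OF PQ] C by (meson mult_left_mono order.trans)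
qed (use CA_approx_r[OF assms] C in auto)

definition extension :: "((nat \<Rightarrow> real) \<Rightarrow> complex) \<Rightarrow> 'a"
  where "extension = (\<lambda>\<phi>\<in>CA. THE x. \<forall>P\<in>mpolys m. norm (x - mpoly_tensor m P a b) \<le> C * rdist \<phi> (mpoly_fun m P))"

lemma extension_dist_poly:
  assumes "\<phi> \<in> CA" "P \<in> mpolys m"
  shows "norm (extension \<phi> - mpoly_tensor m P a b) \<le> C * rdist \<phi> (mpoly_fun m P)"
  using theI'[OF ex1_value[OF assms(1)]] assms by (simp add: extension_def)

lemma extension_dist:
  assumes "\<phi> \<in> CA" "\<psi> \<in> CA"
  shows "norm (extension \<phi> - extension \<psi>) \<le> C * rdist \<phi> \<psi>"
proof (rule le_of_le_add_small_multiple)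
  fix e :: real assume "0 < e"
  then obtain P where P: "P \<in> mpolys m" "rdist \<phi> (mpoly_fun m P) < e"
    using CA_approx_r[OF assms(1)] by blast
  have "rdist \<psi> (mpoly_fun m P) \<le> rdist \<psi> \<phi> + rdist \<phi> (mpoly_fun m P)"
    by (intro rdist_triangle poly_in_V CA_V P assms)
  also have "rdist \<psi> \<phi> = rdist \<phi> \<psi>" by (intro rdist_commute CA_V assms)
  finally have "rdist \<psi> (mpoly_fun m P) + rdist \<phi> (mpoly_fun m P) \<le> rdist \<phi> \<psi> + 2 * e" using P(2) by linarith
  then have "C * (rdist \<psi> (mpoly_fun m P) + rdist \<phi> (mpoly_fun m P)) \<le> C * (rdist \<phi> \<psi> + 2 * e)"
    using C by (rule mult_left_mono)
  moreover have "norm (extension \<phi> - extension \<psi>) \<le>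
      norm (extension \<phi> - mpoly_tensor m P a b) + norm (extension \<psi> - mpoly_tensor m P a b)"
    using dist_triangle2[of "extension \<phi>" "extension \<psi>" "mpoly_tensor m P a b"] by (simp add: dist_norm)
  ultimately show "norm (extension \<phi> - extension \<psi>) \<le> C * rdist \<phi> \<psi> + e * (2 * C)"
    using extension_dist_poly[OF assms(1) P(1)] extension_dist_poly[OF assms(2) P(1)]
    by (simp add: distrib_left mult_ac)
qed

lemma extension_eqI:
  assumes \<phi>: "\<phi> \<in> CA"
    and approx: "\<And>e. 0 < e \<Longrightarrow> \<exists>P\<in>mpolys m. rdist \<phi> (mpoly_fun m P) \<le> B * e \<and> norm (x - mpoly_tensor m P a b) \<le> B' * e"
  shows "extension \<phi> = x"
proof (rule eq_of_norm_diff_le_small_multiple)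
  fix e :: real assume "0 < e"
  then obtain P where P: "P \<in> mpolys m" "rdist \<phi> (mpoly_fun m P) \<le> B * e" "norm (x - mpoly_tensor m P a b) \<le> B' * e"
    using approx by blast
  have "norm (extension \<phi> - x) \<le> norm (extension \<phi> - mpoly_tensor m P a b) + norm (x - mpoly_tensor m P a b)"
    using dist_triangle2[of "extension \<phi>" x "mpoly_tensor m P a b"] by (simp add: dist_norm)
  also have "\<dots> \<le> C * (B * e) + B' * e"
    using extension_dist_poly[OF \<phi> P(1)] mult_left_mono[OF P(2) C] P(3) by linarith
  finally show "norm (extension \<phi> - x) \<le> e * (C * B + B')" by (simp add: algebra_simps)
qed

lemma extension_poly: "P \<in> mpolys m \<Longrightarrow> extension (mpoly_fun m P) = mpoly_tensor m P a b"
  by (rule extension_eqI[where B = 1 and B' = 1])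
    (auto intro!: bexI[of _ P] poly_in_CA simp: rdist_def norm_dist_refl[OF r] poly_in_V)

lemma extension_add:
  assumes "\<phi> \<in> CA" "\<psi> \<in> CA"
  shows "extension (\<phi> \<oplus> \<psi>) = extension \<phi> + extension \<psi>"
proof (rule extension_eqI[where B = 2 and B' = "2 * C"])
  fix e :: real assume e: "0 < e"
  obtain P where P: "P \<in> mpolys m" "rdist \<phi> (mpoly_fun m P) < e" using CA_approx_r[OF assms(1) e] by blast
  obtain Q where Q: "Q \<in> mpolys m" "rdist \<psi> (mpoly_fun m Q) < e" using CA_approx_r[OF assms(2) e] by blast
  have "rdist (\<phi> \<oplus> \<psi>) (mpoly_fun m (P + Q)) \<le> rdist \<phi> (mpoly_fun m P) + rdist \<psi> (mpoly_fun m Q)"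
    unfolding mpoly_fun_add by (intro rdist_add CA_V poly_in_V assms P Q)
  moreover have "norm (extension \<phi> + extension \<psi> - mpoly_tensor m (P + Q) a b) \<le>
      C * rdist \<phi> (mpoly_fun m P) + C * rdist \<psi> (mpoly_fun m Q)"
    unfolding mpoly_tensor_add
    by (rule order.trans[OF norm_diff_triangle_ineq add_mono[OF extension_dist_poly extension_dist_poly]])
      (use assms P Q in auto)
  moreover have "C * rdist \<phi> (mpoly_fun m P) \<le> C * e" "C * rdist \<psi> (mpoly_fun m Q) \<le> C * e"
    using P(2) Q(2) C by (auto intro: mult_left_mono)
  ultimately show "\<exists>R\<in>mpolys m. rdist (\<phi> \<oplus> \<psi>) (mpoly_fun m R) \<le> 2 * e \<and>
      norm (extension \<phi> + extension \<psi> - mpoly_tensor m R a b) \<le> 2 * C * e"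
    using P(2) Q(2) by (intro bexI[of _ "P + Q"] mpolys_add P(1) Q(1)) auto
qed (intro CA_add assms)

lemma extension_scale:
  assumes "\<phi> \<in> CA"
  shows "extension (c \<odot> \<phi>) = c *\<^sub>C extension \<phi>"
proof (rule extension_eqI[where B = "cmod c" and B' = "cmod c * C"])
  fix e :: real assume e: "0 < e"
  obtain P where P: "P \<in> mpolys m" "rdist \<phi> (mpoly_fun m P) < e" using CA_approx_r[OF assms(1) e] by blast
  have "rdist (c \<odot> \<phi>) (mpoly_fun m (mpoly_smult c P)) = cmod c * rdist \<phi> (mpoly_fun m P)"
    unfolding mpoly_fun_smult by (intro rdist_scale CA_V poly_in_V assms P)
  moreover have "norm (c *\<^sub>C extension \<phi> - mpoly_tensor m (mpoly_smult c P) a b) =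
      cmod c * norm (extension \<phi> - mpoly_tensor m P a b)"
    unfolding mpoly_tensor_smult by (simp add: norm_scaleC flip: scaleC_diff_right)
  moreover have "norm (extension \<phi> - mpoly_tensor m P a b) \<le> C * e"
    using extension_dist_poly[OF assms P(1)] mult_left_mono[OF less_imp_le[OF P(2)] C] by linarith
  ultimately show "\<exists>R\<in>mpolys m. rdist (c \<odot> \<phi>) (mpoly_fun m R) \<le> cmod c * e \<and>
      norm (c *\<^sub>C extension \<phi> - mpoly_tensor m R a b) \<le> cmod c * C * e"
    using P(2) by (intro bexI[of _ "mpoly_smult c P"] mpolys_smult P(1)) (auto simp: mult.assoc intro!: mult_left_mono)
qed (intro CA_scale assms)

lemma extension_continuous:
  "continuous_map (subtopology (finite_seminorm_top \<alpha> m) CA) euclidean extension"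
  unfolding continuous_map_def
proof (intro conjI allI impI)
  fix U :: "'a set" assume "openin euclidean U"
  then have U: "open U" by simp
  let ?T = "subtopology (finite_seminorm_top \<alpha> m) CA"
  have top: "topspace ?T = CA" using CA_V by (auto simp: topspace_T)
  show "openin ?T {\<phi> \<in> topspace ?T. extension \<phi> \<in> U}"
  proof (subst openin_subopen, intro ballI)
    fix \<phi> assume "\<phi> \<in> {\<phi> \<in> topspace ?T. extension \<phi> \<in> U}"
    then have \<phi>: "\<phi> \<in> CA" "extension \<phi> \<in> U" by (auto simp: top)
    obtain e where e: "0 < e" "\<And>x. dist x (extension \<phi>) < e \<Longrightarrow> x \<in> U"
      using U \<phi>(2) unfolding open_dist by blast
    define \<delta> where "\<delta> = e / (C + 1)"
    have \<delta>: "0 < \<delta>" using e C by (simp add: \<delta>_def)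
    have "(C + 1) * \<delta> = e" using C by (simp add: \<delta>_def)
    then have C\<delta>: "C * \<delta> < e" using \<delta> by (simp add: distrib_right)
    define B where "B = {\<psi>\<in>V. norm_dist \<alpha> r m \<psi> \<phi> < ennreal \<delta>} \<inter> CA"
    have "openin ?T B"
      unfolding B_def openin_subtopology
      by (intro exI[of _ "{\<psi>\<in>V. norm_dist \<alpha> r m \<psi> \<phi> < ennreal \<delta>}"] conjI openin_ball refl)
        (use r \<delta> CA_V[OF \<phi>(1)] in auto)
    moreover have "\<phi> \<in> B" using \<phi> \<delta> CA_V by (simp add: B_def norm_dist_refl[OF r])
    moreover have "extension \<psi> \<in> U" if "\<psi> \<in> B" for \<psi>
    proof (rule e(2))
      have \<psi>: "\<psi> \<in> CA" "norm_dist \<alpha> r m \<psi> \<phi> < ennreal \<delta>" using that by (auto simp: B_def)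
      then have "rdist \<psi> \<phi> < \<delta>" by (simp add: ennreal_rdist CA_V \<phi> ennreal_less_iff)
      then have "C * rdist \<psi> \<phi> \<le> C * \<delta>" using C by (intro mult_left_mono) auto
      then show "dist (extension \<psi>) (extension \<phi>) < e"
        using extension_dist[OF \<psi>(1) \<phi>(1)] C\<delta> by (simp add: dist_norm)
    qed
    ultimately show "\<exists>T. openin ?T T \<and> \<phi> \<in> T \<and> T \<subseteq> {\<phi> \<in> topspace ?T. extension \<phi> \<in> U}"
      unfolding top by (intro exI[of _ B]) (auto simp: B_def)
  qed
qed simp

lemma lex_extension_extension: "lex_extension \<alpha> m a b extension"
  unfolding lex_extension_def
  using extension_add extension_scale extension_continuous extension_poly by blast

lemma lex_extension_unique:
  assumes S: "lex_extension \<alpha> m a b S" and \<phi>: "\<phi> \<in> CA"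
  shows "S \<phi> = extension \<phi>"
proof -
  let ?T = "subtopology (finite_seminorm_top \<alpha> m) CA"
  have "mpoly_fun m ` mpolys m \<subseteq> CA" using poly_in_CA by blast
  then have "?T closure_of (mpoly_fun m ` mpolys m) = CA"
    by (simp add: closure_of_subtopology Int_absorb1 C_alpha_def)
  then have "\<phi> \<in> ?T closure_of (mpoly_fun m ` mpolys m)" using \<phi> by simp
  moreover have "continuous_map ?T euclidean S" using S by (simp add: lex_extension_def)
  moreover have "S \<psi> = extension \<psi>" if "\<psi> \<in> mpoly_fun m ` mpolys m" for \<psi>
    using that S by (auto simp: lex_extension_def extension_poly)
  ultimately show ?thesis
    using forall_in_closure_of_eq[of \<phi> ?T "mpoly_fun m ` mpolys m" euclidean S extension] extension_continuous
    by auto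
qed

theorem lex_calculus_eq_extension:
  assumes "\<phi> \<in> CA"
  shows "lex_calculus \<alpha> m \<phi> a b = extension \<phi>"
proof -
  have ext: "extension \<in> extensional CA" by (simp add: extension_def)
  have "(THE T. T \<in> extensional CA \<and> lex_extension \<alpha> m a b T) = extension"
  proof (rule the_equality)
    show "extension \<in> extensional CA \<and> lex_extension \<alpha> m a b extension"
      using ext lex_extension_extension by blast
    fix S assume "S \<in> extensional CA \<and> lex_extension \<alpha> m a b S"
    then show "S = extension" using ext lex_extension_unique by (blast intro: extensionalityI)
  qed
  then show ?thesis by (simp add: lex_calculus_def)
qed

end

section \<open>Divided differences of functions in \<open>C\<^sub>\<alpha>\<^sup>k\<close>\<close>

locale polynomial_norms =
  fixes \<alpha> :: norm_family
  assumes all_norms: "\<And>r m. 0 < r \<Longrightarrow> 1 \<le> m \<Longrightarrow> inf_norm_on (cube r m) (\<alpha> r m)"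
    and finite_polys: "finite_on_polynomials \<alpha>"
begin

lemma cube_norms_Suc: "cube_norms \<alpha> (Suc i)"
  by unfold_locales (simp add: all_norms)

lemma polys_subset: "mpoly_fun (Suc i) ` mpolys (Suc i) \<subseteq> finite_seminorm_funs \<alpha> (Suc i)"
  using finite_polys by (simp add: finite_on_polynomials_def)

lemma distance_topology_Ck:
  "distance_topology (finite_seminorm_Ck \<alpha> k) ({0<..} \<times> {..k})
    (\<lambda>(r, i) f g. norm_dist \<alpha> r (Suc i) (divided_difference f i) (divided_difference g i))
    (finite_seminorm_Ck_top \<alpha> k)"
proof
  let ?V = "finite_seminorm_Ck \<alpha> k" and ?I = "{0<..} \<times> {..k} :: (real \<times> nat) set"
  let ?d = "\<lambda>(r, i) f g. norm_dist \<alpha> r (Suc i) (divided_difference f i) (divided_difference g i)"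
  let ?p = "\<lambda>(r, i) f. seminorm \<alpha> r (Suc i) (divided_difference f i)"
  have CkD: "Ck_real i f" if "f \<in> ?V" "i \<le> k" for f i
    using that Ck_real_mono by (auto simp: finite_seminorm_Ck_def)
  have Cfun: "divided_difference f i \<in> Cfun (rspace (Suc i))" if "f \<in> ?V" "i \<le> k" for f i
    by (rule divided_difference_Cfun[OF CkD[OF that]])
  have pd: "?p n (\<lambda>x\<in>UNIV. g x - f x) = ?d n g f" if "n \<in> ?I" "f \<in> ?V" "g \<in> ?V" for n f g
    using that CkD by (auto simp: norm_dist_def divided_difference_diff restrict_UNIV)
  have balls: "{g \<in> ?V. ?p n (\<lambda>x\<in>UNIV. g x - f x) < ennreal \<epsilon>} = {g \<in> ?V. ?d n g f < ennreal \<epsilon>}"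
    if "n \<in> ?I" "f \<in> ?V" for n f \<epsilon>
    by (rule Collect_cong) (use pd[OF that] in auto)
  have "{{g \<in> ?V. ?p n (\<lambda>x\<in>UNIV. g x - f x) < ennreal \<epsilon>} | n f \<epsilon>. n \<in> ?I \<and> f \<in> ?V \<and> 0 < \<epsilon>} =
      {{g \<in> ?V. ?d n g f < ennreal \<epsilon>} | n f \<epsilon>. n \<in> ?I \<and> f \<in> ?V \<and> 0 < \<epsilon>}"
    (is "?L = ?R")
  proof (intro equalityI subsetI)
    fix U assume "U \<in> ?L"
    then obtain n f \<epsilon> where "n \<in> ?I" "f \<in> ?V" "0 < \<epsilon>" "U = {g \<in> ?V. ?p n (\<lambda>x\<in>UNIV. g x - f x) < ennreal \<epsilon>}"
      by blast
    then show "U \<in> ?R" unfolding balls[OF \<open>n \<in> ?I\<close> \<open>f \<in> ?V\<close>] by blast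
  next
    fix U assume "U \<in> ?R"
    then obtain n f \<epsilon> where "n \<in> ?I" "f \<in> ?V" "0 < \<epsilon>" "U = {g \<in> ?V. ?d n g f < ennreal \<epsilon>}"
      by blast
    then show "U \<in> ?L" unfolding balls[OF \<open>n \<in> ?I\<close> \<open>f \<in> ?V\<close>, symmetric] by blast
  qed
  then show "finite_seminorm_Ck_top \<alpha> k = topology_generated_by
      {{g \<in> ?V. ?d n g f < ennreal \<epsilon>} | n f \<epsilon>. n \<in> ?I \<and> f \<in> ?V \<and> 0 < \<epsilon>}"
    unfolding finite_seminorm_Ck_top_def seminorm_topology_def by (rule arg_cong)
  show "?I \<noteq> {}" using zero_less_one by blast
  show "?d n f f = 0" if "n \<in> ?I" for n f
    using that by (auto simp: cube_norms.norm_dist_refl[OF cube_norms_Suc])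
  show "?d n f h \<le> ?d n f g + ?d n g h" if "n \<in> ?I" "f \<in> ?V" "g \<in> ?V" "h \<in> ?V" for n f g h
    using that Cfun by (auto intro!: cube_norms.norm_dist_triangle[OF cube_norms_Suc])
qed

lemma Ck_alpha_finite: "f \<in> Ck_alpha \<alpha> k \<Longrightarrow> f \<in> finite_seminorm_Ck \<alpha> k"
  using closure_of_subset_topspace[of "finite_seminorm_Ck_top \<alpha> k"]
    distance_topology.topspace_T[OF distance_topology_Ck]
  by (auto simp: Ck_alpha_def)

lemma Ck_alpha_approx:
  assumes "f \<in> Ck_alpha \<alpha> k" "finite J" "J \<subseteq> {0<..} \<times> {..k}" "0 < \<epsilon>"
  shows "\<exists>p. \<forall>(r, i)\<in>J. norm_dist \<alpha> r (Suc i)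
    (mpoly_fun (Suc i) (divided_difference_mpoly p i)) (divided_difference f i) < ennreal \<epsilon>"
  using distance_topology.closure_approx[OF distance_topology_Ck assms(1)[unfolded Ck_alpha_def] assms(2-4)]
  by (auto simp: mpoly_fun_divided_difference_mpoly)

lemma divided_difference_C_alpha:
  assumes f: "f \<in> Ck_alpha \<alpha> k" and i: "i \<le> k"
  shows "divided_difference f i \<in> C_alpha \<alpha> (Suc i)"
proof -
  interpret cube_norms \<alpha> "Suc i" by (rule cube_norms_Suc)
  have fV: "f \<in> finite_seminorm_Ck \<alpha> k" by (rule Ck_alpha_finite[OF f])
  show ?thesis
    unfolding C_alpha_def
  proof (rule closure_ofI[OF _ polys_subset])
    have "Ck_real i f" using fV i Ck_real_mono by (auto simp: finite_seminorm_Ck_def)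
    then show "divided_difference f i \<in> V"
      using fV i divided_difference_Cfun by (auto simp: finite_seminorm_Ck_def finite_seminorm_funs_def)
    fix J :: "real set" and \<epsilon> :: real assume J: "finite J" "J \<subseteq> {0<..}" "0 < \<epsilon>"
    then obtain p where "\<forall>(r, i)\<in>J \<times> {i}. norm_dist \<alpha> r (Suc i)
        (mpoly_fun (Suc i) (divided_difference_mpoly p i)) (divided_difference f i) < ennreal \<epsilon>"
      using Ck_alpha_approx[OF f, of "J \<times> {i}" \<epsilon>] i by auto
    then show "\<exists>\<psi>\<in>mpoly_fun (Suc i) ` mpolys (Suc i). \<forall>r\<in>J. norm_dist \<alpha> r (Suc i) \<psi> (divided_difference f i) < ennreal \<epsilon>"
      by (intro bexI[of _ "mpoly_fun (Suc i) (divided_difference_mpoly p i)"] imageI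
          divided_difference_mpoly_in_mpolys) auto
  qed
qed

end

lemma mpoly_tensor_cong:
  assumes "\<And>j. j < m - 1 \<Longrightarrow> b j = b' j"
  shows "mpoly_tensor m P a b = mpoly_tensor m P a b'"
proof -
  have "map (\<lambda>i. a i ^ Poly_Mapping.lookup \<delta> i * b i) [0..<m - 1] =
      map (\<lambda>i. a i ^ Poly_Mapping.lookup \<delta> i * b' i) [0..<m - 1]" for \<delta>
    by (rule map_cong) (use assms in auto)
  then show ?thesis by (simp only: mpoly_tensor_def)
qed

lemma lex_calculus_cong:
  assumes "\<And>j. j < m - 1 \<Longrightarrow> b j = b' j"
  shows "lex_calculus \<alpha> m \<phi> a b = lex_calculus \<alpha> m \<phi> a b'"
  using mpoly_tensor_cong[OF assms] by (simp add: lex_calculus_def lex_extension_def)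

section \<open>Approximation of \<open>f(a)\<close> and of its derivatives by those of polynomials\<close>

text \<open>The parameter \<open>A\<close> names the algebra, which the family of norms does not determine.\<close>

locale lex_norms = polynomial_norms \<alpha> for \<alpha> +
  fixes A :: "'a :: cstar_algebra itself"
  assumes sup_norm: "\<And>r \<phi>. 0 < r \<Longrightarrow> \<phi> \<in> Cfun (cube r 1) \<Longrightarrow>
      \<alpha> r 1 \<phi> = (SUP s\<in>cube r 1. ennreal (cmod (\<phi> s)))"
    and tensor_bound: "\<And>m P (b :: nat \<Rightarrow> 'a) r. 2 \<le> m \<Longrightarrow> P \<in> mpolys m \<Longrightarrow> 0 < r \<Longrightarrow>
      (SUP a\<in>{a. \<forall>i<m. star (a i) = a i \<and> norm (a i) \<le> r}. ennreal (norm (mpoly_tensor m P a b)))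
      \<le> seminorm \<alpha> r m (mpoly_fun m P) * (\<Prod>i<m - 1. ennreal (norm (b i)))"
begin

text \<open>The asserted derivatives of \<open>f(a)\<close>. The bound on tensor evaluations starts with two variables,
  so that the zeroth derivative relies on the continuous functional calculus instead.\<close>

definition lex_jet :: "(real \<Rightarrow> complex) \<Rightarrow> nat \<Rightarrow> 'a sa \<Rightarrow> (nat \<Rightarrow> 'a sa) \<Rightarrow> 'a"
  where "lex_jet f i a b = (if i = 0 then op_fun f a else
    \<Sum>\<pi> | \<pi> permutes {..<i}. lex_calculus \<alpha> (Suc i) (divided_difference f i)
      (\<lambda>_. sa_elem a) (\<lambda>j. sa_elem (b (\<pi> j))))"

lemma lex_calculus_dist_poly:
  fixes a :: "'a sa" and b :: "nat \<Rightarrow> 'a"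
  assumes f: "f \<in> Ck_alpha \<alpha> k" and i: "1 \<le> i" "i \<le> k" and r: "0 < r" "norm a \<le> r" and e: "0 < e"
    and approx: "norm_dist \<alpha> r (Suc i) (mpoly_fun (Suc i) (divided_difference_mpoly p i)) (divided_difference f i) < ennreal e"
  shows "norm (lex_calculus \<alpha> (Suc i) (divided_difference f i) (\<lambda>_. sa_elem a) b -
    poly_word_sum p (sa_elem a) (map b [0..<i])) \<le> e * prod_norm i b"
proof -
  define C where "C = prod_norm i b"
  have C: "0 \<le> C" by (simp add: C_def prod_nonneg)
  interpret L: lex_point \<alpha> "Suc i" "\<lambda>_. sa_elem a" b r C
  proof (unfold_locales)
    fix P assume P: "P \<in> mpolys (Suc i)"
    have "ennreal (norm (mpoly_tensor (Suc i) P (\<lambda>_. sa_elem a) b)) \<le>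
        (SUP a\<in>{a. \<forall>j<Suc i. star (a j) = a j \<and> norm (a j) \<le> r}. ennreal (norm (mpoly_tensor (Suc i) P a b)))"
      by (rule SUP_upper) (use r in simp)
    also have "\<dots> \<le> seminorm \<alpha> r (Suc i) (mpoly_fun (Suc i) P) * (\<Prod>j<Suc i - 1. ennreal (norm (b j)))"
      by (rule tensor_bound) (use i P r in auto)
    also have "(\<Prod>j<Suc i - 1. ennreal (norm (b j))) = ennreal C" by (simp add: C_def prod_ennreal)
    finally show "ennreal (norm (mpoly_tensor (Suc i) P (\<lambda>_. sa_elem a) b)) \<le>
        seminorm \<alpha> r (Suc i) (mpoly_fun (Suc i) P) * ennreal C" .
  qed (use r C all_norms polys_subset in auto)
  let ?Q = "divided_difference_mpoly p i" and ?\<phi> = "divided_difference f i"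
  have Q: "?Q \<in> mpolys (Suc i)" by (rule divided_difference_mpoly_in_mpolys)
  have \<phi>: "?\<phi> \<in> C_alpha \<alpha> (Suc i)" by (rule divided_difference_C_alpha[OF f i(2)])
  have "L.rdist (mpoly_fun (Suc i) ?Q) ?\<phi> < e"
    using approx e by (simp add: L.ennreal_rdist L.poly_in_V[OF Q] L.CA_V[OF \<phi>] ennreal_less_iff)
  then have "L.rdist ?\<phi> (mpoly_fun (Suc i) ?Q) \<le> e"
    using L.rdist_commute[OF L.poly_in_V[OF Q] L.CA_V[OF \<phi>]] by simp
  then have "C * L.rdist ?\<phi> (mpoly_fun (Suc i) ?Q) \<le> C * e" using C by (rule mult_left_mono)
  moreover have "norm (lex_calculus \<alpha> (Suc i) ?\<phi> (\<lambda>_. sa_elem a) b - mpoly_tensor (Suc i) ?Q (\<lambda>_. sa_elem a) b)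
      \<le> C * L.rdist ?\<phi> (mpoly_fun (Suc i) ?Q)"
    unfolding L.lex_calculus_eq_extension[OF \<phi>] by (rule L.extension_dist_poly[OF \<phi> Q])
  ultimately show ?thesis
    unfolding mpoly_tensor_divided_difference_mpoly C_def by (simp add: mult.commute)
qed

lemma op_fun_dist_poly:
  fixes a :: "'a sa"
  assumes f: "f \<in> Ck_alpha \<alpha> k" and r: "0 < r" "norm a \<le> r" and e: "0 < e"
    and approx: "norm_dist \<alpha> r 1 (mpoly_fun 1 (divided_difference_mpoly p 0)) (divided_difference f 0) < ennreal e"
  shows "norm (op_fun f a - alg_eval p (sa_elem a)) \<le> e"
proof (rule op_fun_dist_alg_eval)
  show cont: "continuous_on UNIV f"
    using Ck_alpha_finite[OF f] Ck_real_continuous by (auto simp: finite_seminorm_Ck_def)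
  have contp: "continuous_on UNIV (\<lambda>x. poly p (complex_of_real x))" by (intro continuous_intros)
  define g where "g = (\<lambda>s\<in>cube r 1. poly p (complex_of_real (s 0)) - f (s 0))"
  have coord: "continuous_on (cube r 1) (\<lambda>s. s 0)"
    by (rule continuous_on_subset[OF continuous_on_product_coordinates]) simp
  have g: "g \<in> Cfun (cube r 1)"
    unfolding g_def
    by (intro Cfun_restrictI continuous_intros continuous_on_compose2[OF cont coord] coord) auto
  have "norm_dist \<alpha> r 1 (mpoly_fun 1 (divided_difference_mpoly p 0)) (divided_difference f 0) = \<alpha> r 1 g"
    using mpoly_fun_divided_difference_mpoly[of 0 p] cube_subset_rspace[of r 1]
    unfolding norm_dist_def seminorm_def g_def
    by (intro arg_cong[where f = "\<alpha> r 1"])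
      (auto simp: divided_difference_0[OF cont] divided_difference_0[OF contp] restrict_def fun_eq_iff)
  then have sup: "(SUP s\<in>cube r 1. ennreal (cmod (g s))) < ennreal e"
    using approx sup_norm[OF r(1) g] by simp
  fix x assume x: "\<bar>x\<bar> \<le> r"
  define s where "s = (\<lambda>j\<in>{..<1 :: nat}. x)"
  have s: "s \<in> cube r 1" using x by (auto simp: s_def cube_def)
  have "ennreal (cmod (g s)) < ennreal e" using SUP_upper[OF s] sup by (rule order.strict_trans1)
  then have "cmod (g s) < e" using e by (simp add: ennreal_less_iff)
  moreover have "g s = poly p (complex_of_real x) - f x" using s by (simp add: g_def s_def)
  ultimately show "cmod (f x - poly p (complex_of_real x)) \<le> e" by (simp add: norm_minus_commute)
qed (use r e in auto)

text \<open>One polynomial approximates \<open>f\<close> and all its divided differences up to order \<open>k\<close> in the norms of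
  radius \<open>r\<close>, and this bounds the errors of all derivatives on the ball of radius \<open>r\<close>. The
  denominator \<open>fact k\<close> accounts for the number of permutations. The norms of different radii are not
  assumed to be comparable, so the polynomial depends on \<open>r\<close>.\<close>

lemma lex_jet_approx:
  assumes f: "f \<in> Ck_alpha \<alpha> k" and r: "0 < r" and \<epsilon>: "0 < \<epsilon>"
  shows "\<exists>p. \<forall>i\<le>k. \<forall>(a :: 'a sa) b. norm a \<le> r \<longrightarrow>
    norm (lex_jet f i a b - poly_jet p i a b) \<le> \<epsilon> * prod_norm i b"
proof -
  define e where "e = \<epsilon> / fact k"
  have e: "0 < e" using \<epsilon> by (simp add: e_def)
  have fact_e: "fact i * e \<le> \<epsilon>" if "i \<le> k" for i
  proof -
    have "fact i * e \<le> fact k * e" using e that by (intro mult_right_mono fact_mono) auto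
    then show ?thesis by (simp add: e_def)
  qed
  obtain p where "\<forall>(r, i)\<in>{r} \<times> {..k}. norm_dist \<alpha> r (Suc i)
      (mpoly_fun (Suc i) (divided_difference_mpoly p i)) (divided_difference f i) < ennreal e"
    using Ck_alpha_approx[OF f, of "{r} \<times> {..k}" e] r e by auto
  then have p: "norm_dist \<alpha> r (Suc i)
      (mpoly_fun (Suc i) (divided_difference_mpoly p i)) (divided_difference f i) < ennreal e" if "i \<le> k" for i
    using that by auto
  have "norm (lex_jet f i a b - poly_jet p i a b) \<le> \<epsilon> * prod_norm i b"
    if i: "i \<le> k" and a: "norm a \<le> r" for i and a :: "'a sa" and b
  proof (cases "i = 0")
    case True
    have "norm (op_fun f a - alg_eval p (sa_elem a)) \<le> e"
      by (rule op_fun_dist_poly[OF f r a e]) (use p[of 0] in simp)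
    then show ?thesis using fact_e[of 0] True by (simp add: lex_jet_def poly_jet_0)
  next
    case False
    let ?P = "\<Prod>j<i. norm (b j)"
    have "lex_jet f i a b - poly_jet p i a b = (\<Sum>\<pi> | \<pi> permutes {..<i}.
        lex_calculus \<alpha> (Suc i) (divided_difference f i) (\<lambda>_. sa_elem a) (\<lambda>j. sa_elem (b (\<pi> j))) -
        poly_word_sum p (sa_elem a) (permuted_dirs i b \<pi>))"
      using False by (simp add: lex_jet_def poly_jet_def sum_subtractf)
    also have "norm \<dots> \<le> (\<Sum>\<pi> | \<pi> permutes {..<i}. e * ?P)"
    proof (rule sum_norm_le)
      fix \<pi> assume "\<pi> \<in> {\<pi>. \<pi> permutes {..<i}}"
      then have \<pi>: "\<pi> permutes {..<i}" by simp
      have "norm (lex_calculus \<alpha> (Suc i) (divided_difference f i) (\<lambda>_. sa_elem a) (\<lambda>j. sa_elem (b (\<pi> j))) -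
          poly_word_sum p (sa_elem a) (permuted_dirs i b \<pi>))
          \<le> e * (\<Prod>j<i. norm (sa_elem (b (\<pi> j))))"
        by (rule lex_calculus_dist_poly[OF f _ i r a e p[OF i]]) (use False in simp)
      also have "(\<Prod>j<i. norm (sa_elem (b (\<pi> j)))) = ?P"
        using prod_permutes[OF \<pi>, of "\<lambda>j. norm (b j)"] by simp
      finally show "norm (lex_calculus \<alpha> (Suc i) (divided_difference f i) (\<lambda>_. sa_elem a) (\<lambda>j. sa_elem (b (\<pi> j))) -
          poly_word_sum p (sa_elem a) (permuted_dirs i b \<pi>)) \<le> e * ?P" .
    qed
    also have "\<dots> = (fact i * e) * ?P" by (simp add: card_permutations)
    also have "\<dots> \<le> \<epsilon> * ?P" by (intro mult_right_mono fact_e i prod_nonneg) auto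
    finally show ?thesis .
  qed
  then show ?thesis by blast
qed

theorem jet_limit_lex_jet:
  assumes "f \<in> Ck_alpha \<alpha> k"
  shows "jet_limit k (lex_jet f)"
proof
  fix r \<epsilon> :: real assume "0 < r" "0 < \<epsilon>"
  then obtain p where "\<forall>i\<le>k. \<forall>(a :: 'a sa) b. norm a \<le> r \<longrightarrow>
      norm (lex_jet f i a b - poly_jet p i a b) \<le> \<epsilon> * prod_norm i b"
    using lex_jet_approx[OF assms] by blast
  then show "\<exists>E. smooth_jet E \<and> (\<forall>i\<le>k. \<forall>(a :: 'a sa) b. norm a \<le> r \<longrightarrow>
      norm (lex_jet f i a b - E i a b) \<le> \<epsilon> * prod_norm i b)"
    using smooth_jet_poly[of p] by blast
qed

end

section \<open>Differentiability of \<open>f(a)\<close>\<close>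

lemma reversal_permutes: "(\<lambda>j. if j < k then k - Suc j else j) permutes {..<k :: nat}"
  by (rule bij_imp_permutes) (auto intro!: bij_betw_byWitness[where f' = "\<lambda>j. k - Suc j"])

theorem theorem1p13:
  fixes \<alpha> :: norm_family
    and k :: nat
    and f :: "real \<Rightarrow> complex"
  assumes "1 \<le> k"
    and "\<And>r m. 0 < r \<Longrightarrow> 1 \<le> m \<Longrightarrow> inf_norm_on (cube r m) (\<alpha> r m)"
    and "\<And>r \<phi>. 0 < r \<Longrightarrow> \<phi> \<in> Cfun (cube r 1) \<Longrightarrow>
          \<alpha> r 1 \<phi> = (SUP s\<in>cube r 1. ennreal (cmod (\<phi> s)))"
    and "finite_on_polynomials \<alpha>"
    and "\<And>m P (b :: nat \<Rightarrow> 'a :: cstar_algebra) r. 2 \<le> m \<Longrightarrow> P \<in> mpolys m \<Longrightarrow> 0 < r \<Longrightarrow>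
          (SUP a\<in>{a. \<forall>i<m. star (a i) = a i \<and> norm (a i) \<le> r}.
             ennreal (norm (mpoly_tensor m P a b)))
          \<le> seminorm \<alpha> r m (mpoly_fun m P) * (\<Prod>i<m - 1. ennreal (norm (b i)))"
    and "f \<in> Ck_alpha \<alpha> k"
  shows "Ck_frechet k (op_fun f :: 'a sa \<Rightarrow> 'a) \<and>
    (\<forall>(a :: 'a sa) (b :: nat \<Rightarrow> 'a sa).
      iter_dir_deriv k b (op_fun f) a =
      (\<Sum>\<pi> | \<pi> permutes {..<k}.
        lex_calculus \<alpha> (Suc k) (divided_difference f k)
          (\<lambda>_. sa_elem a) (\<lambda>i. sa_elem (b (\<pi> i)))))"
proof -
  interpret lex_norms \<alpha> "TYPE('a)"
    by unfold_locales (use assms(2-5) in auto)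
  interpret jet_limit k "lex_jet f"
    by (rule jet_limit_lex_jet[OF assms(6)])
  have D0: "lex_jet f 0 a b = op_fun f a" for a b by (simp add: lex_jet_def)
  have "iter_dir_deriv k b (op_fun f) a = (\<Sum>\<pi> | \<pi> permutes {..<k}.
      lex_calculus \<alpha> (Suc k) (divided_difference f k) (\<lambda>_. sa_elem a) (\<lambda>i. sa_elem (b (\<pi> i))))"
    for a :: "'a sa" and b
  proof -
    let ?G = "\<lambda>\<pi>. lex_calculus \<alpha> (Suc k) (divided_difference f k) (\<lambda>_. sa_elem a) (\<lambda>i. sa_elem (b (\<pi> i)))"
    let ?\<rho> = "\<lambda>j. if j < k then k - Suc j else j"
    have "iter_dir_deriv k b (op_fun f) a = lex_jet f k a (\<lambda>j. b (k - Suc j))"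
      by (simp add: iter_dir_deriv_limit[OF D0])
    also have "\<dots> = (\<Sum>\<pi> | \<pi> permutes {..<k}. lex_calculus \<alpha> (Suc k) (divided_difference f k)
        (\<lambda>_. sa_elem a) (\<lambda>i. sa_elem (b (k - Suc (\<pi> i)))))"
      using assms(1) by (simp add: lex_jet_def)
    also have "\<dots> = (\<Sum>\<pi> | \<pi> permutes {..<k}. ?G (?\<rho> \<circ> \<pi>))"
    proof (rule sum.cong[OF refl])
      fix \<pi> assume "\<pi> \<in> {\<pi>. \<pi> permutes {..<k}}"
      then have "\<pi> j < k" if "j < k" for j using permutes_in_image[of \<pi> "{..<k}" j] that by simp
      then show "lex_calculus \<alpha> (Suc k) (divided_difference f k) (\<lambda>_. sa_elem a) (\<lambda>i. sa_elem (b (k - Suc (\<pi> i)))) =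
          ?G (?\<rho> \<circ> \<pi>)"
        by (intro lex_calculus_cong) simp
    qed
    also have "\<dots> = (\<Sum>\<pi> | \<pi> permutes {..<k}. ?G \<pi>)"
      by (rule setum_permutations_compose_left[OF reversal_permutes, symmetric])
    finally show ?thesis .
  qed
  then show ?thesis using Ck_frechet_limit[OF D0] by blast
qed

end
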